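(* Let $\mathcal H$ be a multiplicative representation. There is a constant $A\ge0$ (depending only on $\mathcal H$) such that for every $K$-invariant $\alpha\in\mathcal H^{\mathrm{fin}}$, $$\|\alpha\|_{L^4}\le\|\exp(A\log_+^2\Delta)\alpha\|_{\mathcal H}.$$
   Context: $G=\mathrm{PSL}_2(\mathbf R)$, $K=\mathrm{PSO}_2(\mathbf R)$, $\mathfrak g=\mathfrak{sl}_2(\mathbf C)$, $H=\frac1{2i}\begin{pmatrix}0&1\\-1&0\end{pmatrix}$, $E=\frac12\begin{pmatrix}1&i\\i&-1\end{pmatrix}$, $\bar E$ its complex conjugate; Casimir $\Delta=-H^2-\frac12(E\bar E+\bar EE)$. A multiplicative representation is a unitary $G$-representation $\mathcal H$ with discrete spectrum (Hilbert sum of irreducibles, finitely many with Casimir eigenvalue in any bounded set), with $\mathcal H^{\rm fin}$ the algebraic sum of $K$-finite vectors of the summands, together with a bilinear map $\mathcal H^{\rm fin}\times\mathcal H^{\rm fin}\to\mathcal H^\infty$ (smooth vectors) that is commutative, has a unit $\mathbf 1$ of norm $1$ with $\mathcal H^G=\mathbf C\mathbf 1$, obeys $X(\alpha\beta)=(X\alpha)\beta+\alpha(X\beta)$ for $X\in\mathfrak g$, admits conjugates $\bar\alpha\in\mathcal H^{\rm fin}$ with $\langle\alpha\beta,\gamma\rangle=\langle\beta,\bar\alpha\gamma\rangle$, and satisfies $\langle\alpha_1\alpha_2,\bar\alpha_3\bar\alpha_4\rangle=\langle\alpha_{\sigma(1)}\alpha_{\sigma(2)},\bar\alpha_{\sigma(3)}\bar\alpha_{\sigma(4)}\rangle$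 for $\sigma\in S_4$. $\|\alpha\|_{L^4}=\|\alpha\alpha\|_{\mathcal H}^{1/2}$. $\mathbf 1_{\Delta=\lambda}$ is the orthogonal projection onto the closure of the $\lambda$-eigenspace of $\Delta$ on smooth vectors; $\|f(\Delta)v\|=(\sum_\lambda|f(\lambda)|^2\|\mathbf 1_{\Delta=\lambda}v\|^2)^{1/2}$. $\log_+(x)=\log\max\{x,2\}$. *)

theory Defs
  imports "HOL-Analysis.Analysis"
begin

text \<open>A complex Hilbert space is a real Hilbert space (real inner product = real part of
the complex one) together with J = multiplication by i, a real-linear orthogonal map with
J J = -id.\<close>

definition complex_structure :: "('h::{real_inner,complete_space} \<Rightarrow> 'h) \<Rightarrow> bool" where
  "complex_structure J \<longleftrightarrow> linear J \<and> (\<forall>x. J (J x) = - x) \<and>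
     (\<forall>x y. inner (J x) (J y) = inner x y)"

definition cscale :: "('h::real_vector \<Rightarrow> 'h) \<Rightarrow> complex \<Rightarrow> 'h \<Rightarrow> 'h" where
  "cscale J z x = Re z *\<^sub>R x + Im z *\<^sub>R J x"

text \<open>complex inner product, linear in the first and conjugate-linear in the second slot\<close>
definition cinner :: "('h::real_inner \<Rightarrow> 'h) \<Rightarrow> 'h \<Rightarrow> 'h \<Rightarrow> complex" where
  "cinner J x y = Complex (inner x y) (inner x (J y))"

section \<open>The group PSL2(R), realised on SL2(R) with pi(-g) = pi(g)\<close>

definition mat2 :: "real \<Rightarrow> real \<Rightarrow> real \<Rightarrow> real \<Rightarrow> real^2^2" where
  "mat2 a b c d = (\<chi> i j. if i = 1 then (if j = 1 then a else b) else (if j = 1 then c else d))"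

definition SL2 :: "(real^2^2) set" where
  "SL2 = {g. det g = 1}"

text \<open>one-parameter subgroups exp(tX) for the real basis X_K = [[0,1],[-1,0]],
X_A = [[1,0],[0,-1]], X_S = [[0,1],[1,0]] of sl2(R), and the unipotent group N\<close>
definition kmat :: "real \<Rightarrow> real^2^2" where "kmat t = mat2 (cos t) (sin t) (- sin t) (cos t)"
definition amat :: "real \<Rightarrow> real^2^2" where "amat t = mat2 (exp t) 0 0 (exp (- t))"
definition smat :: "real \<Rightarrow> real^2^2" where "smat t = mat2 (cosh t) (sinh t) (sinh t) (cosh t)"
definition nmat :: "real \<Rightarrow> real^2^2" where "nmat t = mat2 1 t 0 1"

text \<open>Iwasawa coordinates R^3 \<rightarrow> SL2(R), (x,y,theta) \<mapsto> n(x) a(y) k(theta): a surjective local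
diffeomorphism, used to define smoothness of orbit maps\<close>
definition iw :: "real^3 \<Rightarrow> real^2^2" where
  "iw x = nmat (x$1) ** amat (x$2) ** kmat (x$3)"

definition unitary_rep :: "('h::{real_inner,complete_space} \<Rightarrow> 'h) \<Rightarrow> (real^2^2 \<Rightarrow> 'h \<Rightarrow> 'h) \<Rightarrow> bool" where
  "unitary_rep J \<pi> \<longleftrightarrow>
     (\<forall>g\<in>SL2. linear (\<pi> g) \<and> (\<forall>x. \<pi> g (J x) = J (\<pi> g x)) \<and>
        (\<forall>x y. inner (\<pi> g x) (\<pi> g y) = inner x y) \<and> surj (\<pi> g)) \<and>
     \<pi> (mat 1) = id \<and>
     (\<forall>g\<in>SL2. \<forall>h\<in>SL2. \<pi> (g ** h) = \<pi> g \<circ> \<pi> h) \<and>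
     (\<forall>g\<in>SL2. \<pi> (- g) = \<pi> g) \<and>
     (\<forall>v. continuous_on SL2 (\<lambda>g. \<pi> g v))"

definition pd :: "3 \<Rightarrow> (real^3 \<Rightarrow> 'h::real_normed_vector) \<Rightarrow> real^3 \<Rightarrow> 'h" where
  "pd i F x = vector_derivative (\<lambda>t. F (x + t *\<^sub>R axis i 1)) (at 0)"

definition C_inf :: "(real^3 \<Rightarrow> 'h::real_normed_vector) \<Rightarrow> bool" where
  "C_inf F \<longleftrightarrow> (\<forall>is. continuous_on UNIV (fold pd is F) \<and>
      (\<forall>i x. (\<lambda>t. fold pd is F (x + t *\<^sub>R axis i 1)) differentiable (at 0)))"

definition smoothvec :: "(real^2^2 \<Rightarrow> 'h::real_normed_vector \<Rightarrow> 'h) \<Rightarrow> 'h \<Rightarrow> bool" where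
  "smoothvec \<pi> v \<longleftrightarrow> C_inf (\<lambda>x. \<pi> (iw x) v)"

definition dvec :: "(real^2^2 \<Rightarrow> 'h::real_normed_vector \<Rightarrow> 'h) \<Rightarrow> (real \<Rightarrow> real^2^2) \<Rightarrow> 'h \<Rightarrow> 'h" where
  "dvec \<pi> \<gamma> v = vector_derivative (\<lambda>t. \<pi> (\<gamma> t) v) (at 0)"

text \<open>an element (c1,c2,c3) of g = sl2(C) stands for c1 X_K + c2 X_A + c3 X_S\<close>
definition lie :: "('h::real_normed_vector \<Rightarrow> 'h) \<Rightarrow> (real^2^2 \<Rightarrow> 'h \<Rightarrow> 'h) \<Rightarrow> complex \<times> complex \<times> complex \<Rightarrow> 'h \<Rightarrow> 'h" where
  "lie J \<pi> X v = (case X of (c1, c2, c3) \<Rightarrow>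
      cscale J c1 (dvec \<pi> kmat v) + cscale J c2 (dvec \<pi> amat v) + cscale J c3 (dvec \<pi> smat v))"

definition H_el :: "complex \<times> complex \<times> complex" where "H_el = (1 / (2 * \<i>), 0, 0)"
definition E_el :: "complex \<times> complex \<times> complex" where "E_el = (0, 1/2, \<i>/2)"
definition Ebar_el :: "complex \<times> complex \<times> complex" where "Ebar_el = (0, 1/2, - \<i>/2)"

definition Casimir :: "('h::real_normed_vector \<Rightarrow> 'h) \<Rightarrow> (real^2^2 \<Rightarrow> 'h \<Rightarrow> 'h) \<Rightarrow> 'h \<Rightarrow> 'h" where
  "Casimir J \<pi> v = - lie J \<pi> H_el (lie J \<pi> H_el v)
     - (1/2) *\<^sub>R (lie J \<pi> E_el (lie J \<pi> Ebar_el v) + lie J \<pi> Ebar_el (lie J \<pi> E_el v))"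

definition K_invariant :: "(real^2^2 \<Rightarrow> 'h \<Rightarrow> 'h) \<Rightarrow> 'h \<Rightarrow> bool" where
  "K_invariant \<pi> v \<longleftrightarrow> (\<forall>t. \<pi> (kmat t) v = v)"

definition K_finite :: "('h::real_vector \<Rightarrow> 'h) \<Rightarrow> (real^2^2 \<Rightarrow> 'h \<Rightarrow> 'h) \<Rightarrow> 'h \<Rightarrow> bool" where
  "K_finite J \<pi> v \<longleftrightarrow> (\<exists>B. finite B \<and> (\<forall>t. \<pi> (kmat t) v \<in> span (B \<union> J ` B)))"

definition inv_subspace :: "('h::{real_inner,complete_space} \<Rightarrow> 'h) \<Rightarrow> (real^2^2 \<Rightarrow> 'h \<Rightarrow> 'h) \<Rightarrow> 'h set \<Rightarrow> bool" where
  "inv_subspace J \<pi> V \<longleftrightarrow> closed V \<and> subspace V \<and> J ` V \<subseteq> V \<and> (\<forall>g\<in>SL2. \<pi> g ` V \<subseteq> V)"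

definition irreducible_sub :: "('h::{real_inner,complete_space} \<Rightarrow> 'h) \<Rightarrow> (real^2^2 \<Rightarrow> 'h \<Rightarrow> 'h) \<Rightarrow> 'h set \<Rightarrow> bool" where
  "irreducible_sub J \<pi> V \<longleftrightarrow> inv_subspace J \<pi> V \<and> V \<noteq> {0} \<and>
     (\<forall>W. inv_subspace J \<pi> W \<and> W \<subseteq> V \<longrightarrow> W = {0} \<or> W = V)"

definition discrete_decomp :: "('h::{real_inner,complete_space} \<Rightarrow> 'h) \<Rightarrow> (real^2^2 \<Rightarrow> 'h \<Rightarrow> 'h) \<Rightarrow> 'h set set \<Rightarrow> bool" where
  "discrete_decomp J \<pi> \<V> \<longleftrightarrow>
     (\<forall>V\<in>\<V>. irreducible_sub J \<pi> V) \<and>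
     (\<forall>V\<in>\<V>. \<forall>W\<in>\<V>. V \<noteq> W \<longrightarrow> (\<forall>v\<in>V. \<forall>w\<in>W. inner v w = 0)) \<and>
     closure (span (\<Union>\<V>)) = UNIV \<and>
     (\<forall>B::real. finite {V\<in>\<V>. \<exists>c. cmod c \<le> B \<and>
                    (\<forall>v\<in>V. smoothvec \<pi> v \<longrightarrow> Casimir J \<pi> v = cscale J c v)})"

definition Hfin :: "('h::real_vector \<Rightarrow> 'h) \<Rightarrow> (real^2^2 \<Rightarrow> 'h \<Rightarrow> 'h) \<Rightarrow> 'h set set \<Rightarrow> 'h set" where
  "Hfin J \<pi> \<V> = span (\<Union>V\<in>\<V>. {v\<in>V. K_finite J \<pi> v})"

definition multiplicative_rep ::
  "('h::{real_inner,complete_space} \<Rightarrow> 'h) \<Rightarrow> (real^2^2 \<Rightarrow> 'h \<Rightarrow> 'h) \<Rightarrow> 'h set set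
   \<Rightarrow> ('h \<Rightarrow> 'h \<Rightarrow> 'h) \<Rightarrow> 'h \<Rightarrow> ('h \<Rightarrow> 'h) \<Rightarrow> bool" where
  "multiplicative_rep J \<pi> \<V> m one cj \<longleftrightarrow>
     complex_structure J \<and> unitary_rep J \<pi> \<and> discrete_decomp J \<pi> \<V> \<and>
     (\<forall>a\<in>Hfin J \<pi> \<V>. \<forall>b\<in>Hfin J \<pi> \<V>. smoothvec \<pi> (m a b)) \<and>
     (\<forall>a\<in>Hfin J \<pi> \<V>. \<forall>b\<in>Hfin J \<pi> \<V>. \<forall>c\<in>Hfin J \<pi> \<V>. m (a + b) c = m a c + m b c) \<and>
     (\<forall>a\<in>Hfin J \<pi> \<V>. \<forall>b\<in>Hfin J \<pi> \<V>. \<forall>z. m (cscale J z a) b = cscale J z (m a b)) \<and>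
     (\<forall>a\<in>Hfin J \<pi> \<V>. \<forall>b\<in>Hfin J \<pi> \<V>. m a b = m b a) \<and>
     one \<in> Hfin J \<pi> \<V> \<and> norm one = 1 \<and> (\<forall>a\<in>Hfin J \<pi> \<V>. m one a = a) \<and>
     {v. \<forall>g\<in>SL2. \<pi> g v = v} = range (\<lambda>z. cscale J z one) \<and>
     (\<forall>X. \<forall>a\<in>Hfin J \<pi> \<V>. \<forall>b\<in>Hfin J \<pi> \<V>.
        lie J \<pi> X (m a b) = m (lie J \<pi> X a) b + m a (lie J \<pi> X b)) \<and>
     (\<forall>a\<in>Hfin J \<pi> \<V>. cj a \<in> Hfin J \<pi> \<V> \<and>
        (\<forall>b\<in>Hfin J \<pi> \<V>. \<forall>c\<in>Hfin J \<pi> \<V>. cinner J (m a b) c = cinner J b (m (cj a) c))) \<and>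
     (\<forall>\<sigma> f. \<sigma> permutes {..<4::nat} \<longrightarrow> (\<forall>i<4. f i \<in> Hfin J \<pi> \<V>) \<longrightarrow>
        cinner J (m (f (\<sigma> 0)) (f (\<sigma> 1))) (m (cj (f (\<sigma> 2))) (cj (f (\<sigma> 3))))
        = cinner J (m (f 0) (f 1)) (m (cj (f 2)) (cj (f 3))))"

definition L4norm :: "('h::real_normed_vector \<Rightarrow> 'h \<Rightarrow> 'h) \<Rightarrow> 'h \<Rightarrow> real" where
  "L4norm m a = sqrt (norm (m a a))"

definition eigproj :: "('h::{real_inner,complete_space} \<Rightarrow> 'h) \<Rightarrow> (real^2^2 \<Rightarrow> 'h \<Rightarrow> 'h) \<Rightarrow> real \<Rightarrow> 'h \<Rightarrow> 'h" where
  "eigproj J \<pi> l v = (let S = closure {w. smoothvec \<pi> w \<and> Casimir J \<pi> w = l *\<^sub>R w}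
     in THE p. p \<in> S \<and> (\<forall>u\<in>S. inner (v - p) u = 0))"

definition log_plus :: "real \<Rightarrow> real" where
  "log_plus x = ln (max x 2)"

definition fDelta_norm_sq :: "('h::{real_inner,complete_space} \<Rightarrow> 'h) \<Rightarrow> (real^2^2 \<Rightarrow> 'h \<Rightarrow> 'h) \<Rightarrow> (real \<Rightarrow> real) \<Rightarrow> 'h \<Rightarrow> ennreal" where
  "fDelta_norm_sq J \<pi> f v = (\<Sum>\<^sub>\<infinity>l\<in>UNIV. ennreal ((\<bar>f l\<bar>)\<^sup>2 * (norm (eigproj J \<pi> l v))\<^sup>2))"

end

theory Submission
  imports Defs
begin

text \<open>Write \<open>N \<alpha>\<close> for the \<open>L\<^sup>4\<close> norm. Crossing symmetry gives \<open>\<parallel>\<alpha>\<beta>\<parallel> \<le> N \<alpha> * N \<beta>\<close>, so \<open>N\<close> is a norm, and it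
gives \<open>\<langle>E\<^sup>n\<beta> * conj (E\<^sup>n\<beta>), \<beta>\<^sup>2\<rangle> = \<parallel>E\<^sup>n\<beta> * \<beta>\<parallel>\<^sup>2 \<ge> 0\<close> for real K-invariant \<open>\<beta>\<close>. If all eigenvalues occurring
in \<open>\<beta>\<close> are close to \<open>\<Lambda>\<close>, the Leibniz rule turns \<open>E\<^sup>n\<beta> * conj (E\<^sup>n\<beta>)\<close> into \<open>\<Lambda>\<^sup>n * p\<^sub>n(\<Delta>/\<Lambda>) \<beta>\<^sup>2\<close> up to small errors,
where \<open>p\<^sub>n(s)\<close> is the Chebyshev polynomial \<open>T\<^sub>n(1 - s/2)\<close>. The combination \<open>2p\<^sub>1 + p\<^sub>2 + p\<^sub>3 = - (s-1)(s-3)\<^sup>2/2 - 1/2\<close>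
is negative for \<open>s \<ge> 1\<close>, hence \<open>\<beta>\<^sup>2\<close> must have a definite proportion of its mass in the spectral projection \<open>g\<close> to
eigenvalues at most \<open>\<Lambda>\<close>. Since \<open>\<parallel>g\<parallel>\<^sup>2 = \<langle>\<beta>, \<beta>g\<rangle> \<le> \<parallel>\<beta>\<parallel> * N \<beta> * N g\<close>, a bound for \<open>N\<close> on eigenvalues up to \<open>\<Lambda>\<close> extends,
with a loss of a constant factor, to eigenvalues up to \<open>(1 + \<epsilon>)\<Lambda>\<close>. Iterating gives a polynomial bound in the eigenvalue,
which is stronger than the claim.

The spectral input is that the K-invariant vectors of an irreducible summand form a complex line. This is Gelfand's
commutativity argument combined with a Schur lemma, which uses absolute values of self-adjoint operators. All vectors
of \<open>H\<^sup>f\<^sup>i\<^sup>n\<close> are smooth because \<open>\<alpha> = 1 * \<alpha>\<close>.\<close>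

section \<open>Two-by-two matrices\<close>

text \<open>The obstacle is that a product of two elements of \<open>Hf\<close> is only a smooth
  vector. It cannot be multiplied again, so every inequality must be a pairing of two products,
  handled by crossing and the Leibniz rule. With s = 2 - 2 cos(theta) one has p_n = cos(n theta).
  None of p_1, p_2, p_3 is negative on all of s >= 1; the weights 2, 1, 1 make the cubic at most
  -1/2 there. For F = beta^2 the pairing of F with Delta^3 F is not controlled by F and Delta F. It
  is removed by adding the positivity inequality to the spectral one, where it has the opposite
  sign. The slack of the cubic then pays for the squared norms of F and Delta F / Lambda, so the
  unknown of the argument is the best constant Z in a bound for a graph norm of beta^2. Errors from
  the window width and from 1/Lambda add up to 0.16 Z^2 and are absorbed. This needs Z to be finite,
  which holds because a window spans a finite-dimensional space. The width 1/100000 is chosen small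
  enough for crude error counts.\<close>

lemma mat2_nth [simp]:
  "mat2 a b c d $ 1 $ 1 = a" "mat2 a b c d $ 1 $ 2 = b"
  "mat2 a b c d $ 2 $ 1 = c" "mat2 a b c d $ 2 $ 2 = d"
  by (simp_all add: mat2_def)

lemma mat2_eta: "g = mat2 (g $ 1 $ 1) (g $ 1 $ 2) (g $ 2 $ 1) (g $ 2 $ 2)"
  by (simp add: vec_eq_iff forall_2)

lemma mat2_eq_iff: "mat2 a b c d = mat2 a' b' c' d' \<longleftrightarrow> a = a' \<and> b = b' \<and> c = c' \<and> d = d'"
  by (metis mat2_nth)

lemma mat2_mult:
  "mat2 a b c d ** mat2 a' b' c' d' =
     mat2 (a * a' + b * c') (a * b' + b * d') (c * a' + d * c') (c * b' + d * d')"
  by (simp add: vec_eq_iff forall_2 matrix_matrix_mult_def sum_2)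

lemma mat2_one: "mat 1 = mat2 1 0 0 1"
  by (simp add: vec_eq_iff forall_2 mat_def)

lemma mat2_transpose: "transpose (mat2 a b c d) = mat2 a c b d"
  by (simp add: vec_eq_iff forall_2 transpose_def)

lemma mat2_in_SL2: "mat2 a b c d \<in> SL2 \<longleftrightarrow> a * d - b * c = 1"
  by (simp add: SL2_def det_2)

lemma SL2_cases:
  assumes "g \<in> SL2"
  obtains a b c d where "g = mat2 a b c d" "a * d - b * c = 1"
  using assms mat2_eta[of g] mat2_in_SL2 by metis

lemma one_in_SL2 [simp]: "mat 1 \<in> SL2"
  by (simp add: SL2_def)

lemma SL2_mult [simp]: "g \<in> SL2 \<Longrightarrow> h \<in> SL2 \<Longrightarrow> g ** h \<in> SL2"
  by (simp add: SL2_def det_mul)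

lemma SL2_transpose [simp]: "g \<in> SL2 \<Longrightarrow> transpose g \<in> SL2"
  by (simp add: SL2_def)

definition adj2 :: "real^2^2 \<Rightarrow> real^2^2" where
  "adj2 g = mat2 (g $ 2 $ 2) (- (g $ 1 $ 2)) (- (g $ 2 $ 1)) (g $ 1 $ 1)"

lemma adj2_mat2 [simp]: "adj2 (mat2 a b c d) = mat2 d (- b) (- c) a"
  by (simp add: adj2_def)

lemma adj2_SL2 [simp]: "g \<in> SL2 \<Longrightarrow> adj2 g \<in> SL2"
  by (elim SL2_cases) (simp add: mat2_in_SL2 algebra_simps)

lemma adj2_mult [simp]:
  assumes "g \<in> SL2" shows "adj2 g ** g = mat 1" "g ** adj2 g = mat 1"
  using assms by (elim SL2_cases, simp add: mat2_mult mat2_one mat2_eq_iff algebra_simps)+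

lemma kmat_SL2 [simp]: "kmat t \<in> SL2"
  by (simp add: kmat_def mat2_in_SL2 flip: power2_eq_square)

lemma amat_SL2 [simp]: "amat t \<in> SL2"
  by (simp add: amat_def mat2_in_SL2 flip: exp_add)

lemma smat_SL2 [simp]: "smat t \<in> SL2"
  using cosh_square_eq[of t] by (simp add: smat_def mat2_in_SL2 power2_eq_square)

lemma nmat_SL2 [simp]: "nmat t \<in> SL2"
  by (simp add: nmat_def mat2_in_SL2)

lemma kmat_add: "kmat (s + t) = kmat s ** kmat t"
  by (simp add: kmat_def mat2_mult mat2_eq_iff cos_add sin_add)

lemma amat_add: "amat (s + t) = amat s ** amat t"
  by (simp add: amat_def mat2_mult mat2_eq_iff flip: exp_add)

lemma nmat_add: "nmat (s + t) = nmat s ** nmat t"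
  by (simp add: nmat_def mat2_mult mat2_eq_iff)

lemma mat_zero [simp]: "kmat 0 = mat 1" "amat 0 = mat 1" "smat 0 = mat 1" "nmat 0 = mat 1"
  by (simp_all add: kmat_def amat_def smat_def nmat_def mat2_one)

lemma continuous_on_mat2 [continuous_intros]:
  fixes a b c d :: "'a::topological_space \<Rightarrow> real"
  assumes "continuous_on S a" "continuous_on S b" "continuous_on S c" "continuous_on S d"
  shows "continuous_on S (\<lambda>t. mat2 (a t) (b t) (c t) (d t))"
  unfolding mat2_def
proof (intro continuous_on_vec_lambda)
  fix i j :: 2
  show "continuous_on S (\<lambda>x. if i = 1 then if j = 1 then a x else b x else if j = 1 then c x else d x)"
    using assms by (cases "i = 1"; cases "j = 1") simp_all
qed

lemma continuous_on_kmat: "continuous_on UNIV kmat"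
  and continuous_on_amat: "continuous_on UNIV amat"
  and continuous_on_nmat: "continuous_on UNIV nmat"
  unfolding kmat_def amat_def nmat_def by (intro continuous_intros)+

section \<open>Absolute values of self-adjoint contractions\<close>

text \<open>The iterates converge to \<open>1 - sqrt (1 - B)\<close>; the scalar sequence for \<open>B = 1\<close> majorises the increments in norm.\<close>

fun sqrt_iter :: "('h::real_vector \<Rightarrow> 'h) \<Rightarrow> nat \<Rightarrow> 'h \<Rightarrow> 'h" where
  "sqrt_iter B 0 v = 0"
| "sqrt_iter B (Suc k) v = (1/2) *\<^sub>R (B v + sqrt_iter B k (sqrt_iter B k v))"

fun sqrt_bd :: "nat \<Rightarrow> real" where
  "sqrt_bd 0 = 0"
| "sqrt_bd (Suc k) = (1 + sqrt_bd k ^ 2) / 2"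

lemma sqrt_bd_bounds: "0 \<le> sqrt_bd k \<and> sqrt_bd k \<le> 1"
  by (induction k) (auto simp: power_le_one)

lemma sqrt_bd_mono: "sqrt_bd k \<le> sqrt_bd (Suc k)"
proof -
  have "0 \<le> (sqrt_bd k - 1)\<^sup>2" by simp
  then show ?thesis by (simp add: power2_eq_square algebra_simps)
qed

lemma sqrt_bd_Cauchy: "Cauchy sqrt_bd"
proof -
  have "incseq sqrt_bd" by (intro incseq_SucI sqrt_bd_mono)
  then have "convergent sqrt_bd"
    using sqrt_bd_bounds by (intro Bseq_monoseq_convergent BseqI[of 1]) (auto simp: incseq_imp_monoseq)
  then show ?thesis by (simp add: convergent_Cauchy)
qed

lemma sqrt_iter_linear:
  assumes "linear B" shows "linear (sqrt_iter B k)"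
proof (induction k)
  case 0
  then show ?case by (intro linearI) auto
next
  case (Suc k)
  interpret b: linear B by fact
  interpret y: linear "sqrt_iter B k" by fact
  show ?case
    by (intro linearI) (auto simp: b.add y.add b.scale y.scale algebra_simps)
qed

lemma sqrt_iter_commute:
  assumes "linear C" "\<And>v. B (C v) = C (B v)"
  shows "sqrt_iter B k (C v) = C (sqrt_iter B k v)"
proof (induction k arbitrary: v)
  case 0
  then show ?case using linear_0[OF assms(1)] by simp
next
  case (Suc k)
  then show ?case
    by (simp add: assms(2) linear_add[OF assms(1)] linear_scale[OF assms(1)])
qed

lemma sqrt_iter_commute_self:
  assumes "linear B" shows "sqrt_iter B j (sqrt_iter B k v) = sqrt_iter B k (sqrt_iter B j v)"
  by (rule sqrt_iter_commute[OF sqrt_iter_linear[OF assms]])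
     (rule sqrt_iter_commute[OF assms, symmetric], simp)

lemma sqrt_iter_subspace:
  assumes "subspace U" "\<And>v. v \<in> U \<Longrightarrow> B v \<in> U" "v \<in> U"
  shows "sqrt_iter B k v \<in> U"
  using assms(3)
proof (induction k arbitrary: v)
  case 0
  then show ?case using assms(1) by (simp add: subspace_0)
next
  case (Suc k)
  then show ?case using assms(1,2) by (simp add: subspace_add subspace_scale)
qed

context
  fixes B :: "'h::{real_inner,complete_space} \<Rightarrow> 'h"
  assumes linB: "linear B" and normB: "\<And>v. norm (B v) \<le> norm v"
begin

lemma sqrt_iter_norm: "norm (sqrt_iter B k v) \<le> sqrt_bd k * norm v"
proof (induction k arbitrary: v)
  case (Suc k)
  have "norm (sqrt_iter B k (sqrt_iter B k v)) \<le> sqrt_bd k * (sqrt_bd k * norm v)"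
    by (meson Suc.IH mult_left_mono order_trans sqrt_bd_bounds)
  then have "norm (B v + sqrt_iter B k (sqrt_iter B k v)) \<le> norm v + sqrt_bd k * (sqrt_bd k * norm v)"
    using normB by (meson add_mono norm_triangle_le)
  then have "(1/2) * norm (B v + sqrt_iter B k (sqrt_iter B k v)) \<le> (1 + sqrt_bd k ^ 2) / 2 * norm v"
    by (simp add: power2_eq_square algebra_simps)
  then show ?case unfolding sqrt_iter.simps norm_scaleR sqrt_bd.simps by simp
qed simp

text \<open>The iterates are polynomials in \<open>B\<close> and commute, so a difference of two
  squares factors as (Y' + Y)(Y' - Y). The scalar sequence obeys the same identity, and induction
  compares the two.\<close>

lemma sqrt_iter_step:
  "norm (sqrt_iter B (Suc k) v - sqrt_iter B k v) \<le> (sqrt_bd (Suc k) - sqrt_bd k) * norm v"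
proof (induction k arbitrary: v)
  case 0
  then show ?case using normB by simp
next
  case (Suc k)
  let ?Y = "sqrt_iter B"
  define d where "d = ?Y (Suc k) v - ?Y k v"
  interpret y: linear "?Y k" using sqrt_iter_linear[OF linB] .
  interpret y': linear "?Y (Suc k)" using sqrt_iter_linear[OF linB] .
  have "?Y (Suc (Suc k)) v - ?Y (Suc k) v
      = (1/2) *\<^sub>R (?Y (Suc k) (?Y (Suc k) v) - ?Y k (?Y k v))"
    by (simp only: sqrt_iter.simps(2)[of B "Suc k"] sqrt_iter.simps(2)[of B "k" v])
       (simp add: scaleR_right_diff_distrib[symmetric] scaleR_add_right[symmetric] del: sqrt_iter.simps scaleR_add_right)
  also have "?Y (Suc k) (?Y (Suc k) v) - ?Y k (?Y k v) = ?Y (Suc k) d + ?Y k d"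
    unfolding d_def by (simp add: y.diff y'.diff sqrt_iter_commute_self[OF linB, of k "Suc k"] del: sqrt_iter.simps)
  finally have eq: "?Y (Suc (Suc k)) v - ?Y (Suc k) v = (1/2) *\<^sub>R (?Y (Suc k) d + ?Y k d)" .
  have "norm (?Y (Suc k) d + ?Y k d) \<le> sqrt_bd (Suc k) * norm d + sqrt_bd k * norm d"
    by (meson add_mono norm_triangle_le sqrt_iter_norm)
  also have "\<dots> = (sqrt_bd (Suc k) + sqrt_bd k) * norm d" by (simp add: algebra_simps)
  also have "\<dots> \<le> (sqrt_bd (Suc k) + sqrt_bd k) * ((sqrt_bd (Suc k) - sqrt_bd k) * norm v)"
    unfolding d_def using sqrt_bd_bounds[of k] sqrt_bd_bounds[of "Suc k"] Suc.IH
    by (intro mult_left_mono) (auto simp del: sqrt_iter.simps sqrt_bd.simps)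
  also have "\<dots> = 2 * (sqrt_bd (Suc (Suc k)) - sqrt_bd (Suc k)) * norm v"
    by (simp only: sqrt_bd.simps(2)[of "Suc k"] sqrt_bd.simps(2)[of k]) (simp add: field_simps power2_eq_square)
  finally have fin: "norm (?Y (Suc k) d + ?Y k d) \<le> 2 * ((sqrt_bd (Suc (Suc k)) - sqrt_bd (Suc k)) * norm v)"
    by (simp only: mult.assoc)
  have "norm (?Y (Suc (Suc k)) v - ?Y (Suc k) v) = norm (?Y (Suc k) d + ?Y k d) / 2"
    unfolding eq by (simp del: sqrt_iter.simps scaleR_add_right)
  with fin show ?case by linarith
qed

lemma sqrt_iter_diff:
  "norm (sqrt_iter B (k + p) v - sqrt_iter B k v) \<le> (sqrt_bd (k + p) - sqrt_bd k) * norm v"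
proof (induction p)
  case (Suc p)
  have "norm (sqrt_iter B (k + Suc p) v - sqrt_iter B k v)
     \<le> norm (sqrt_iter B (Suc (k + p)) v - sqrt_iter B (k + p) v) + norm (sqrt_iter B (k + p) v - sqrt_iter B k v)"
    by (metis add_Suc_right diff_add_cancel add_diff_eq norm_triangle_ineq)
  also have "\<dots> \<le> (sqrt_bd (Suc (k + p)) - sqrt_bd (k + p)) * norm v + (sqrt_bd (k + p) - sqrt_bd k) * norm v"
    by (intro add_mono sqrt_iter_step Suc.IH)
  finally show ?case by (simp add: algebra_simps del: sqrt_bd.simps sqrt_iter.simps)
qed simp

lemma sqrt_iter_convergent: "convergent (\<lambda>k. sqrt_iter B k v)"
proof (rule Cauchy_convergent, rule CauchyI')
  fix e :: real assume "e > 0"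
  then have "e / (norm v + 1) > 0" by (simp add: add_nonneg_pos)
  then obtain M where M: "\<And>m n. m \<ge> M \<Longrightarrow> n \<ge> M \<Longrightarrow> norm (sqrt_bd m - sqrt_bd n) < e / (norm v + 1)"
    using CauchyD[OF sqrt_bd_Cauchy] by blast
  show "\<exists>M. \<forall>m\<ge>M. \<forall>n>m. dist (sqrt_iter B m v) (sqrt_iter B n v) < e"
  proof (intro exI allI impI)
    fix m n assume mn: "M \<le> m" "m < n"
    then obtain p where p: "n = m + p" using less_imp_add_positive by metis
    have "dist (sqrt_iter B m v) (sqrt_iter B n v) \<le> (sqrt_bd n - sqrt_bd m) * norm v"
      using sqrt_iter_diff[of m p v] by (simp add: p dist_norm norm_minus_commute)
    also have "\<dots> \<le> e / (norm v + 1) * norm v"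
      using M[of n m] mn by (intro mult_right_mono) auto
    also have "\<dots> < e" using \<open>e > 0\<close> add_nonneg_pos[OF norm_ge_zero[of v] zero_less_one] by (simp add: field_simps)
    finally show "dist (sqrt_iter B m v) (sqrt_iter B n v) < e" .
  qed
qed

end

text \<open>For B = 1 - A^2 the limit R of the iteration satisfies 2R = B + R^2, so Q = 1 - R
  squares to A^2 and is |A|. The two closing clauses, commutation and stability of closed subspaces,
  pass to the limit from polynomials in B; they let |A| be restricted to the K-fixed part of a
  summand.\<close>

lemma abs_operator_exists:
  fixes A :: "'h::{real_inner,complete_space} \<Rightarrow> 'h"
  assumes linA: "linear A" and normA: "\<And>v. norm (A v) \<le> norm v"
    and symA: "\<And>v w. inner (A v) w = inner v (A w)"
  shows "\<exists>Q. bounded_linear Q \<and> (\<forall>v. Q (Q v) = A (A v)) \<and> (\<forall>v. inner (Q v) v \<ge> 0) \<and>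
    (\<forall>C v. bounded_linear C \<longrightarrow> (\<forall>v. A (C v) = C (A v)) \<longrightarrow> Q (C v) = C (Q v)) \<and>
    (\<forall>U v. closed U \<longrightarrow> subspace U \<longrightarrow> (\<forall>v\<in>U. A v \<in> U) \<longrightarrow> v \<in> U \<longrightarrow> Q v \<in> U)"
proof -
  define B where "B v = v - A (A v)" for v
  interpret A: linear A by fact
  have linB: "linear B" by (intro linearI) (auto simp: B_def A.add A.scale algebra_simps)
  have normB: "norm (B v) \<le> norm v" for v
  proof -
    have "(norm (B v))\<^sup>2 = inner v v - 2 * inner (A v) (A v) + inner (A (A v)) (A (A v))"
      by (simp add: B_def power2_norm_eq_inner inner_diff inner_commute symA[of "A v" v, symmetric] symA[of v "A v"])
    also have "inner (A (A v)) (A (A v)) \<le> inner (A v) (A v)"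
      using power_mono[OF normA[of "A v"], of 2] by (simp add: power2_norm_eq_inner)
    finally have "(norm (B v))\<^sup>2 \<le> (norm v)\<^sup>2"
      using inner_ge_zero[of "A v"] power2_norm_eq_inner[of v] by linarith
    then show ?thesis using norm_ge_zero power2_le_imp_le by blast
  qed
  let ?Y = "sqrt_iter B"
  define R where "R v = lim (\<lambda>k. ?Y k v)" for v
  have conv: "(\<lambda>k. ?Y k v) \<longlonglongrightarrow> R v" for v
    using sqrt_iter_convergent[OF linB normB] unfolding R_def by (simp add: convergent_LIMSEQ_iff)
  have linY: "linear (?Y k)" for k by (rule sqrt_iter_linear[OF linB])
  have normY: "norm (?Y k v) \<le> norm v" for k v
    using sqrt_iter_norm[OF linB normB, of k v] sqrt_bd_bounds[of k]
    by (smt (verit) mult_left_le_one_le norm_ge_zero)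
  have normR: "norm (R v) \<le> norm v" for v
    by (rule LIMSEQ_le_const2[OF tendsto_norm[OF conv]]) (use normY in auto)
  have linR: "linear R"
  proof (rule linearI)
    fix x y :: 'h and c :: real
    have "(\<lambda>k. ?Y k x + ?Y k y) \<longlonglongrightarrow> R x + R y" by (intro tendsto_intros conv)
    then show "R (x + y) = R x + R y" using conv[of "x + y"]
      by (simp add: linear_add[OF linY] LIMSEQ_unique)
    have "(\<lambda>k. c *\<^sub>R ?Y k x) \<longlonglongrightarrow> c *\<^sub>R R x" by (intro tendsto_intros conv)
    then show "R (c *\<^sub>R x) = c *\<^sub>R R x" using conv[of "c *\<^sub>R x"]
      by (simp add: linear_scale[OF linY] LIMSEQ_unique)
  qed
  \<comment> \<open>Pointwise convergence alone does not pass through a composition; the uniform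
    bound \<open>normY\<close> makes Y_k (Y_k v - R v) tend to 0.\<close>
  have YY: "(\<lambda>k. ?Y k (?Y k v)) \<longlonglongrightarrow> R (R v)" for v
  proof -
    have "(\<lambda>k. norm (?Y k v - R v)) \<longlonglongrightarrow> 0"
      using conv[of v] by (simp add: LIM_zero tendsto_norm_zero)
    then have "(\<lambda>k. ?Y k (?Y k v - R v)) \<longlonglongrightarrow> 0"
      by (rule Lim_null_comparison[rotated]) (use normY in auto)
    from tendsto_add[OF this conv[of "R v"]] show ?thesis
      by (simp add: linear_diff[OF linY])
  qed
  have Req: "R v = (1/2) *\<^sub>R (B v + R (R v))" for v
  proof -
    have "(\<lambda>k. ?Y (Suc k) v) \<longlonglongrightarrow> (1/2) *\<^sub>R (B v + R (R v))"
      unfolding sqrt_iter.simps by (intro tendsto_intros YY)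
    moreover have "(\<lambda>k. ?Y (Suc k) v) \<longlonglongrightarrow> R v" using conv LIMSEQ_Suc by blast
    ultimately show ?thesis using LIMSEQ_unique by blast
  qed
  interpret R: linear R by fact
  define Q where "Q v = v - R v" for v
  have blQ: "bounded_linear Q"
  proof (rule bounded_linear_intro[of _ 2])
    fix v show "norm (Q v) \<le> norm v * 2"
      unfolding Q_def using norm_triangle_ineq4[of v "R v"] normR[of v] by simp
  qed (auto simp: Q_def R.add R.scale algebra_simps)
  show ?thesis
  proof (intro exI[of _ Q] conjI allI impI)
    show "bounded_linear Q" by fact
    show "Q (Q v) = A (A v)" for v
    proof -
      have "2 *\<^sub>R R v = B v + R (R v)" by (subst Req) simp
      then show ?thesis by (simp add: Q_def R.diff B_def scaleR_2 algebra_simps)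
    qed
    show "inner (Q v) v \<ge> 0" for v
    proof -
      have "inner (R v) v \<le> norm (R v) * norm v" by (rule norm_cauchy_schwarz)
      also have "\<dots> \<le> norm v * norm v" by (intro mult_right_mono normR) auto
      finally show ?thesis by (simp add: Q_def inner_diff norm_eq_sqrt_inner)
    qed
    show "Q (C v) = C (Q v)" if C: "bounded_linear C" and AC: "\<forall>v. A (C v) = C (A v)" for C v
    proof -
      interpret C: bounded_linear C by fact
      have "(\<lambda>k. ?Y k (C v)) = (\<lambda>k. C (?Y k v))"
        by (rule ext, rule sqrt_iter_commute) (use AC in \<open>auto simp: B_def C.diff C.linear_axioms\<close>)
      moreover have "(\<lambda>k. C (?Y k v)) \<longlonglongrightarrow> C (R v)" by (intro C.tendsto conv)
      ultimately have "R (C v) = C (R v)" using conv[of "C v"] LIMSEQ_unique by fastforce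
      then show ?thesis by (simp add: Q_def C.diff)
    qed
    show "Q v \<in> U" if U: "closed U" "subspace U" "\<forall>v\<in>U. A v \<in> U" "v \<in> U" for U v
    proof -
      have "?Y k v \<in> U" for k
        by (rule sqrt_iter_subspace) (use U in \<open>auto simp: B_def subspace_diff\<close>)
      then have "R v \<in> U" using closed_sequentially[OF U(1) _ conv[of v]] by blast
      then show ?thesis using U by (simp add: Q_def subspace_diff)
    qed
  qed
qed

section \<open>Unitary representations and averaging over K\<close>

lemma subspace_closure:
  fixes S :: "'a::real_normed_vector set"
  assumes "subspace S" shows "subspace (closure S)"
proof (intro subspaceI)
  show "0 \<in> closure S" using assms closure_subset subspace_0 by blast
next
  fix x y assume "x \<in> closure S" "y \<in> closure S"
  then obtain f g where "\<And>n. f n \<in> S" "f \<longlonglongrightarrow> x" "\<And>n. g n \<in> S" "g \<longlonglongrightarrow> y"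
    unfolding closure_sequential by blast
  then have "(\<lambda>n. f n + g n) \<longlonglongrightarrow> x + y" "\<And>n. f n + g n \<in> S"
    using assms by (auto intro: tendsto_add subspace_add)
  then show "x + y \<in> closure S" unfolding closure_sequential by (intro exI[of _ "\<lambda>n. f n + g n"]) auto
next
  fix x and c :: real assume "x \<in> closure S"
  then obtain f where "\<And>n. f n \<in> S" "f \<longlonglongrightarrow> x" unfolding closure_sequential by blast
  then have "(\<lambda>n. c *\<^sub>R f n) \<longlonglongrightarrow> c *\<^sub>R x" "\<And>n. c *\<^sub>R f n \<in> S"
    using assms by (auto intro: tendsto_intros subspace_scale)
  then show "c *\<^sub>R x \<in> closure S" unfolding closure_sequential by (intro exI[of _ "\<lambda>n. c *\<^sub>R f n"]) auto
qed

locale sl2_rep =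
  fixes J :: "'h::{real_inner,complete_space} \<Rightarrow> 'h" and \<pi> :: "real^2^2 \<Rightarrow> 'h \<Rightarrow> 'h"
  assumes complex_structure_J: "complex_structure J" and unitary_pi: "unitary_rep J \<pi>"
begin

lemma linear_J: "linear J" and J_J [simp]: "J (J x) = - x"
  and inner_J_J [simp]: "inner (J x) (J y) = inner x y"
  using complex_structure_J by (auto simp: complex_structure_def)

lemma J_add: "J (x + y) = J x + J y" and J_diff: "J (x - y) = J x - J y"
  and J_minus: "J (- x) = - J x" and J_scale: "J (c *\<^sub>R x) = c *\<^sub>R J x" and J_0 [simp]: "J 0 = 0"
  using linear_J by (simp_all add: linear_add linear_diff linear_neg linear_scale linear_0)

lemma norm_J [simp]: "norm (J x) = norm x"
  by (simp add: norm_eq_sqrt_inner)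

lemma inner_J_left: "inner (J x) y = - inner x (J y)"
  using inner_J_J[of x "J y"] by simp

lemma inner_J_self [simp]: "inner (J x) x = 0" "inner x (J x) = 0"
  using inner_J_left[of x x] by (simp_all add: inner_commute)

lemma bounded_linear_J: "bounded_linear J"
  by (rule bounded_linear_intro[of _ 1]) (simp_all add: J_add J_scale)

lemma linear_pi: "g \<in> SL2 \<Longrightarrow> linear (\<pi> g)"
  and pi_J: "g \<in> SL2 \<Longrightarrow> \<pi> g (J x) = J (\<pi> g x)"
  and inner_pi_pi: "g \<in> SL2 \<Longrightarrow> inner (\<pi> g x) (\<pi> g y) = inner x y"
  and pi_mult: "g \<in> SL2 \<Longrightarrow> h \<in> SL2 \<Longrightarrow> \<pi> (g ** h) x = \<pi> g (\<pi> h x)"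
  and pi_continuous: "continuous_on SL2 (\<lambda>g. \<pi> g x)"
  using unitary_pi by (auto simp: unitary_rep_def)

lemma pi_one [simp]: "\<pi> (mat 1) x = x"
  using unitary_pi by (simp add: unitary_rep_def)

lemma norm_pi [simp]: "g \<in> SL2 \<Longrightarrow> norm (\<pi> g x) = norm x"
  by (simp add: norm_eq_sqrt_inner inner_pi_pi)

lemma pi_add: "g \<in> SL2 \<Longrightarrow> \<pi> g (x + y) = \<pi> g x + \<pi> g y"
  and pi_diff: "g \<in> SL2 \<Longrightarrow> \<pi> g (x - y) = \<pi> g x - \<pi> g y"
  and pi_scale: "g \<in> SL2 \<Longrightarrow> \<pi> g (c *\<^sub>R x) = c *\<^sub>R \<pi> g x"
  and pi_0 [simp]: "g \<in> SL2 \<Longrightarrow> \<pi> g 0 = 0"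
  and pi_sum: "g \<in> SL2 \<Longrightarrow> \<pi> g (sum f A) = (\<Sum>i\<in>A. \<pi> g (f i))"
  using linear_pi[of g] by (simp_all add: linear_add linear_diff linear_scale linear_0 linear_sum)

lemma bounded_linear_pi: "g \<in> SL2 \<Longrightarrow> bounded_linear (\<pi> g)"
  by (rule bounded_linear_intro[of _ 1]) (simp_all add: pi_add pi_scale)

lemma pi_adj2 [simp]: "g \<in> SL2 \<Longrightarrow> \<pi> (adj2 g) (\<pi> g x) = x" "g \<in> SL2 \<Longrightarrow> \<pi> g (\<pi> (adj2 g) x) = x"
  by (metis adj2_SL2 adj2_mult pi_mult pi_one)+

lemma inner_pi_left: "g \<in> SL2 \<Longrightarrow> inner (\<pi> g x) y = inner x (\<pi> (adj2 g) y)"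
  by (metis adj2_SL2 inner_pi_pi pi_adj2(2))

lemma continuous_on_pi_curve:
  assumes "continuous_on S \<gamma>" "\<And>t. t \<in> S \<Longrightarrow> \<gamma> t \<in> SL2"
  shows "continuous_on S (\<lambda>t. \<pi> (\<gamma> t) x)"
  using continuous_on_compose2[OF pi_continuous assms(1)] assms(2) by blast

abbreviation rot :: "real \<Rightarrow> 'h \<Rightarrow> 'h" where "rot t \<equiv> \<pi> (kmat t)"

lemma rot_add: "rot (s + t) x = rot s (rot t x)"
  by (simp add: kmat_add pi_mult)

lemma rot_continuous: "continuous_on UNIV (\<lambda>t. rot t x)"
  by (intro continuous_on_pi_curve continuous_on_kmat) simp

lemma rot_periodic: "rot (2 * pi) x = x"
proof -
  have "kmat (2 * pi) = mat 1" by (simp add: kmat_def mat2_one)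
  then show ?thesis by simp
qed

section \<open>The projection onto K-fixed vectors as a limit of dyadic averages\<close>

lemma K_invariant_subspace: "subspace {v. K_invariant \<pi> v}"
  by (auto simp: subspace_def K_invariant_def pi_add pi_scale)

lemma K_invariant_diff: "K_invariant \<pi> a \<Longrightarrow> K_invariant \<pi> b \<Longrightarrow> K_invariant \<pi> (a - b)"
  and K_invariant_J: "K_invariant \<pi> a \<Longrightarrow> K_invariant \<pi> (J a)"
  by (simp_all add: K_invariant_def pi_diff pi_J)

lemma K_invariant_closed: "closed {v. K_invariant \<pi> v}"
proof -
  have "{v. K_invariant \<pi> v} = (\<Inter>t. {v. rot t v = v})" by (auto simp: K_invariant_def)
  moreover have "closed {v. rot t v = v}" for t
    by (intro closed_Collect_eq linear_continuous_on bounded_linear_pi bounded_linear_ident) simp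
  ultimately show ?thesis by (simp add: closed_INT)
qed

text \<open>Mean over 2^n equally spaced rotations. Powers of 2 make these cyclic groups nested, and
  the limit of the means replaces a vector-valued Haar integral over K.\<close>

definition kavg :: "nat \<Rightarrow> 'h \<Rightarrow> 'h" where
  "kavg n v = (1 / 2 ^ n) *\<^sub>R (\<Sum>j<2 ^ n. rot (2 * pi * real j / 2 ^ n) v)"

lemma kavg_norm: "norm (kavg n v) \<le> norm v"
proof -
  have "norm (\<Sum>j<2 ^ n. rot (2 * pi * real j / 2 ^ n) v) \<le> (\<Sum>j<2 ^ n::nat. norm v)"
    by (rule sum_norm_le) simp
  then show ?thesis by (simp add: kavg_def field_simps)
qed

lemma kavg_linear: "linear (kavg n)"
  by (intro linearI)
     (simp_all add: kavg_def pi_add pi_scale sum.distrib scaleR_add_right scaleR_right.sum mult.commute)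

text \<open>The finer mean splits into 2^n blocks of 2^p rotations. A block starts at a coarse
  rotation and moves away from it by at most 2 pi / 2^n, where \<open>v\<close> changes by at most
  \<open>d\<close>; unitarity carries this bound to every block.\<close>

lemma kavg_refine:
  assumes "\<And>s. 0 \<le> s \<Longrightarrow> s \<le> 2 * pi / 2 ^ n \<Longrightarrow> norm (rot s v - v) \<le> d"
  shows "norm (kavg (n + p) v - kavg n v) \<le> d"
proof -
  let ?N = "2 ^ n :: nat" and ?P = "2 ^ p :: nat"
  define f where "f j = rot (2 * pi * real j / 2 ^ (n + p)) v" for j :: nat
  define c where "c i = rot (2 * pi * real i / 2 ^ n) v" for i :: nat
  have "(\<Sum>j<2 ^ (n + p). f j) = (\<Sum>i<?N. sum f {i * ?P..<i * ?P + ?P})"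
    by (simp add: sum.nat_group power_add)
  also have "\<dots> = (\<Sum>i<?N. \<Sum>k<?P. f (i * ?P + k))"
    by (rule sum.cong[OF refl], subst sum.atLeastLessThan_shift_0) (simp add: lessThan_atLeast0 add.commute)
  finally have fsum: "(\<Sum>j<2 ^ (n + p). f j) = (\<Sum>i<?N. \<Sum>k<?P. f (i * ?P + k))" .
  have bd: "norm (f (i * ?P + k) - c i) \<le> d" if "k < ?P" for i k
  proof -
    define s where "s = 2 * pi * real k / 2 ^ (n + p)"
    have k: "real k \<le> 2 ^ p" using that by (metis less_imp_le of_nat_le_iff of_nat_numeral of_nat_power)
    have eq: "2 * pi * real (i * ?P + k) / 2 ^ (n + p) = 2 * pi * real i / 2 ^ n + s"
      by (simp add: s_def power_add field_simps)
    have "f (i * ?P + k) - c i = rot (2 * pi * real i / 2 ^ n) (rot s v - v)"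
      unfolding f_def c_def eq by (simp add: rot_add pi_diff)
    then have "norm (f (i * ?P + k) - c i) = norm (rot s v - v)" by simp
    also have "\<dots> \<le> d" using k by (intro assms) (auto simp: s_def power_add field_simps)
    finally show ?thesis .
  qed
  have "kavg (n + p) v - kavg n v = (1 / 2 ^ (n + p)) *\<^sub>R (\<Sum>i<?N. \<Sum>k<?P. f (i * ?P + k) - c i)"
    unfolding kavg_def f_def[symmetric] c_def[symmetric] fsum
    by (simp add: sum_subtractf scaleR_diff_right scaleR_right.sum power_add sum_constant_scaleR)
  moreover have "norm (\<Sum>i<?N. \<Sum>k<?P. f (i * ?P + k) - c i) \<le> (\<Sum>i<?N. \<Sum>k<?P. d)"
    by (intro sum_norm_le order_trans[OF norm_sum] sum_mono bd) auto
  ultimately show ?thesis by (simp add: power_add field_simps)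
qed

lemma kavg_convergent: "convergent (\<lambda>n. kavg n v)"
proof (rule Cauchy_convergent, rule metric_CauchyI)
  fix e :: real assume "e > 0"
  have "isCont (\<lambda>t. rot t v) 0" using rot_continuous[of v] by (simp add: continuous_on_eq_continuous_at)
  moreover have "e / 3 > 0" using \<open>e > 0\<close> by simp
  ultimately obtain d where d: "d > 0" "\<And>s. \<bar>s\<bar> < d \<Longrightarrow> norm (rot s v - v) < e / 3"
    unfolding continuous_at_eps_delta dist_norm by (metis diff_zero mat_zero(1) pi_one real_norm_def)
  have "(\<lambda>n. 2 * pi / 2 ^ n) \<longlonglongrightarrow> 0" by (rule LIMSEQ_divide_realpow_zero) simp
  then obtain n where n: "2 * pi / 2 ^ n < d"
    by (metis (mono_tags, lifting) d(1) eventually_sequentially order_refl order_tendstoD(2))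
  have close: "norm (kavg (n + p) v - kavg n v) \<le> e / 3" for p
    by (rule kavg_refine) (use d(2) n in \<open>fastforce intro: less_imp_le\<close>)
  show "\<exists>M. \<forall>m\<ge>M. \<forall>n\<ge>M. dist (kavg m v) (kavg n v) < e"
  proof (intro exI allI impI)
    fix i j assume "n \<le> i" "n \<le> j"
    then obtain p q where "i = n + p" "j = n + q" using le_Suc_ex by blast
    then have "dist (kavg i v) (kavg n v) \<le> e / 3" "dist (kavg j v) (kavg n v) \<le> e / 3"
      using close by (simp_all add: dist_norm)
    then have "dist (kavg i v) (kavg j v) \<le> 2 * e / 3"
      using dist_triangle2[of "kavg i v" "kavg j v" "kavg n v"] by simp
    then show "dist (kavg i v) (kavg j v) < e" using \<open>e > 0\<close> by simp
  qed
qed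

definition PK :: "'h \<Rightarrow> 'h" where "PK v = lim (\<lambda>n. kavg n v)"

lemma kavg_LIMSEQ: "(\<lambda>n. kavg n v) \<longlonglongrightarrow> PK v"
  using kavg_convergent unfolding PK_def by (simp add: convergent_LIMSEQ_iff)

lemma PK_norm: "norm (PK v) \<le> norm v"
  by (rule LIMSEQ_le_const2[OF tendsto_norm[OF kavg_LIMSEQ]]) (use kavg_norm in auto)

lemma PK_bounded_linear: "bounded_linear PK"
proof (rule bounded_linear_intro[of _ 1])
  fix x y :: 'h and c :: real
  have "(\<lambda>n. kavg n x + kavg n y) \<longlonglongrightarrow> PK x + PK y" by (intro tendsto_intros kavg_LIMSEQ)
  then show "PK (x + y) = PK x + PK y" using kavg_LIMSEQ[of "x + y"]
    by (simp add: linear_add[OF kavg_linear] LIMSEQ_unique)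
  have "(\<lambda>n. c *\<^sub>R kavg n x) \<longlonglongrightarrow> c *\<^sub>R PK x" by (intro tendsto_intros kavg_LIMSEQ)
  then show "PK (c *\<^sub>R x) = c *\<^sub>R PK x" using kavg_LIMSEQ[of "c *\<^sub>R x"]
    by (simp add: linear_scale[OF kavg_linear] LIMSEQ_unique)
qed (simp add: PK_norm)

lemma kavg_J: "kavg n (J v) = J (kavg n v)"
  by (simp add: kavg_def pi_J J_scale linear_sum[OF linear_J])

lemma PK_J: "PK (J v) = J (PK v)"
  using bounded_linear.tendsto[OF bounded_linear_J kavg_LIMSEQ[of v]] kavg_LIMSEQ[of "J v"]
  by (simp add: kavg_J LIMSEQ_unique)

lemma kavg_fix: "K_invariant \<pi> v \<Longrightarrow> kavg n v = v"
  by (simp add: kavg_def K_invariant_def sum_constant_scaleR)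

lemma PK_fix: "K_invariant \<pi> v \<Longrightarrow> PK v = v"
  using kavg_LIMSEQ[of v] by (simp add: kavg_fix LIMSEQ_const_iff)

lemma kavg_rot: "kavg n (rot t v) = rot t (kavg n v)"
  by (simp add: kavg_def pi_scale pi_sum flip: rot_add) (simp add: add.commute)

lemma PK_rot_commute: "PK (rot t v) = rot t (PK v)"
  using bounded_linear.tendsto[OF bounded_linear_pi[OF kmat_SL2] kavg_LIMSEQ[of v], of t] kavg_LIMSEQ[of "rot t v"]
  by (simp add: kavg_rot LIMSEQ_unique)

lemma kavg_shift: "rot (2 * pi / 2 ^ n) (kavg n v) = kavg n v"
proof -
  let ?f = "\<lambda>j. rot (2 * pi * real j / 2 ^ n) v"
  have "rot (2 * pi / 2 ^ n) (kavg n v) = (1 / 2 ^ n) *\<^sub>R (\<Sum>j<2 ^ n. ?f (Suc j))"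
    by (simp add: kavg_def pi_scale pi_sum flip: rot_add) (simp add: field_simps)
  also have "(\<Sum>j<2 ^ n. ?f (Suc j)) = (\<Sum>j<2 ^ n. ?f j)"
    using sum.lessThan_Suc_shift[of ?f "2 ^ n"] sum.lessThan_Suc[of ?f "2 ^ n"] rot_periodic[of v] by simp
  finally show ?thesis by (simp add: kavg_def)
qed

lemma kavg_shift_power: "rot (real m * (2 * pi / 2 ^ n)) (kavg n v) = kavg n v"
proof (induction m)
  case (Suc m)
  have "real (Suc m) * (2 * pi / 2 ^ n) = real m * (2 * pi / 2 ^ n) + 2 * pi / 2 ^ n"
    by (simp add: field_simps)
  then show ?case by (simp only: rot_add kavg_shift Suc)
qed simp

text \<open>For \<open>k \<ge> n\<close> the rotation by a multiple of 2 pi / 2^n belongs to the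
  group averaged by \<open>kavg k\<close>, so it fixes all but finitely many terms of the
  sequence.\<close>

lemma PK_dyadic: "rot (real m * (2 * pi / 2 ^ n)) (PK v) = PK v"
proof -
  let ?r = "rot (real m * (2 * pi / 2 ^ n))"
  have "?r (kavg k v) = kavg k v" if "k \<ge> n" for k
  proof -
    have "real m * (2 * pi / 2 ^ n) = real (m * 2 ^ (k - n)) * (2 * pi / 2 ^ k)"
      using that by (simp add: field_simps flip: power_add)
    then show ?thesis by (simp only: kavg_shift_power)
  qed
  then have "\<forall>\<^sub>F k in sequentially. ?r (kavg k v) = kavg k v"
    by (metis (mono_tags, lifting) eventually_sequentiallyI)
  moreover have "(\<lambda>k. ?r (kavg k v)) \<longlonglongrightarrow> ?r (PK v)"
    by (intro bounded_linear.tendsto[OF bounded_linear_pi] kavg_LIMSEQ) simp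
  ultimately have "(\<lambda>k. kavg k v) \<longlonglongrightarrow> ?r (PK v)"
    by (rule Lim_transform_eventually[rotated])
  then show ?thesis using kavg_LIMSEQ LIMSEQ_unique by blast
qed

lemma PK_K_invariant: "K_invariant \<pi> (PK v)"
proof -
  have pos: "rot t (PK v) = PK v" if "t \<ge> 0" for t
  proof -
    \<comment> \<open>Dyadic rotations are dense: subtracting from \<open>t\<close> the largest
      multiple of the mesh \<open>h n\<close> leaves \<open>s n\<close>, which tends to 0, while the
      rotated vector stays the same.\<close>
    define h where "h n = 2 * pi / 2 ^ n" for n :: nat
    define s where "s n = t - real (nat \<lfloor>t / h n\<rfloor>) * h n" for n
    have h: "h n > 0" for n by (simp add: h_def)
    have h0: "h \<longlonglongrightarrow> 0" unfolding h_def by (rule LIMSEQ_divide_realpow_zero) simp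
    have "0 \<le> s n \<and> s n \<le> h n" for n
    proof -
      have nn: "real (nat \<lfloor>t / h n\<rfloor>) = of_int \<lfloor>t / h n\<rfloor>" using that h[of n] by simp
      have "of_int \<lfloor>t / h n\<rfloor> \<le> t / h n" "t / h n \<le> of_int \<lfloor>t / h n\<rfloor> + 1" by linarith+
      then have "of_int \<lfloor>t / h n\<rfloor> * h n \<le> t" "t \<le> (of_int \<lfloor>t / h n\<rfloor> + 1) * h n"
        using h[of n] by (simp_all only: pos_le_divide_eq pos_divide_le_eq)
      then show ?thesis unfolding s_def nn by (simp add: algebra_simps)
    qed
    then have s0: "s \<longlonglongrightarrow> 0" by (intro real_tendsto_sandwich[OF _ _ tendsto_const h0]) auto
    have eq: "rot (s n) (PK v) = rot t (PK v)" for n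
    proof -
      have "rot t (PK v) = rot (s n + real (nat \<lfloor>t / h n\<rfloor>) * h n) (PK v)" by (simp add: s_def)
      also have "\<dots> = rot (s n) (PK v)" by (simp only: rot_add h_def PK_dyadic)
      finally show ?thesis by (rule sym)
    qed
    have "isCont (\<lambda>t. rot t (PK v)) 0"
      using rot_continuous[of "PK v"] by (simp add: continuous_on_eq_continuous_at)
    from isCont_tendsto_compose[OF this s0] show ?thesis by (simp add: eq LIMSEQ_const_iff)
  qed
  show ?thesis unfolding K_invariant_def
  proof
    fix t show "rot t (PK v) = PK v"
    proof (cases "t \<ge> 0")
      case False
      then have "rot t (PK v) = rot t (rot (- t) (PK v))" using pos[of "- t"] by simp
      then show ?thesis by (simp flip: rot_add)
    qed (rule pos)
  qed
qed

lemma PK_rot: "PK (rot t v) = PK v"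
  using PK_K_invariant[of v] by (simp add: PK_rot_commute K_invariant_def)

lemma inner_rot_left: "inner (rot t v) w = inner v (rot (- t) w)"
  by (metis add.right_inverse inner_pi_pi kmat_SL2 mat_zero(1) pi_one rot_add)

lemma inner_PK: "K_invariant \<pi> w \<Longrightarrow> inner (PK v) w = inner v w"
proof -
  assume w: "K_invariant \<pi> w"
  then have "inner (rot t v) w = inner v w" for t by (simp add: inner_rot_left K_invariant_def)
  then have "inner (kavg n v) w = inner v w" for n by (simp add: kavg_def inner_sum_left)
  then show ?thesis
    using tendsto_inner[OF kavg_LIMSEQ[of v] tendsto_const[of w]] by (simp add: LIMSEQ_const_iff)
qed

lemma PK_sym: "inner (PK v) w = inner v (PK w)"
  by (metis PK_K_invariant inner_PK inner_commute)

lemma PK_in: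
  assumes "inv_subspace J \<pi> V" "v \<in> V" shows "PK v \<in> V"
proof -
  have V: "closed V" "subspace V" "\<And>g v. g \<in> SL2 \<Longrightarrow> v \<in> V \<Longrightarrow> \<pi> g v \<in> V"
    using assms(1) by (auto simp: inv_subspace_def)
  have "kavg n v \<in> V" for n unfolding kavg_def
    by (intro subspace_scale subspace_sum V(2) V(3) assms(2)) auto
  then show ?thesis using closed_sequentially[OF V(1) _ kavg_LIMSEQ] by blast
qed

text \<open>The finite rotation group is closed under inversion. This is needed because transposing
  g k(t) h reverses the sign of t.\<close>

lemma kavg_reverse: "kavg n v = (1 / 2 ^ n) *\<^sub>R (\<Sum>j<2 ^ n. rot (- (2 * pi * real j / 2 ^ n)) v)"
proof -
  let ?f = "\<lambda>j. rot (2 * pi * real j / 2 ^ n) v"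
  have r: "rot (- (2 * pi * real j / 2 ^ n)) v = ?f (2 ^ n - j)" if "j < 2 ^ n" for j
  proof -
    have "?f (2 ^ n - j) = rot (- (2 * pi * real j / 2 ^ n) + 2 * pi) v"
      using that by (simp add: of_nat_diff field_simps)
    then show ?thesis by (simp only: rot_add rot_periodic)
  qed
  have "(\<Sum>j<2 ^ n. rot (- (2 * pi * real j / 2 ^ n)) v) = (\<Sum>j<2 ^ n. ?f (Suc (2 ^ n - Suc j)))"
    by (intro sum.cong refl, subst r) (auto simp: Suc_diff_Suc)
  also have "\<dots> = (\<Sum>j<2 ^ n. ?f (Suc j))"
    by (rule sum.nat_diff_reindex[of "\<lambda>j. ?f (Suc j)"])
  also have "\<dots> = (\<Sum>j<2 ^ n. ?f j)"
    using sum.lessThan_Suc_shift[of ?f "2 ^ n"] sum.lessThan_Suc[of ?f "2 ^ n"] rot_periodic[of v] by simp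
  finally show ?thesis by (simp add: kavg_def)
qed

end

section \<open>Polar decomposition and Gelfand's trick\<close>

lemma SL2_polar:
  assumes "g \<in> SL2"
  obtains t s where "s \<in> SL2" "transpose s = s" "g = kmat t ** s"
proof -
  obtain a b c d where g: "g = mat2 a b c d" "a * d - b * c = 1" using assms SL2_cases by blast
  \<comment> \<open>The angle of the vector (a + d, b - c) is the one whose removal leaves a
    symmetric factor. That factor is not claimed to be positive definite.\<close>
  obtain r t where rt: "a + d = r * cos t" "b - c = r * sin t" using polar_Ex by metis
  define s where "s = kmat (- t) ** g"
  have "cos t * b - sin t * d = sin t * a + cos t * c"
    using rt by (smt (verit, ccfv_threshold) distrib_left mult.assoc mult.commute right_diff_distrib)
  then have "transpose s = s"
    unfolding s_def g kmat_def by (simp add: mat2_mult mat2_transpose mat2_eq_iff)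
  moreover have "g = kmat t ** s"
    unfolding s_def matrix_mul_assoc by (simp flip: kmat_add)
  moreover have "s \<in> SL2" using assms by (simp add: s_def)
  ultimately show ?thesis using that by blast
qed

lemma transpose_kmat: "transpose (kmat t) = kmat (- t)"
  by (simp add: kmat_def mat2_transpose)

text \<open>Inversion in SL2 is transposition followed by conjugation with the rotation by pi/2.
  Between K-fixed vectors that conjugation disappears, so symmetric g give symmetric forms
  there.\<close>

lemma adj2_eq_conj_transpose:
  assumes "g \<in> SL2" shows "adj2 g = kmat (pi/2) ** transpose g ** kmat (- (pi/2))"
  using assms by (elim SL2_cases) (simp add: kmat_def mat2_mult mat2_transpose)

context sl2_rep
begin

text \<open>Gelfand's trick: transposition is an anti-involution which fixes every double coset of K.\<close>

lemma inner_pi_transpose: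
  assumes g: "g \<in> SL2" and u: "K_invariant \<pi> u" and w: "K_invariant \<pi> w"
  shows "inner (\<pi> g u) w = inner (\<pi> (transpose g) u) w"
proof -
  obtain t s where s: "s \<in> SL2" "transpose s = s" "g = kmat t ** s" using SL2_polar[OF g] .
  have "inner (\<pi> g u) w = inner (\<pi> s u) w"
    using w by (simp add: s(1,3) pi_mult inner_rot_left K_invariant_def)
  moreover have "transpose g = s ** kmat (- t)"
    by (simp add: s(2,3) matrix_transpose_mul transpose_kmat)
  then have "\<pi> (transpose g) u = \<pi> s u" using u by (simp add: s(1) pi_mult K_invariant_def)
  ultimately show ?thesis by simp
qed

lemma inner_pi_sym:
  assumes g: "g \<in> SL2" "transpose g = g" and u: "K_invariant \<pi> u" and w: "K_invariant \<pi> w"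
  shows "inner (\<pi> g u) w = inner u (\<pi> g w)"
proof -
  have "inner (\<pi> g u) w = inner u (rot (pi/2) (\<pi> g (rot (- (pi/2)) w)))"
    using g by (simp add: inner_pi_left adj2_eq_conj_transpose pi_mult)
  also have "\<dots> = inner (rot (- (pi/2)) u) (\<pi> g (rot (- (pi/2)) w))"
    by (metis inner_commute inner_rot_left minus_minus)
  also have "\<dots> = inner u (\<pi> g w)"
    using u w by (simp add: K_invariant_def)
  finally show ?thesis .
qed

text \<open>Inserting k(t) between g and h and transposing gives h k(-t) g; averaging over t turns
  both k(t) and k(-t) into \<open>PK\<close>.\<close>

lemma Gelfand_commute:
  assumes g: "g \<in> SL2" "transpose g = g" and h: "h \<in> SL2" "transpose h = h"
    and u: "K_invariant \<pi> u" and w: "K_invariant \<pi> w"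
  shows "inner (\<pi> g (PK (\<pi> h u))) w = inner (\<pi> h (PK (\<pi> g u))) w"
proof -
  have swap: "inner (\<pi> g (rot t (\<pi> h u))) w = inner (\<pi> h (rot (- t) (\<pi> g u))) w" for t
  proof -
    have "inner (\<pi> g (rot t (\<pi> h u))) w = inner (\<pi> (g ** kmat t ** h) u) w"
      by (simp add: g h pi_mult)
    also have "\<dots> = inner (\<pi> (transpose (g ** kmat t ** h)) u) w"
      by (intro inner_pi_transpose u w) (simp add: g h)
    also have "transpose (g ** kmat t ** h) = h ** kmat (- t) ** g"
      by (simp add: matrix_transpose_mul transpose_kmat g h matrix_mul_assoc)
    finally show ?thesis by (simp add: g h pi_mult)
  qed
  have "inner (\<pi> g (kavg n (\<pi> h u))) w = inner (\<pi> h (kavg n (\<pi> g u))) w" for n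
    by (subst kavg_reverse[of n "\<pi> g u"])
       (simp add: kavg_def g h pi_scale pi_sum inner_sum_left swap)
  moreover have "(\<lambda>n. inner (\<pi> g (kavg n (\<pi> h u))) w) \<longlonglongrightarrow> inner (\<pi> g (PK (\<pi> h u))) w"
    by (intro tendsto_intros bounded_linear.tendsto[OF bounded_linear_pi[OF g(1)]] kavg_LIMSEQ)
  moreover have "(\<lambda>n. inner (\<pi> h (kavg n (\<pi> g u))) w) \<longlonglongrightarrow> inner (\<pi> h (PK (\<pi> g u))) w"
    by (intro tendsto_intros bounded_linear.tendsto[OF bounded_linear_pi[OF h(1)]] kavg_LIMSEQ)
  ultimately show ?thesis by (simp add: LIMSEQ_unique)
qed

text \<open>The compression of \<open>\<pi> g\<close> to the K-fixed vectors, extended by 0 to their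
  complement so that it acts on the whole space. For symmetric g these are commuting self-adjoint
  contractions.\<close>

definition sph :: "real^2^2 \<Rightarrow> 'h \<Rightarrow> 'h" where "sph g v = PK (\<pi> g (PK v))"

lemma sph_bounded_linear: "g \<in> SL2 \<Longrightarrow> bounded_linear (sph g)"
  unfolding sph_def
  by (intro bounded_linear_compose[OF PK_bounded_linear] bounded_linear_compose[OF bounded_linear_pi PK_bounded_linear])

lemma sph_norm: "g \<in> SL2 \<Longrightarrow> norm (sph g v) \<le> norm v"
  unfolding sph_def by (metis PK_norm norm_pi order_trans)

lemma sph_sym: "g \<in> SL2 \<Longrightarrow> transpose g = g \<Longrightarrow> inner (sph g v) w = inner v (sph g w)"
  unfolding sph_def by (simp add: PK_sym[of "\<pi> g (PK v)"] PK_sym[of v, symmetric] inner_pi_sym PK_K_invariant)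

lemma eq_if_inner_K_invariant:
  assumes "K_invariant \<pi> a" "K_invariant \<pi> b" "\<And>w. K_invariant \<pi> w \<Longrightarrow> inner a w = inner b w"
  shows "a = b"
proof -
  have "inner (a - b) (a - b) = 0"
    using assms(3)[OF K_invariant_diff[OF assms(1,2)]] by (simp add: inner_diff_left)
  then show ?thesis by simp
qed

lemma sph_commute:
  assumes "g \<in> SL2" "transpose g = g" "h \<in> SL2" "transpose h = h"
  shows "sph g (sph h v) = sph h (sph g v)"
proof (rule eq_if_inner_K_invariant)
  fix w assume w: "K_invariant \<pi> w"
  show "inner (sph g (sph h v)) w = inner (sph h (sph g v)) w"
    using Gelfand_commute[OF assms PK_K_invariant w, of v] w
    by (simp add: sph_def inner_PK PK_fix[OF PK_K_invariant])
qed (simp_all add: sph_def PK_K_invariant)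

definition VK :: "'h set \<Rightarrow> 'h set" where "VK V = {v \<in> V. K_invariant \<pi> v}"

lemma inv_subspace_generated:
  assumes "J ` U \<subseteq> U"
  shows "inv_subspace J \<pi> (closure (span {\<pi> g u |g u. g \<in> SL2 \<and> u \<in> U}))"
proof -
  let ?G = "{\<pi> g u |g u. g \<in> SL2 \<and> u \<in> U}"
  have inv: "f ` closure (span ?G) \<subseteq> closure (span ?G)" if f: "bounded_linear f" "f ` ?G \<subseteq> ?G" for f
  proof -
    have "f ` span ?G = span (f ` ?G)" using f(1) by (simp add: bounded_linear.linear linear_span_image)
    then have "f ` span ?G \<subseteq> closure (span ?G)" 
      using span_mono[OF f(2)] closure_subset[of "span ?G"] by simp
    then show ?thesis
      by (intro image_closure_subset linear_continuous_on f(1) closed_closure)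
  qed
  have "J ` ?G \<subseteq> ?G"
  proof
    fix y assume "y \<in> J ` ?G"
    then obtain g u where gu: "g \<in> SL2" "u \<in> U" "y = J (\<pi> g u)" by blast
    then have "y = \<pi> g (J u)" "J u \<in> U" using assms by (auto simp: pi_J)
    then show "y \<in> ?G" using gu(1) by blast
  qed
  then have "J ` closure (span ?G) \<subseteq> closure (span ?G)" by (rule inv[OF bounded_linear_J])
  moreover have "\<pi> h ` closure (span ?G) \<subseteq> closure (span ?G)" if h: "h \<in> SL2" for h
  proof (rule inv[OF bounded_linear_pi[OF h]], rule subsetI)
    fix y assume "y \<in> \<pi> h ` ?G"
    then obtain g u where gu: "g \<in> SL2" "u \<in> U" "y = \<pi> h (\<pi> g u)" by blast
    then have "y = \<pi> (h ** g) u" using h by (simp add: pi_mult)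
    then show "y \<in> ?G" using gu(1,2) h SL2_mult by blast
  qed
  ultimately show ?thesis unfolding inv_subspace_def by (simp add: subspace_closure)
qed

interpretation PK: bounded_linear PK by (rule PK_bounded_linear)

section \<open>Schur's lemma for the K-invariant vectors\<close>

lemma inv_subspace_pi: "inv_subspace J \<pi> V \<Longrightarrow> g \<in> SL2 \<Longrightarrow> v \<in> V \<Longrightarrow> \<pi> g v \<in> V"
  by (auto simp: inv_subspace_def)

lemma irreducible_generated:
  assumes V: "irreducible_sub J \<pi> V" and U: "J ` U \<subseteq> U" "U \<subseteq> V" "u \<in> U" "u \<noteq> 0"
  shows "closure (span {\<pi> g u |g u. g \<in> SL2 \<and> u \<in> U}) = V"
proof -
  let ?G = "{\<pi> g u |g u. g \<in> SL2 \<and> u \<in> U}"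
  have invV: "closed V" "subspace V" "\<And>g v. g \<in> SL2 \<Longrightarrow> v \<in> V \<Longrightarrow> \<pi> g v \<in> V"
    using V by (auto simp: irreducible_sub_def inv_subspace_def)
  have "?G \<subseteq> V" using U(2) invV(3) by blast
  then have sub: "closure (span ?G) \<subseteq> V"
    by (intro closure_minimal span_minimal invV)
  have "u \<in> ?G" using U(3) by (metis (mono_tags, lifting) mem_Collect_eq one_in_SL2 pi_one)
  then have "u \<in> closure (span ?G)" by (intro subsetD[OF closure_subset] span_base)
  then have "closure (span ?G) \<noteq> {0}" using U(4) by blast
  moreover have "closure (span ?G) = {0} \<or> closure (span ?G) = V"
    using V inv_subspace_generated[OF U(1)] sub by (simp only: irreducible_sub_def)
  ultimately show ?thesis by simp
qed

text \<open>By irreducibility the translates of \<open>U\<close> span a dense subspace of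
  \<open>V\<close>, and \<open>PK\<close> sends each translate back into \<open>U\<close>; as
  \<open>PK\<close> fixes \<open>VK V\<close>, nothing of it lies outside \<open>U\<close>. Testing
  symmetric g is enough, because the rotation in g = k s is absorbed by \<open>PK\<close>.\<close>

lemma irreducible_VK:
  assumes V: "irreducible_sub J \<pi> V"
    and U: "closed U" "subspace U" "J ` U \<subseteq> U" "U \<subseteq> VK V" "u \<in> U" "u \<noteq> 0"
    and inv: "\<And>g u. g \<in> SL2 \<Longrightarrow> transpose g = g \<Longrightarrow> u \<in> U \<Longrightarrow> PK (\<pi> g u) \<in> U"
  shows "U = VK V"
proof (rule antisym[OF U(4)], rule subsetI)
  let ?G = "{\<pi> g u |g u. g \<in> SL2 \<and> u \<in> U}"
  fix w assume w: "w \<in> VK V"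
  have "closure (span ?G) = V"
    by (rule irreducible_generated[OF V U(3) _ U(5,6)]) (use U(4) in \<open>auto simp: VK_def\<close>)
  then have "w \<in> closure (span ?G)" using w by (auto simp: VK_def)
  moreover have "PK ` closure (span ?G) \<subseteq> U"
  proof (rule image_closure_subset)
    show "continuous_on (closure (span ?G)) PK" by (rule linear_continuous_on[OF PK_bounded_linear])
    have "PK ` ?G \<subseteq> U"
    proof
      fix y assume "y \<in> PK ` ?G"
      then obtain g u where gu: "g \<in> SL2" "u \<in> U" "y = PK (\<pi> g u)" by blast
      obtain t s where s: "s \<in> SL2" "transpose s = s" "g = kmat t ** s" using SL2_polar[OF gu(1)] .
      have "y = PK (\<pi> s u)" by (simp add: gu(3) s(1,3) pi_mult PK_rot)
      then show "y \<in> U" using inv[OF s(1,2) gu(2)] by simp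
    qed
    then have "span (PK ` ?G) \<subseteq> U" by (rule span_minimal[OF _ U(2)])
    then show "PK ` span ?G \<subseteq> U" by (simp only: linear_span_image[OF PK.linear_axioms])
  qed (rule U(1))
  ultimately have "PK w \<in> U" by blast
  then show "w \<in> U" using w by (simp add: VK_def PK_fix)
qed

lemma VK_closed_subspace:
  assumes "inv_subspace J \<pi> V" shows "closed (VK V)" "subspace (VK V)" "J ` VK V \<subseteq> VK V"
proof -
  have "VK V = V \<inter> {v. K_invariant \<pi> v}" by (auto simp: VK_def)
  then show "closed (VK V)" "subspace (VK V)"
    using assms K_invariant_closed K_invariant_subspace
    by (auto simp: inv_subspace_def closed_Int subspace_inter)
  show "J ` VK V \<subseteq> VK V" using assms by (auto simp: VK_def inv_subspace_def K_invariant_J)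
qed

text \<open>Let A be a positive multiple of \<open>sph g\<close> minus \<open>c\<close>. The kernel
  of |A| - A in \<open>VK V\<close> is stable under all symmetric \<open>sph h\<close>, so it is
  everything or 0. In the first case A = |A|. In the second, (|A| - A)(|A| + A) = 0 forces A =
  -|A|.\<close>

lemma sph_semidefinite:
  assumes V: "irreducible_sub J \<pi> V" and g: "g \<in> SL2" "transpose g = g"
  shows "(\<forall>v\<in>VK V. inner (sph g v) v \<ge> c * inner v v) \<or> (\<forall>v\<in>VK V. inner (sph g v) v \<le> c * inner v v)"
proof -
  have invV: "inv_subspace J \<pi> V" using V by (simp add: irreducible_sub_def)
  note VK = VK_closed_subspace[OF invV]
  interpret S: bounded_linear "sph g" by (rule sph_bounded_linear[OF g(1)])
  define r where "r = 1 / (1 + \<bar>c\<bar>)"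
  have r: "r > 0" "r * (1 + \<bar>c\<bar>) = 1" by (auto simp: r_def field_simps add_nonneg_pos)
  define A where "A v = r *\<^sub>R (sph g v - c *\<^sub>R v)" for v
  have linA: "linear A" by (intro linearI) (auto simp: A_def S.add S.scaleR algebra_simps)
  have normA: "norm (A v) \<le> norm v" for v
  proof -
    have "norm (sph g v - c *\<^sub>R v) \<le> norm v + \<bar>c\<bar> * norm v"
      using norm_triangle_ineq4[of "sph g v" "c *\<^sub>R v"] sph_norm[OF g(1), of v] by simp
    then have "r * norm (sph g v - c *\<^sub>R v) \<le> r * ((1 + \<bar>c\<bar>) * norm v)"
      using r(1) by (intro mult_left_mono) (auto simp: algebra_simps)
    also have "\<dots> = norm v" using r(2) by (metis mult.assoc mult_1)
    finally show ?thesis using r(1) by (simp add: A_def)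
  qed
  have symA: "inner (A v) w = inner v (A w)" for v w
    by (simp add: A_def inner_diff sph_sym[OF g])
  obtain Q where blQ: "bounded_linear Q" and QQ: "\<forall>v. Q (Q v) = A (A v)" and Qpos: "\<forall>v. inner (Q v) v \<ge> 0"
    and Qc: "\<forall>C v. bounded_linear C \<longrightarrow> (\<forall>v. A (C v) = C (A v)) \<longrightarrow> Q (C v) = C (Q v)"
    and QU: "\<forall>U v. closed U \<longrightarrow> subspace U \<longrightarrow> (\<forall>v\<in>U. A v \<in> U) \<longrightarrow> v \<in> U \<longrightarrow> Q v \<in> U"
    using abs_operator_exists[OF linA normA symA] by (elim exE conjE) (rule that)
  note Q = blQ QQ[rule_format] Qpos[rule_format] Qc[rule_format] QU[rule_format]
  interpret Q: bounded_linear Q by (rule Q(1))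
  interpret A: linear A by (rule linA)
  have blA: "bounded_linear A" by (rule bounded_linear_intro[of _ 1]) (simp_all add: A.add A.scale normA)
  have Acomm: "A (sph h v) = sph h (A v)" if h: "h \<in> SL2" "transpose h = h" for h v
  proof -
    interpret T: bounded_linear "sph h" by (rule sph_bounded_linear[OF h(1)])
    show ?thesis by (simp add: A_def T.diff T.scaleR sph_commute[OF g h])
  qed
  have AJ: "A (J v) = J (A v)" for v
    by (simp add: A_def sph_def PK_J pi_J g J_diff J_scale)
  have Qcomm: "Q (sph h v) = sph h (Q v)" if "h \<in> SL2" "transpose h = h" for h v
    by (rule Q(4)[OF sph_bounded_linear]) (use that Acomm in auto)
  have QJ: "Q (J v) = J (Q v)" for v by (rule Q(4)[OF bounded_linear_J AJ])
  have QA: "Q (A v) = A (Q v)" for v by (rule Q(4)[OF blA]) simp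
  have sphVK: "sph h v \<in> VK V" if "h \<in> SL2" "v \<in> VK V" for h v
    using that invV PK_in[OF invV] inv_subspace_pi[OF invV]
      by (auto simp: sph_def VK_def PK_K_invariant)
  have A_VK: "A v \<in> VK V" if "v \<in> VK V" for v
    unfolding A_def using that sphVK[OF g(1)] VK(2) by (intro subspace_scale subspace_diff) auto
  have Q_VK: "Q v \<in> VK V" if "v \<in> VK V" for v
    by (rule Q(5)[OF VK(1,2) A_VK that])
  define N where "N = {v \<in> VK V. Q v = A v}"
  have N_eq: "N = VK V \<inter> {v. Q v = A v}" by (auto simp: N_def)
  have N: "closed N" "subspace N" "J ` N \<subseteq> N"
  proof -
    show "closed N" unfolding N_eq
      by (intro closed_Int VK(1) closed_Collect_eq linear_continuous_on Q(1) blA)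
    show "subspace N" unfolding N_eq
      by (intro subspace_inter VK(2)) (auto simp: subspace_def Q.add A.add Q.scaleR A.scale Q.zero A.zero)
    show "J ` N \<subseteq> N" using VK(3) by (auto simp: N_def QJ AJ)
  qed
  have Ninv: "PK (\<pi> h u) \<in> N" if h: "h \<in> SL2" "transpose h = h" and "u \<in> N" for h u
  proof -
    have u: "u \<in> VK V" "Q u = A u" using that by (auto simp: N_def)
    then have "PK (\<pi> h u) = sph h u" by (simp add: sph_def VK_def PK_fix)
    then show ?thesis using u sphVK h by (simp add: N_def Qcomm Acomm)
  qed
  have A_inner: "inner (A v) v = r * (inner (sph g v) v - c * inner v v)" for v
    by (simp add: A_def inner_diff)
  show ?thesis
  proof (cases "\<exists>u\<in>N. u \<noteq> 0")
    case True
    then obtain u where u: "u \<in> N" "u \<noteq> 0" by blast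
    have "N \<subseteq> VK V" by (auto simp: N_def)
    from irreducible_VK[OF V N(1-3) this u Ninv] have "N = VK V" .
    then have "Q v = A v" if "v \<in> VK V" for v using that N_def by blast
    then have "inner (A v) v \<ge> 0" if "v \<in> VK V" for v using that Q(3)[of v] by simp
    then show ?thesis using r(1) by (auto simp: A_inner zero_le_mult_iff)
  next
    case False
    have "inner (A v) v \<le> 0" if v: "v \<in> VK V" for v
    proof -
      have "Q v + A v \<in> N"
        using v A_VK Q_VK VK(2) by (auto simp: N_def Q.add A.add Q(2) QA subspace_add)
      then have "Q v + A v = 0" using False by blast
      then have "A v = - Q v" by (simp add: eq_neg_iff_add_eq_0 add.commute)
      then show ?thesis using Q(3)[of v] by simp
    qed
    then show ?thesis using r(1) by (auto simp: A_inner mult_le_0_iff)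
  qed
qed

text \<open>Two different Rayleigh quotients would contradict semidefiniteness at a value between
  them; the midpoint is used. A constant quotient makes the operator scalar by polarization.\<close>

lemma sph_scalar:
  assumes V: "irreducible_sub J \<pi> V" and g: "g \<in> SL2" "transpose g = g"
  shows "\<exists>c. \<forall>v\<in>VK V. PK (\<pi> g v) = c *\<^sub>R v"
proof (cases "\<exists>e\<in>VK V. e \<noteq> 0")
  case False
  then have "\<forall>v\<in>VK V. PK (\<pi> g v) = 0 *\<^sub>R v" using g by (auto simp: PK.zero)
  then show ?thesis by blast
next
  case True
  then obtain e where e: "e \<in> VK V" "e \<noteq> 0" by blast
  have invV: "inv_subspace J \<pi> V" using V by (simp add: irreducible_sub_def)
  note VK = VK_closed_subspace[OF invV]
  interpret S: bounded_linear "sph g" by (rule sph_bounded_linear[OF g(1)])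
  define c where "c = inner (sph g e) e / inner e e"
  have ratio: "inner (sph g v) v = c * inner v v" if v: "v \<in> VK V" for v
  proof (cases "v = 0")
    case False
    define d where "d = inner (sph g v) v / inner v v"
    have pos: "inner v v > 0" "inner e e > 0" using False e by auto
    have ev: "inner (sph g e) e = c * inner e e" "inner (sph g v) v = d * inner v v"
      using pos by (simp_all add: c_def d_def)
    have "(h \<le> c \<and> h \<le> d) \<or> (c \<le> h \<and> d \<le> h)" for h
      using sph_semidefinite[OF V g, of h]
    proof
      assume a: "\<forall>v\<in>VK V. h * inner v v \<le> inner (sph g v) v"
      have "h * inner e e \<le> c * inner e e" "h * inner v v \<le> d * inner v v"
        using bspec[OF a e(1)] bspec[OF a v] unfolding ev .
      then show ?thesis using pos by simp
    next
      assume a: "\<forall>v\<in>VK V. inner (sph g v) v \<le> h * inner v v"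
      have "c * inner e e \<le> h * inner e e" "d * inner v v \<le> h * inner v v"
        using bspec[OF a e(1)] bspec[OF a v] unfolding ev .
      then show ?thesis using pos by simp
    qed
    from this[of "(c + d) / 2"] have "c \<le> d \<and> d \<le> c" by (auto simp: field_simps)
    then have "c = d" by (simp add: order_antisym)
    then show ?thesis using ev by simp
  qed simp
  have "PK (\<pi> g v) = c *\<^sub>R v" if v: "v \<in> VK V" for v
  proof -
    have gv: "PK (\<pi> g w) = sph g w" if "w \<in> VK V" for w using that by (simp add: sph_def VK_def PK_fix)
    define w where "w = sph g v - c *\<^sub>R v"
    have w: "w \<in> VK V" unfolding w_def
    proof (intro subspace_diff subspace_scale VK(2) v)
      show "sph g v \<in> VK V"
        using v invV PK_in[OF invV] g inv_subspace_pi[OF invV]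
      by (auto simp: sph_def VK_def PK_K_invariant)
    qed
    have "inner (sph g (v + w)) (v + w) = c * inner (v + w) (v + w)"
      by (intro ratio subspace_add VK(2) v w)
    then have "2 * inner (sph g v) w = 2 * c * inner v w"
      using ratio[OF v] ratio[OF w] sph_sym[OF g, of w v]
      by (simp add: S.add inner_add algebra_simps inner_commute)
    then have "inner w w = 0" unfolding w_def[symmetric]
      by (subst (1) w_def) (simp add: inner_diff_left)
    then show ?thesis using gv[OF v] by (simp add: w_def)
  qed
  then show ?thesis by blast
qed

text \<open>For symmetric g the compressed operators act on \<open>VK V\<close> by real scalars, so
  the complex line through \<open>e\<close> is already stable and the Schur argument makes it
  everything. It is spanned by \<open>e\<close> and \<open>J e\<close> because scalars are real
  throughout.\<close>

lemma VK_line: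
  assumes V: "irreducible_sub J \<pi> V" and e: "e \<in> VK V" "norm e = 1" and v: "v \<in> VK V"
  shows "v = inner v e *\<^sub>R e + inner v (J e) *\<^sub>R J e"
proof -
  have invV: "inv_subspace J \<pi> V" using V by (simp add: irreducible_sub_def)
  note VK = VK_closed_subspace[OF invV]
  have ee: "inner e e = 1" using e(2) by (simp flip: power2_norm_eq_inner)
  have Je: "J e \<in> VK V" using VK(3) e(1) by blast
  define U where "U = {v \<in> VK V. v = inner v e *\<^sub>R e + inner v (J e) *\<^sub>R J e}"
  have U_eq: "U = VK V \<inter> {v. v = inner v e *\<^sub>R e + inner v (J e) *\<^sub>R J e}" by (auto simp: U_def)
  have UI: "a *\<^sub>R e + b *\<^sub>R J e \<in> U" for a b
    unfolding U_def using e(1) Je VK(2) by (auto simp: inner_add ee subspace_add subspace_scale)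
  have "U = VK V"
  proof (rule irreducible_VK[OF V])
    show "closed U" unfolding U_eq
      by (intro closed_Int VK(1) closed_Collect_eq continuous_intros)
    show "subspace U" unfolding U_eq
    proof (intro subspace_inter VK(2) subspaceI CollectI)
      fix x y and c :: real
      assume "x \<in> {v. v = inner v e *\<^sub>R e + inner v (J e) *\<^sub>R J e}"
        "y \<in> {v. v = inner v e *\<^sub>R e + inner v (J e) *\<^sub>R J e}"
      then have x: "x = inner x e *\<^sub>R e + inner x (J e) *\<^sub>R J e"
        and y: "y = inner y e *\<^sub>R e + inner y (J e) *\<^sub>R J e" by simp_all
      show "x + y = inner (x + y) e *\<^sub>R e + inner (x + y) (J e) *\<^sub>R J e"
        by (subst x, subst y) (simp add: inner_add_left scaleR_add_left)
      show "c *\<^sub>R x = inner (c *\<^sub>R x) e *\<^sub>R e + inner (c *\<^sub>R x) (J e) *\<^sub>R J e"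
        by (subst x) (simp add: scaleR_add_right)
    qed simp
    show "J ` U \<subseteq> U"
    proof
      fix y assume "y \<in> J ` U"
      then obtain u where u: "y = J u" "u = inner u e *\<^sub>R e + inner u (J e) *\<^sub>R J e" by (auto simp: U_def)
      have "y = (- inner u (J e)) *\<^sub>R e + inner u e *\<^sub>R J e"
        by (subst u(1), subst u(2)) (simp add: J_add J_scale)
      then show "y \<in> U" using UI by metis
    qed
    show "U \<subseteq> VK V" by (auto simp: U_def)
    show "e \<in> U" using UI[of 1 0] by simp
    show "e \<noteq> 0" using e(2) by auto
    show "PK (\<pi> g u) \<in> U" if "g \<in> SL2" "transpose g = g" "u \<in> U" for g u
    proof -
      obtain c where "\<forall>v\<in>VK V. PK (\<pi> g v) = c *\<^sub>R v"
        using sph_scalar[OF V \<open>g \<in> SL2\<close> \<open>transpose g = g\<close>] by blast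
      then have "PK (\<pi> g u) = c *\<^sub>R u" using \<open>u \<in> U\<close> by (auto simp: U_def)
      then show ?thesis using \<open>subspace U\<close> \<open>u \<in> U\<close> by (simp add: subspace_scale)
    qed
  qed
  then show ?thesis using v by (auto simp: U_def)
qed

end

section \<open>Differentiating along curves in the group\<close>

lemma has_vector_derivative_at_0_iff:
  fixes f :: "real \<Rightarrow> 'a::real_normed_vector"
  shows "(f has_vector_derivative f') (at 0) \<longleftrightarrow> ((\<lambda>h. (f h - f 0) /\<^sub>R h) \<longlongrightarrow> f') (at 0)"
proof -
  have "(f has_vector_derivative f') (at 0) \<longleftrightarrow>
      ((\<lambda>h. norm (f h - f 0 - h *\<^sub>R f') / norm h) \<longlongrightarrow> 0) (at 0)"
    unfolding has_vector_derivative_def has_derivative_at by (simp add: bounded_linear_scaleR_left)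
  also have "\<dots> \<longleftrightarrow> ((\<lambda>h. norm ((f h - f 0) /\<^sub>R h - f')) \<longlongrightarrow> 0) (at 0)"
  proof (rule tendsto_cong)
    have "norm (f h - f 0 - h *\<^sub>R f') / norm h = norm ((f h - f 0) /\<^sub>R h - f')" if "h \<noteq> 0" for h
    proof -
      have "(f h - f 0) /\<^sub>R h - f' = (f h - f 0 - h *\<^sub>R f') /\<^sub>R h" using that by (simp add: scaleR_diff_right)
      then show ?thesis by (simp add: divide_inverse)
    qed
    then show "\<forall>\<^sub>F h in at 0. norm (f h - f 0 - h *\<^sub>R f') / norm h = norm ((f h - f 0) /\<^sub>R h - f')"
      by (simp add: eventually_at_filter)
  qed
  also have "\<dots> \<longleftrightarrow> ((\<lambda>h. (f h - f 0) /\<^sub>R h) \<longlongrightarrow> f') (at 0)"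
    by (simp only: tendsto_norm_zero_iff LIM_zero_iff)
  finally show ?thesis .
qed

text \<open>The bottom row of n(x) a(y) k(theta) is exp(-y) times (-sin theta, cos theta), which
  gives y and theta; x follows from the inner product of the two rows. The condition
  \<open>d > 0\<close> puts theta in the range of \<open>arctan\<close>, and it holds near the
  identity.\<close>

lemma iwasawa_coordinates:
  assumes "a * d - b * c = 1" "d > 0"
  shows "mat2 a b c d = nmat ((a * c + b * d) / (c\<^sup>2 + d\<^sup>2)) ** amat (- ln (sqrt (c\<^sup>2 + d\<^sup>2))) ** kmat (- arctan (c / d))"
proof -
  define R where "R = sqrt (c\<^sup>2 + d\<^sup>2)"
  have pos: "c\<^sup>2 + d\<^sup>2 > 0" using assms(2) by (simp add: add_nonneg_pos)
  have R: "R > 0" "R\<^sup>2 = c\<^sup>2 + d\<^sup>2" using pos by (auto simp: R_def)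
  have "1 + (c / d)\<^sup>2 = (R / d)\<^sup>2" using assms(2) by (simp add: R(2) power_divide field_simps)
  then have sq: "sqrt (1 + (c / d)\<^sup>2) = R / d" using R(1) assms(2) by simp
  have cs: "cos (- arctan (c / d)) = d / R" "sin (- arctan (c / d)) = - (c / R)"
    using sq assms(2) by (simp_all add: cos_arctan sin_arctan)
  have e: "exp (- ln R) = 1 / R" "exp (- (- ln R)) = R" using R(1) by (simp_all add: exp_minus divide_inverse)
  have RR: "R * R = c * c + d * d" using R(2) by (simp add: power2_eq_square)
  define k where "k = a * c + b * d"
  have kR: "k / (R * R) * R * (x / R) = k * x / (R * R)" for x using R(1) by simp
  have "a * (R * R) = d + k * c" unfolding RR k_def using assms(1) by algebra
  then have 1: "a = 1 / R * (d / R) + k / (R * R) * R * (c / R)"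
    unfolding kR using R(1) by (simp add: add_divide_distrib[symmetric] eq_divide_eq)
  have "b * (R * R) = k * d - c" unfolding RR k_def using assms(1) by algebra
  then have 2: "b = 1 / R * - (c / R) + k / (R * R) * R * (d / R)"
    unfolding kR using R(1) by (simp add: diff_divide_distrib[symmetric] eq_divide_eq)
  show ?thesis
    unfolding R_def[symmetric] R(2)[symmetric] k_def[symmetric] nmat_def amat_def kmat_def cs e mat2_mult mat2_eq_iff
    using 1 2 R(1) by (simp add: power2_eq_square e)
qed

context sl2_rep
begin

definition D1 :: "'h \<Rightarrow> bool" where
  "D1 v \<longleftrightarrow> (\<lambda>t. \<pi> (nmat t) v) differentiable (at 0) \<and>
     (\<lambda>t. \<pi> (amat t) v) differentiable (at 0) \<and> (\<lambda>t. \<pi> (kmat t) v) differentiable (at 0)"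

abbreviation "Nd \<equiv> dvec \<pi> nmat"
abbreviation "Ad \<equiv> dvec \<pi> amat"
abbreviation "Kd \<equiv> dvec \<pi> kmat"
abbreviation "Sd \<equiv> dvec \<pi> smat"

lemma dvec_works:
  assumes "D1 v"
  shows "((\<lambda>t. \<pi> (nmat t) v) has_vector_derivative Nd v) (at 0)"
    "((\<lambda>t. \<pi> (amat t) v) has_vector_derivative Ad v) (at 0)"
    "((\<lambda>t. \<pi> (kmat t) v) has_vector_derivative Kd v) (at 0)"
  using assms by (simp_all add: D1_def dvec_def vector_derivative_works)

text \<open>Every traceless matrix is \<open>M\<^sub>1\<^sub>1 X\<^sub>A + (M\<^sub>1\<^sub>2 + M\<^sub>2\<^sub>1) X\<^sub>N - M\<^sub>2\<^sub>1 X\<^sub>K\<close>.\<close>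

definition Ld :: "real^2^2 \<Rightarrow> 'h \<Rightarrow> 'h" where
  "Ld M v = (M $ 1 $ 1) *\<^sub>R Ad v + (M $ 1 $ 2 + M $ 2 $ 1) *\<^sub>R Nd v - (M $ 2 $ 1) *\<^sub>R Kd v"

text \<open>Only strong continuity of \<open>\<pi> (g t)\<close> is available. Because these
  operators are isometries, the error in the difference quotient of \<open>w\<close> stays small
  after they are applied.\<close>

lemma pi_product_derivative:
  assumes g: "\<And>t. g t \<in> SL2" "g 0 = mat 1"
    and w: "(w has_vector_derivative w') (at 0)"
    and z: "((\<lambda>t. \<pi> (g t) (w 0)) has_vector_derivative z) (at 0)"
    and cont: "((\<lambda>t. \<pi> (g t) w') \<longlongrightarrow> w') (at 0)"
  shows "((\<lambda>t. \<pi> (g t) (w t)) has_vector_derivative z + w') (at 0)"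
proof -
  have w_lim: "((\<lambda>t. (w t - w 0) /\<^sub>R t) \<longlongrightarrow> w') (at 0)"
    using w by (simp add: has_vector_derivative_at_0_iff)
  have z_lim: "((\<lambda>t. (\<pi> (g t) (w 0) - w 0) /\<^sub>R t) \<longlongrightarrow> z) (at 0)"
    using z by (simp add: has_vector_derivative_at_0_iff g)
  have "((\<lambda>t. norm ((w t - w 0) /\<^sub>R t - w')) \<longlongrightarrow> 0) (at 0)"
    using w_lim by (simp add: LIM_zero tendsto_norm_zero)
  then have "((\<lambda>t. \<pi> (g t) ((w t - w 0) /\<^sub>R t - w')) \<longlongrightarrow> 0) (at 0)"
    by (rule Lim_null_comparison[rotated]) (simp add: g)
  from tendsto_add[OF z_lim tendsto_add[OF this cont]]
  have "((\<lambda>t. (\<pi> (g t) (w t) - w 0) /\<^sub>R t) \<longlongrightarrow> z + w') (at 0)"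
    by (simp add: g pi_diff pi_scale scaleR_diff_right)
  then show ?thesis by (simp add: has_vector_derivative_at_0_iff g)
qed

lemma pi_curve_tendsto:
  fixes f :: "real \<Rightarrow> real"
  assumes "continuous_on UNIV \<gamma>" "\<And>t. \<gamma> t \<in> SL2" "\<gamma> 0 = mat 1" "isCont f 0" "f 0 = 0"
  shows "((\<lambda>t. \<pi> (\<gamma> (f t)) u) \<longlongrightarrow> u) (at 0)"
proof -
  have "continuous_on UNIV (\<lambda>t. \<pi> (\<gamma> t) u)" by (rule continuous_on_pi_curve) (use assms in auto)
  then have "isCont (\<lambda>t. \<pi> (\<gamma> t) u) (f 0)" by (simp add: continuous_on_eq_continuous_at)
  from isCont_o2[OF assms(4) this] show ?thesis by (simp add: isCont_def assms(3,5))
qed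

text \<open>\<open>D1\<close> only asks for derivatives along N, A and K. Near 0 the curve is
  written in Iwasawa coordinates, whose velocities are q + r, p and -r, and the product rule is
  applied twice. The entry \<open>s\<close> is free since \<open>Ld\<close> does not read
  it.\<close>

lemma curve_derivative:
  assumes v: "D1 v" and det: "\<And>t. a t * d t - b t * c t = 1"
    and init: "a 0 = 1" "b 0 = 0" "c 0 = 0" "d 0 = 1"
    and a: "(a has_real_derivative p) (at 0)" and b: "(b has_real_derivative q) (at 0)"
    and c: "(c has_real_derivative r) (at 0)" and d: "(d has_real_derivative - p) (at 0)"
  shows "((\<lambda>t. \<pi> (mat2 (a t) (b t) (c t) (d t)) v) has_vector_derivative Ld (mat2 p q r s) v) (at 0)"
proof -
  define x where "x t = (a t * c t + b t * d t) / ((c t)\<^sup>2 + (d t)\<^sup>2)" for t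
  define y where "y t = - ln (sqrt ((c t)\<^sup>2 + (d t)\<^sup>2))" for t
  define z where "z t = - arctan (c t / d t)" for t
  have x: "(x has_real_derivative q + r) (at 0)"
    unfolding x_def by (auto intro!: derivative_eq_intros a b c d simp: init)
  have y: "(y has_real_derivative p) (at 0)"
    unfolding y_def by (auto intro!: derivative_eq_intros c d simp: init field_simps)
  have z: "(z has_real_derivative - r) (at 0)"
    unfolding z_def by (auto intro!: derivative_eq_intros c d simp: init)
  have xyz0: "x 0 = 0" "y 0 = 0" "z 0 = 0" by (auto simp: x_def y_def z_def init)
  have chain: "((\<lambda>t. \<pi> (\<gamma> (f t)) v) has_vector_derivative f' *\<^sub>R D) (at 0)"
    if "((\<lambda>t. \<pi> (\<gamma> t) v) has_vector_derivative D) (at 0)" "(f has_real_derivative f') (at 0)" "f 0 = 0"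
    for \<gamma> f f' D
    using vector_diff_chain_at[of f f' 0 "\<lambda>t. \<pi> (\<gamma> t) v" D] that
    by (simp add: o_def has_real_derivative_iff_has_vector_derivative)
  have k: "((\<lambda>t. \<pi> (kmat (z t)) v) has_vector_derivative (- r) *\<^sub>R Kd v) (at 0)"
    by (rule chain[OF dvec_works(3)[OF v] z xyz0(3)])
  have ak: "((\<lambda>t. \<pi> (amat (y t)) (\<pi> (kmat (z t)) v)) has_vector_derivative p *\<^sub>R Ad v + (- r) *\<^sub>R Kd v) (at 0)"
  proof (rule pi_product_derivative[OF _ _ k])
    show "((\<lambda>t. \<pi> (amat (y t)) (\<pi> (kmat (z 0)) v)) has_vector_derivative p *\<^sub>R Ad v) (at 0)"
      using chain[OF dvec_works(2)[OF v] y xyz0(2)] by (simp add: xyz0)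
    show "((\<lambda>t. \<pi> (amat (y t)) ((- r) *\<^sub>R Kd v)) \<longlongrightarrow> (- r) *\<^sub>R Kd v) (at 0)"
      by (rule pi_curve_tendsto[OF continuous_on_amat]) (use y DERIV_isCont xyz0 in auto)
  qed (auto simp: xyz0)
  have nak: "((\<lambda>t. \<pi> (nmat (x t)) (\<pi> (amat (y t)) (\<pi> (kmat (z t)) v)))
      has_vector_derivative (q + r) *\<^sub>R Nd v + (p *\<^sub>R Ad v + (- r) *\<^sub>R Kd v)) (at 0)"
  proof (rule pi_product_derivative[OF _ _ ak])
    show "((\<lambda>t. \<pi> (nmat (x t)) (\<pi> (amat (y 0)) (\<pi> (kmat (z 0)) v))) has_vector_derivative (q + r) *\<^sub>R Nd v) (at 0)"
      using chain[OF dvec_works(1)[OF v] x xyz0(1)] by (simp add: xyz0)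
    show "((\<lambda>t. \<pi> (nmat (x t)) (p *\<^sub>R Ad v + (- r) *\<^sub>R Kd v)) \<longlongrightarrow> p *\<^sub>R Ad v + (- r) *\<^sub>R Kd v) (at 0)"
      by (rule pi_curve_tendsto[OF continuous_on_nmat]) (use x DERIV_isCont xyz0 in auto)
  qed (auto simp: xyz0)
  have "isCont d 0" using d by (rule DERIV_isCont)
  then have "\<forall>\<^sub>F t in nhds 0. d t > 0"
    unfolding isCont_def by (metis init(4) order_tendstoD(1) tendsto_at_iff_tendsto_nhds zero_less_one)
  then obtain e where e: "e > 0" "\<And>t. dist t 0 < e \<Longrightarrow> d t > 0"
    unfolding eventually_nhds_metric by blast
  show ?thesis
  proof (rule has_vector_derivative_transform_within[OF _ e(1)])
    show "((\<lambda>t. \<pi> (nmat (x t)) (\<pi> (amat (y t)) (\<pi> (kmat (z t)) v))) has_vector_derivative Ld (mat2 p q r s) v) (at 0)"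
      using nak by (simp add: Ld_def algebra_simps)
    fix t :: real assume "dist t 0 < e"
    then show "\<pi> (nmat (x t)) (\<pi> (amat (y t)) (\<pi> (kmat (z t)) v)) = \<pi> (mat2 (a t) (b t) (c t) (d t)) v"
      using iwasawa_coordinates[OF det e(2)[of t]] unfolding x_def y_def z_def by (simp add: pi_mult)
  qed simp
qed

abbreviation "XA \<equiv> mat2 1 0 0 (-1)"
abbreviation "XS \<equiv> mat2 0 1 1 0"
abbreviation "XK \<equiv> mat2 0 1 (-1) 0"
abbreviation "XN \<equiv> mat2 0 1 0 0"

text \<open>Moving \<open>g\<close> to the left replaces the curve by its conjugate under the
  inverse of \<open>g\<close>, again a curve through 1 in SL2.\<close>

lemma conj_curve_derivative:
  assumes v: "D1 v" and g: "g \<in> SL2" and det: "\<And>t. a t * d t - b t * c t = 1"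
    and init: "a 0 = 1" "b 0 = 0" "c 0 = 0" "d 0 = 1"
    and a: "(a has_real_derivative p) (at 0)" and b: "(b has_real_derivative q) (at 0)"
    and c: "(c has_real_derivative r) (at 0)" and d: "(d has_real_derivative - p) (at 0)"
  shows "((\<lambda>t. \<pi> (mat2 (a t) (b t) (c t) (d t)) (\<pi> g v)) has_vector_derivative
      \<pi> g (Ld (adj2 g ** mat2 p q r (- p) ** g) v)) (at 0)"
proof -
  obtain \<alpha> \<beta> \<gamma> \<delta> where g2: "g = mat2 \<alpha> \<beta> \<gamma> \<delta>" and dg: "\<alpha> * \<delta> - \<beta> * \<gamma> = 1" using g SL2_cases by blast
  let ?m = "\<lambda>t. mat2 (a t) (b t) (c t) (d t)"
  have SL: "?m t \<in> SL2" for t using det by (simp add: mat2_in_SL2)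
  have "det (adj2 g ** ?m t ** g) = 1" for t
    using SL g by (metis (mono_tags, lifting) SL2_def SL2_mult adj2_SL2 mem_Collect_eq)
  note det' = this[unfolded g2 adj2_mat2 mat2_mult det_2 mat2_nth]
  have "((\<lambda>t. \<pi> (adj2 g ** ?m t ** g) v) has_vector_derivative Ld (adj2 g ** mat2 p q r (- p) ** g) v) (at 0)"
    unfolding g2 adj2_mat2 mat2_mult
  proof (rule curve_derivative[OF v det'])
    show "((\<lambda>t. (- \<gamma> * a t + \<alpha> * c t) * \<beta> + (- \<gamma> * b t + \<alpha> * d t) * \<delta>) has_real_derivative
      - ((\<delta> * p + - \<beta> * r) * \<alpha> + (\<delta> * q + - \<beta> * - p) * \<gamma>)) (at 0)"
      by (auto intro!: derivative_eq_intros a b c d simp: algebra_simps)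
  qed (use dg in \<open>auto intro!: derivative_eq_intros a b c d simp: init algebra_simps\<close>)
  then have "((\<lambda>t. \<pi> g (\<pi> (adj2 g ** ?m t ** g) v)) has_vector_derivative
      \<pi> g (Ld (adj2 g ** mat2 p q r (- p) ** g) v)) (at 0)"
    by (rule bounded_linear.has_vector_derivative[OF bounded_linear_pi[OF g]])
  moreover have "\<pi> g (\<pi> (adj2 g ** ?m t ** g) v) = \<pi> (?m t) (\<pi> g v)" for t
    using SL g by (simp add: pi_mult)
  ultimately show ?thesis by simp
qed

lemma conj_derivatives:
  assumes v: "D1 v" and g: "g \<in> SL2"
  shows "((\<lambda>t. \<pi> (nmat t) (\<pi> g v)) has_vector_derivative \<pi> g (Ld (adj2 g ** XN ** g) v)) (at 0)"
    "((\<lambda>t. \<pi> (amat t) (\<pi> g v)) has_vector_derivative \<pi> g (Ld (adj2 g ** XA ** g) v)) (at 0)"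
    "((\<lambda>t. \<pi> (kmat t) (\<pi> g v)) has_vector_derivative \<pi> g (Ld (adj2 g ** XK ** g) v)) (at 0)"
    "((\<lambda>t. \<pi> (smat t) (\<pi> g v)) has_vector_derivative \<pi> g (Ld (adj2 g ** XS ** g) v)) (at 0)"
proof -
  have cosh_sinh: "cosh t * cosh t - sinh t * sinh t = 1" for t :: real
    using cosh_square_eq[of t] by (simp add: power2_eq_square)
  have cos_sin: "cos t * cos t + sin t * sin t = 1" for t :: real
    by (simp flip: power2_eq_square)
  show "((\<lambda>t. \<pi> (nmat t) (\<pi> g v)) has_vector_derivative \<pi> g (Ld (adj2 g ** XN ** g) v)) (at 0)"
    unfolding nmat_def
    by (rule conj_curve_derivative[OF v g, of "\<lambda>_. 1" "\<lambda>_. 1" "\<lambda>t. t" "\<lambda>_. 0" 0 1 0, unfolded minus_zero])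
       (auto intro!: derivative_eq_intros)
  show "((\<lambda>t. \<pi> (amat t) (\<pi> g v)) has_vector_derivative \<pi> g (Ld (adj2 g ** XA ** g) v)) (at 0)"
    unfolding amat_def
    by (rule conj_curve_derivative[OF v g, of exp "\<lambda>t. exp (- t)" "\<lambda>_. 0" "\<lambda>_. 0" 1 0 0])
       (auto intro!: derivative_eq_intros simp flip: exp_add)
  show "((\<lambda>t. \<pi> (kmat t) (\<pi> g v)) has_vector_derivative \<pi> g (Ld (adj2 g ** XK ** g) v)) (at 0)"
    unfolding kmat_def
    by (rule conj_curve_derivative[OF v g, of cos cos sin "\<lambda>t. - sin t" 0 1 "-1", unfolded minus_zero])
       (auto intro!: derivative_eq_intros simp: cos_sin)
  show "((\<lambda>t. \<pi> (smat t) (\<pi> g v)) has_vector_derivative \<pi> g (Ld (adj2 g ** XS ** g) v)) (at 0)"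
    unfolding smat_def
    by (rule conj_curve_derivative[OF v g, of cosh cosh sinh sinh 0 1 1, unfolded minus_zero])
       (auto intro!: derivative_eq_intros simp: cosh_sinh)
qed

lemma D1_pi: "D1 v \<Longrightarrow> g \<in> SL2 \<Longrightarrow> D1 (\<pi> g v)"
  unfolding D1_def using conj_derivatives[of v g] D1_def differentiableI_vector by blast

lemma dvec_pi:
  assumes "D1 v" "g \<in> SL2"
  shows "Nd (\<pi> g v) = \<pi> g (Ld (adj2 g ** XN ** g) v)" "Ad (\<pi> g v) = \<pi> g (Ld (adj2 g ** XA ** g) v)"
    "Kd (\<pi> g v) = \<pi> g (Ld (adj2 g ** XK ** g) v)" "Sd (\<pi> g v) = \<pi> g (Ld (adj2 g ** XS ** g) v)"
  using conj_derivatives[OF assms] by (simp_all add: dvec_def vector_derivative_at)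

lemma Sd_derivative: assumes "D1 v" shows "((\<lambda>t. \<pi> (smat t) v) has_vector_derivative Sd v) (at 0)"
  and Sd_eq: "Sd v = 2 *\<^sub>R Nd v - Kd v"
proof -
  have "((\<lambda>t. \<pi> (smat t) v) has_vector_derivative Ld XS v) (at 0)"
    using conj_derivatives(4)[OF assms one_in_SL2] by (simp add: mat2_one mat2_mult) (simp flip: mat2_one)
  moreover from this have "Sd v = Ld XS v" by (simp add: dvec_def vector_derivative_at)
  ultimately show "((\<lambda>t. \<pi> (smat t) v) has_vector_derivative Sd v) (at 0)" "Sd v = 2 *\<^sub>R Nd v - Kd v"
    by (simp_all add: Ld_def)
qed

lemma D1_add: assumes "D1 u" "D1 v" shows "D1 (u + v)"
  and dvec_add: "Nd (u + v) = Nd u + Nd v" "Ad (u + v) = Ad u + Ad v" "Kd (u + v) = Kd u + Kd v"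
proof -
  note d = dvec_works[OF assms(1)] dvec_works[OF assms(2)]
  have e: "((\<lambda>t. \<pi> (nmat t) (u + v)) has_vector_derivative Nd u + Nd v) (at 0)"
    "((\<lambda>t. \<pi> (amat t) (u + v)) has_vector_derivative Ad u + Ad v) (at 0)"
    "((\<lambda>t. \<pi> (kmat t) (u + v)) has_vector_derivative Kd u + Kd v) (at 0)"
    unfolding pi_add[OF nmat_SL2] pi_add[OF amat_SL2] pi_add[OF kmat_SL2]
    by (intro has_vector_derivative_add d)+
  show "D1 (u + v)" using e by (auto simp: D1_def intro: differentiableI_vector)
  show "Nd (u + v) = Nd u + Nd v" "Ad (u + v) = Ad u + Ad v" "Kd (u + v) = Kd u + Kd v"
    using e by (simp_all add: dvec_def vector_derivative_at)
qed

lemma D1_commute: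
  assumes v: "D1 v" and f: "bounded_linear f" and comm: "\<And>g v. g \<in> SL2 \<Longrightarrow> \<pi> g (f v) = f (\<pi> g v)"
  shows "D1 (f v)" "Nd (f v) = f (Nd v)" "Ad (f v) = f (Ad v)" "Kd (f v) = f (Kd v)"
proof -
  note d = dvec_works[OF v]
  have e: "((\<lambda>t. \<pi> (nmat t) (f v)) has_vector_derivative f (Nd v)) (at 0)"
    "((\<lambda>t. \<pi> (amat t) (f v)) has_vector_derivative f (Ad v)) (at 0)"
    "((\<lambda>t. \<pi> (kmat t) (f v)) has_vector_derivative f (Kd v)) (at 0)"
    unfolding comm[OF nmat_SL2] comm[OF amat_SL2] comm[OF kmat_SL2]
    by (intro bounded_linear.has_vector_derivative[OF f] d)+
  show "D1 (f v)" using e by (auto simp: D1_def intro: differentiableI_vector)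
  show "Nd (f v) = f (Nd v)" "Ad (f v) = f (Ad v)" "Kd (f v) = f (Kd v)"
    using e by (simp_all add: dvec_def vector_derivative_at)
qed

lemmas D1_J = D1_commute[OF _ bounded_linear_J pi_J]
lemmas D1_scale = D1_commute[OF _ bounded_linear_scaleR_right pi_scale]

lemma D1_diff: assumes "D1 u" "D1 v" shows "D1 (u - v)"
  and dvec_diff: "Nd (u - v) = Nd u - Nd v" "Ad (u - v) = Ad u - Ad v" "Kd (u - v) = Kd u - Kd v"
  using D1_add[OF assms(1) D1_scale(1)[OF assms(2), of "-1"]] dvec_add[OF assms(1) D1_scale(1)[OF assms(2), of "-1"]]
    D1_scale[OF assms(2), of "-1"] by simp_all

lemma Sd_linear:
  "D1 u \<Longrightarrow> D1 v \<Longrightarrow> Sd (u + v) = Sd u + Sd v" "D1 u \<Longrightarrow> D1 v \<Longrightarrow> Sd (u - v) = Sd u - Sd v"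
  "D1 u \<Longrightarrow> Sd (c *\<^sub>R u) = c *\<^sub>R Sd u" "D1 u \<Longrightarrow> Sd (J u) = J (Sd u)"
  by (simp_all add: Sd_eq D1_add D1_diff D1_scale D1_J dvec_add dvec_diff J_diff J_scale algebra_simps)

end

section \<open>Smooth vectors and the Casimir operator\<close>

lemma iw_vector: "iw (vector [x, y, z]) = nmat x ** amat y ** kmat z"
  by (simp add: iw_def vector_3)

lemma vector_add_axis:
  "(vector [x, y, z] :: real^3) + t *\<^sub>R axis 1 1 = vector [x + t, y, z]"
  "(vector [x, y, z] :: real^3) + t *\<^sub>R axis 2 1 = vector [x, y + t, z]"
  "(vector [x, y, z] :: real^3) + t *\<^sub>R axis 3 1 = vector [x, y, z + t]"
  by (simp_all add: vec_eq_iff forall_3 axis_def vector_3)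

lemma differentiable_real_scaleR:
  fixes G :: "real \<Rightarrow> 'a::real_normed_vector"
  assumes "(f has_real_derivative f') (at 0)" "G differentiable (at 0)"
  shows "(\<lambda>t. f t *\<^sub>R G t) differentiable (at 0)"
  using has_vector_derivative_scaleR[OF assms(1)] assms(2) vector_derivative_works differentiableI_vector
  by metis

context sl2_rep
begin

lemma adj2_adj2: "adj2 (adj2 g) = g"
  by (simp add: adj2_def flip: mat2_eta)

lemma pi_dvec:
  assumes "D1 v" "g \<in> SL2"
  shows "\<pi> g (Nd v) = Ld (g ** XN ** adj2 g) (\<pi> g v)" "\<pi> g (Ad v) = Ld (g ** XA ** adj2 g) (\<pi> g v)"
    "\<pi> g (Kd v) = Ld (g ** XK ** adj2 g) (\<pi> g v)" "\<pi> g (Sd v) = Ld (g ** XS ** adj2 g) (\<pi> g v)"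
  using dvec_pi[OF D1_pi[OF assms] adj2_SL2[OF assms(2)]] assms(2) by (simp_all add: adj2_adj2)

lemma Ld_ASK:
  assumes "D1 v"
  shows "Ld (mat2 p q r s) v = p *\<^sub>R Ad v + ((q + r) / 2) *\<^sub>R Sd v + ((q - r) / 2) *\<^sub>R Kd v"
proof -
  have "Nd v = (1/2) *\<^sub>R (Sd v + Kd v)" by (simp add: Sd_eq[OF assms])
  then have "Ld (mat2 p q r s) v = p *\<^sub>R Ad v + ((q + r) / 2) *\<^sub>R Sd v + (((q + r) / 2) *\<^sub>R Kd v - r *\<^sub>R Kd v)"
    by (simp add: Ld_def scaleR_add_right add_divide_distrib)
  also have "((q + r) / 2) *\<^sub>R Kd v - r *\<^sub>R Kd v = ((q - r) / 2) *\<^sub>R Kd v"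
    by (simp add: field_simps flip: scaleR_diff_left)
  finally show ?thesis .
qed

lemma conj_kmat:
  "kmat t ** XA ** adj2 (kmat t) = mat2 (cos (2*t)) (- sin (2*t)) (- sin (2*t)) (- cos (2*t))"
  "kmat t ** XS ** adj2 (kmat t) = mat2 (sin (2*t)) (cos (2*t)) (cos (2*t)) (- sin (2*t))"
  "kmat t ** XK ** adj2 (kmat t) = XK"
proof -
  have sc: "sin t * sin t = 1 - cos t * cos t" using sin_squared_eq[of t] by (simp add: power2_eq_square)
  show "kmat t ** XA ** adj2 (kmat t) = mat2 (cos (2*t)) (- sin (2*t)) (- sin (2*t)) (- cos (2*t))"
    "kmat t ** XS ** adj2 (kmat t) = mat2 (sin (2*t)) (cos (2*t)) (cos (2*t)) (- sin (2*t))"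
    "kmat t ** XK ** adj2 (kmat t) = XK"
    by (simp_all add: kmat_def mat2_mult mat2_eq_iff cos_double sin_double power2_eq_square sc)
qed

lemma conj_amat:
  "amat t ** XS ** adj2 (amat t) = mat2 0 (cosh (2*t) + sinh (2*t)) (cosh (2*t) - sinh (2*t)) 0"
  "amat t ** XN ** adj2 (amat t) = mat2 0 (exp (2*t)) 0 0"
  by (simp_all add: amat_def mat2_mult mat2_eq_iff cosh_plus_sinh cosh_minus_sinh flip: exp_add)

lemma rot_dvec:
  assumes "D1 v"
  shows "rot t (Ad v) = cos (2 * t) *\<^sub>R Ad (rot t v) - sin (2 * t) *\<^sub>R Sd (rot t v)"
    "rot t (Sd v) = cos (2 * t) *\<^sub>R Sd (rot t v) + sin (2 * t) *\<^sub>R Ad (rot t v)"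
    "rot t (Kd v) = Kd (rot t v)"
  using D1_pi[OF assms, of "kmat t"] by (simp_all add: pi_dvec[OF assms] conj_kmat Ld_ASK)

lemma amat_dvec:
  assumes "D1 v"
  shows "\<pi> (amat t) (Sd v) = cosh (2 * t) *\<^sub>R Sd (\<pi> (amat t) v) + sinh (2 * t) *\<^sub>R Kd (\<pi> (amat t) v)"
    "\<pi> (amat t) (Nd v) = exp (2 * t) *\<^sub>R Nd (\<pi> (amat t) v)"
  using D1_pi[OF assms, of "amat t"]
  by (simp_all add: pi_dvec[OF assms] conj_amat Ld_ASK) (simp add: Sd_eq scaleR_diff_right scaleR_right_distrib)

definition D2 :: "'h \<Rightarrow> bool" where
  "D2 v \<longleftrightarrow> D1 v \<and> D1 (Nd v) \<and> D1 (Ad v) \<and> D1 (Kd v)"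

lemma smooth_D1: assumes "smoothvec \<pi> v" shows "D1 v"
proof -
  define F where "F x = \<pi> (iw x) v" for x
  have "\<forall>i x. (\<lambda>t. fold pd [] F (x + t *\<^sub>R axis i 1)) differentiable (at 0)"
    using assms unfolding smoothvec_def C_inf_def F_def[symmetric] by (rule allE[of _ "[]"]) (erule conjunct2)
  then have h: "(\<lambda>t. \<pi> (iw (vector [0,0,0] + t *\<^sub>R axis i 1)) v) differentiable (at 0)" for i
    by (simp add: F_def)
  from h[of 1] h[of 2] h[of 3] show ?thesis
    unfolding D1_def vector_add_axis iw_vector by simp
qed

text \<open>The partial derivatives in Iwasawa coordinates respect the order n, a, k. Some mixed
  partials therefore differentiate \<open>Nd (\<pi> g v)\<close> or \<open>Ad (\<pi> g v)\<close>,
  whereas \<open>D2\<close> asks for the orbit maps of \<open>Nd v\<close> and \<open>Ad v\<close>.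
  Conjugating the fields by a(t) and k(t), with smooth scalar coefficients, converts one into the
  other.\<close>

lemma smooth_D2: assumes "smoothvec \<pi> v" shows "D2 v"
proof -
  have D: "D1 v" by (rule smooth_D1[OF assms])
  define F where "F x = \<pi> (iw x) v" for x
  have h: "(\<lambda>t. pd j F (p + t *\<^sub>R axis i 1)) differentiable (at 0)" for i j p
  proof -
    have "(\<lambda>t. fold pd [j] F (p + t *\<^sub>R axis i 1)) differentiable (at 0)"
      using assms unfolding smoothvec_def C_inf_def F_def[symmetric] by (rule allE[of _ "[j]"]) (drule conjunct2, erule allE, erule allE)
    then show ?thesis by simp
  qed
  have pdF: "pd 1 F (vector [x, y, z]) = vector_derivative (\<lambda>t. \<pi> (nmat (x + t) ** amat y ** kmat z) v) (at 0)"
    "pd 2 F (vector [x, y, z]) = vector_derivative (\<lambda>t. \<pi> (nmat x ** amat (y + t) ** kmat z) v) (at 0)"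
    "pd 3 F (vector [x, y, z]) = vector_derivative (\<lambda>t. \<pi> (nmat x ** amat y ** kmat (z + t)) v) (at 0)" for x y z
    by (simp_all add: pd_def F_def vector_add_axis iw_vector)
  have push: "vector_derivative (\<lambda>t. \<pi> g (\<pi> (\<gamma> t) v)) (at 0) = \<pi> g (dvec \<pi> \<gamma> v)"
    if "g \<in> SL2" "((\<lambda>t. \<pi> (\<gamma> t) v) has_vector_derivative dvec \<pi> \<gamma> v) (at 0)" for g \<gamma>
    by (rule vector_derivative_at) (rule bounded_linear.has_vector_derivative[OF bounded_linear_pi[OF that(1)] that(2)])
  have n: "pd 1 F (vector [s, 0, 0]) = \<pi> (nmat s) (Nd v)" "pd 2 F (vector [s, 0, 0]) = \<pi> (nmat s) (Ad v)"
    "pd 3 F (vector [s, 0, 0]) = \<pi> (nmat s) (Kd v)" for s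
    by (simp_all add: pdF pi_mult nmat_add push dvec_works[OF D])
  have a: "pd 1 F (vector [0, s, 0]) = Nd (\<pi> (amat s) v)" "pd 2 F (vector [0, s, 0]) = \<pi> (amat s) (Ad v)"
    "pd 3 F (vector [0, s, 0]) = \<pi> (amat s) (Kd v)" for s
    by (simp_all add: pdF pi_mult amat_add push dvec_works[OF D]) (simp add: dvec_def)
  have k: "pd 1 F (vector [0, 0, s]) = Nd (rot s v)" "pd 2 F (vector [0, 0, s]) = Ad (rot s v)"
    "pd 3 F (vector [0, 0, s]) = rot s (Kd v)" for s
    by (simp_all add: pdF pi_mult kmat_add push dvec_works[OF D]) (simp_all add: dvec_def)
  note h1 = h[of _ "vector [0, 0, 0]" 1, unfolded vector_add_axis add_0]
  note h2 = h[of _ "vector [0, 0, 0]" 2, unfolded vector_add_axis add_0]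
  note h3 = h[of _ "vector [0, 0, 0]" 3, unfolded vector_add_axis add_0]
  have nd: "(\<lambda>t. \<pi> (nmat t) (Nd v)) differentiable (at 0)" "(\<lambda>t. \<pi> (nmat t) (Ad v)) differentiable (at 0)"
    "(\<lambda>t. \<pi> (nmat t) (Kd v)) differentiable (at 0)"
    using h1[of 1] h1[of 2] h1[of 3] by (simp_all add: n)
  have ad0: "(\<lambda>t. Nd (\<pi> (amat t) v)) differentiable (at 0)" "(\<lambda>t. \<pi> (amat t) (Ad v)) differentiable (at 0)"
    "(\<lambda>t. \<pi> (amat t) (Kd v)) differentiable (at 0)"
    using h2[of 1] h2[of 2] h2[of 3] by (simp_all add: a)
  have "((\<lambda>t. exp (2 * t)) has_real_derivative 2) (at 0)" by (auto intro!: derivative_eq_intros)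
  from differentiable_real_scaleR[OF this ad0(1)]
  have ad: "(\<lambda>t. \<pi> (amat t) (Nd v)) differentiable (at 0)" by (simp add: amat_dvec[OF D])
  have kd: "(\<lambda>t. Nd (rot t v)) differentiable (at 0)" "(\<lambda>t. Ad (rot t v)) differentiable (at 0)"
    "(\<lambda>t. rot t (Kd v)) differentiable (at 0)"
    using h3[of 1] h3[of 2] h3[of 3] by (simp_all add: k)
  have kS: "(\<lambda>t. Sd (rot t v)) differentiable (at 0)"
    unfolding Sd_eq[OF D1_pi[OF D kmat_SL2]] using kd
    by (simp add: rot_dvec(3)[OF D, symmetric])
  have c: "((\<lambda>t. cos (2 * t)) has_real_derivative 0) (at 0)" "((\<lambda>t. sin (2 * t)) has_real_derivative 2) (at 0)"
    by (auto intro!: derivative_eq_intros)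
  have kA: "(\<lambda>t. rot t (Ad v)) differentiable (at 0)"
    unfolding rot_dvec(1)[OF D]
    by (intro differentiable_diff differentiable_real_scaleR[OF c(1) kd(2)] differentiable_real_scaleR[OF c(2) kS])
  have kS': "(\<lambda>t. rot t (Sd v)) differentiable (at 0)"
    unfolding rot_dvec(2)[OF D]
    by (intro differentiable_add differentiable_real_scaleR[OF c(2) kd(2)] differentiable_real_scaleR[OF c(1) kS])
  have "rot t (Nd v) = (1/2) *\<^sub>R (rot t (Sd v) + rot t (Kd v))" for t
    unfolding Sd_eq[OF D] by (simp add: pi_diff pi_scale)
  then have kN: "(\<lambda>t. rot t (Nd v)) differentiable (at 0)" using kS' kd(3) by simp
  show ?thesis unfolding D2_def D1_def using D[unfolded D1_def] nd ad0(2,3) ad kd(3) kA kN by simp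
qed

lemma D2_Sd: "D2 v \<Longrightarrow> D1 (Sd v)"
  by (simp add: D2_def Sd_eq D1_diff(1) D1_scale(1))

lemma Casimir_eq:
  assumes "D2 v"
  shows "Casimir J \<pi> v = (1/4) *\<^sub>R (Kd (Kd v) - Ad (Ad v) - Sd (Sd v))"
proof -
  have D: "D1 v" "D1 (Ad v)" "D1 (Kd v)" "D1 (Sd v)" using assms D2_Sd by (auto simp: D2_def)
  have H: "lie J \<pi> H_el u = - (1/2) *\<^sub>R J (Kd u)" for u
    by (simp add: lie_def H_el_def cscale_def Re_divide Im_divide)
  have E: "lie J \<pi> E_el u = (1/2) *\<^sub>R Ad u + (1/2) *\<^sub>R J (Sd u)"
    "lie J \<pi> Ebar_el u = (1/2) *\<^sub>R Ad u - (1/2) *\<^sub>R J (Sd u)" for u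
    by (simp_all add: lie_def E_el_def Ebar_el_def cscale_def)
  have minus: "D1 (- u)" "Kd (- u) = - Kd u" if "D1 u" for u
    using D1_scale[OF that, of "-1"] by simp_all
  note lin = D minus D1_scale D1_J dvec_add dvec_diff D1_add(1) D1_diff(1) Sd_linear J_add J_diff J_scale J_minus
  show ?thesis unfolding Casimir_def H E
    by (simp add: lin algebra_simps flip: scaleR_add_left)
qed

section \<open>Symmetry and invariance of the Casimir operator\<close>

lemma skew_derivative:
  assumes "\<And>t x y. inner (\<pi> (\<gamma> t) x) y = inner x (\<pi> (\<gamma> (- t)) y)"
    and v: "((\<lambda>t. \<pi> (\<gamma> t) v) has_vector_derivative v') (at 0)"
    and w: "((\<lambda>t. \<pi> (\<gamma> t) w) has_vector_derivative w') (at 0)"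
  shows "inner v' w = - inner v w'"
proof -
  have 1: "((\<lambda>t. inner (\<pi> (\<gamma> t) v) w) has_real_derivative inner v' w) (at 0)"
    using bounded_linear.has_vector_derivative[OF bounded_linear_inner_left v, of w]
    by (simp add: has_real_derivative_iff_has_vector_derivative)
  have "((\<lambda>t. inner v (\<pi> (\<gamma> t) w)) has_real_derivative inner v w') (at 0)"
    using bounded_linear.has_vector_derivative[OF bounded_linear_inner_right w, of v]
    by (simp add: has_real_derivative_iff_has_vector_derivative)
  then have "((\<lambda>t. inner v (\<pi> (\<gamma> (- t)) w)) has_real_derivative - inner v w') (at 0)"
    using DERIV_mirror[of "\<lambda>t. inner v (\<pi> (\<gamma> t) w)" "inner v w'" 0] by simp
  then show ?thesis using 1 DERIV_unique by (auto simp: assms(1))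
qed

lemma skew:
  assumes v: "D1 v" and w: "D1 w"
  shows "inner (Ad v) w = - inner v (Ad w)" "inner (Kd v) w = - inner v (Kd w)" "inner (Sd v) w = - inner v (Sd w)"
proof -
  have a: "adj2 (amat t) = amat (- t)" "adj2 (kmat t) = kmat (- t)" "adj2 (smat t) = smat (- t)" for t
    by (simp_all add: amat_def kmat_def smat_def)
  show "inner (Ad v) w = - inner v (Ad w)"
    by (rule skew_derivative[OF _ dvec_works(2)[OF v] dvec_works(2)[OF w]]) (simp add: inner_pi_left a)
  show "inner (Kd v) w = - inner v (Kd w)"
    by (rule skew_derivative[OF _ dvec_works(3)[OF v] dvec_works(3)[OF w]]) (simp add: inner_pi_left a)
  show "inner (Sd v) w = - inner v (Sd w)"
    by (rule skew_derivative[OF _ Sd_derivative(1)[OF v] Sd_derivative(1)[OF w]]) (simp add: inner_pi_left a)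
qed

lemma Casimir_sym:
  assumes "D2 v" "D2 w"
  shows "inner (Casimir J \<pi> v) w = inner v (Casimir J \<pi> w)"
proof -
  have "D1 v" "D1 w" "D1 (Ad v)" "D1 (Kd v)" "D1 (Sd v)" "D1 (Ad w)" "D1 (Kd w)" "D1 (Sd w)"
    using assms D2_Sd by (auto simp: D2_def)
  then show ?thesis by (simp add: Casimir_eq assms inner_diff skew)
qed

text \<open>Conjugation by g acts on coordinates in the basis A, S, K as an isometry of the
  quadratic form k^2 - p^2 - s^2. Mixed second derivatives enter only as symmetrised sums, so their
  coefficients cancel without any commutator relation.\<close>

lemma Casimir_pi:
  assumes v: "D2 v" and g: "g \<in> SL2"
  shows "D2 (\<pi> g v)" "Casimir J \<pi> (\<pi> g v) = \<pi> g (Casimir J \<pi> v)"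
proof -
  have D: "D1 v" "D1 (Nd v)" "D1 (Ad v)" "D1 (Kd v)" "D1 (Sd v)" using v D2_Sd by (auto simp: D2_def)
  have DL: "D1 (Ld M v)" for M using D by (simp add: Ld_def D1_add(1) D1_diff(1) D1_scale(1))
  show D2g: "D2 (\<pi> g v)" using DL D g by (simp add: D2_def dvec_pi D1_pi)
  obtain a b c d where g2: "g = mat2 a b c d" and det: "a * d - b * c = 1" using g SL2_cases by blast
  define LL where "LL p s k u = p *\<^sub>R Ad u + s *\<^sub>R Sd u + k *\<^sub>R Kd u" for p s k u
  have DLL: "D1 (LL p s k v)" for p s k using D by (simp add: LL_def D1_add(1) D1_scale(1))
  define sS kS sK kK where "sS = (d*d - b*b + a*a - c*c)/2" and "kS = (d*d - b*b - a*a + c*c)/2"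
    and "sK = (d*d + b*b - a*a - c*c)/2" and "kK = (d*d + b*b + a*a + c*c)/2"
  note halves = sS_def kS_def sK_def kK_def
  have cong3: "\<pi> h (x1 *\<^sub>R P + x2 *\<^sub>R Q + x3 *\<^sub>R R) = \<pi> h (y1 *\<^sub>R P + y2 *\<^sub>R Q + y3 *\<^sub>R R)"
    if "x1 = y1" "x2 = y2" "x3 = y3" for x1 x2 x3 y1 y2 y3 :: real and P Q R :: 'h and h
    using that by simp
  have A: "Ad (\<pi> g u) = \<pi> g (LL (a*d + b*c) (b*d - a*c) (b*d + a*c) u)"
    and S: "Sd (\<pi> g u) = \<pi> g (LL (c*d - a*b) sS kS u)"
    and K: "Kd (\<pi> g u) = \<pi> g (LL (c*d + a*b) sK kK u)"
    if "D1 u" for u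
    unfolding dvec_pi[OF that g] unfolding g2 adj2_mat2 mat2_mult Ld_ASK[OF that] LL_def halves
    by (rule cong3; simp add: field_simps)+
  have LLLL: "LL p s k (LL p s k v) =
      (p * p) *\<^sub>R Ad (Ad v) + (p * s) *\<^sub>R (Ad (Sd v) + Sd (Ad v)) + (p * k) *\<^sub>R (Ad (Kd v) + Kd (Ad v)) +
      (s * s) *\<^sub>R Sd (Sd v) + (s * k) *\<^sub>R (Sd (Kd v) + Kd (Sd v)) + (k * k) *\<^sub>R Kd (Kd v)" for p s k
  proof -
    have lin: "f (p *\<^sub>R Ad v + s *\<^sub>R Sd v + k *\<^sub>R Kd v) = p *\<^sub>R f (Ad v) + s *\<^sub>R f (Sd v) + k *\<^sub>R f (Kd v)"
      if "\<And>x y. D1 x \<Longrightarrow> D1 y \<Longrightarrow> f (x + y) = f x + f y" "\<And>c x. D1 x \<Longrightarrow> f (c *\<^sub>R x) = c *\<^sub>R f x" for f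
      using D by (simp add: that D1_add(1) D1_scale(1))
    show ?thesis unfolding LL_def
      by (simp only: lin[of Ad, OF dvec_add(2) D1_scale(3)] lin[of Sd, OF Sd_linear(1,3)] lin[of Kd, OF dvec_add(3) D1_scale(4)])
         (simp add: algebra_simps)
  qed
  have comb: "x1 *\<^sub>R P + x2 *\<^sub>R Q + x3 *\<^sub>R R + x4 *\<^sub>R S + x5 *\<^sub>R T + x6 *\<^sub>R U
      - (y1 *\<^sub>R P + y2 *\<^sub>R Q + y3 *\<^sub>R R + y4 *\<^sub>R S + y5 *\<^sub>R T + y6 *\<^sub>R U)
      - (z1 *\<^sub>R P + z2 *\<^sub>R Q + z3 *\<^sub>R R + z4 *\<^sub>R S + z5 *\<^sub>R T + z6 *\<^sub>R U) = U - P - S"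
    if "x1 - y1 - z1 = -1" "x2 - y2 - z2 = 0" "x3 - y3 - z3 = 0" "x4 - y4 - z4 = -1" "x5 - y5 - z5 = 0" "x6 - y6 - z6 = 1"
    for x1 x2 x3 x4 x5 x6 y1 y2 y3 y4 y5 y6 z1 z2 z3 z4 z5 z6 :: real and P Q R S T U :: 'h
  proof -
    have eqs: "x1 = y1 + z1 - 1" "x2 = y2 + z2" "x3 = y3 + z3" "x4 = y4 + z4 - 1" "x5 = y5 + z5" "x6 = y6 + z6 + 1"
      using that by linarith+
    show ?thesis unfolding eqs by (simp add: algebra_simps)
  qed
  have h: "2 * sS = d*d - b*b + a*a - c*c" "2 * kS = d*d - b*b - a*a + c*c"
    "2 * sK = d*d + b*b - a*a - c*c" "2 * kK = d*d + b*b + a*a + c*c" by (simp_all add: halves)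
  have "Kd (Kd (\<pi> g v)) - Ad (Ad (\<pi> g v)) - Sd (Sd (\<pi> g v)) = \<pi> g (Kd (Kd v) - Ad (Ad v) - Sd (Sd v))"
    unfolding A[OF D(1)] S[OF D(1)] K[OF D(1)] A[OF DLL] S[OF DLL] K[OF DLL] pi_diff[OF g, symmetric] LLLL
    by (rule arg_cong[where f = "\<pi> g"], rule comb) (use det h in algebra)+
  then show "Casimir J \<pi> (\<pi> g v) = \<pi> g (Casimir J \<pi> v)"
    by (simp add: Casimir_eq D2g v pi_scale g)
qed

lemma D2_add: "D2 u \<Longrightarrow> D2 v \<Longrightarrow> D2 (u + v)" and D2_scale: "D2 u \<Longrightarrow> D2 (c *\<^sub>R u)"
  by (simp_all add: D2_def D1_add(1) dvec_add D1_scale)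

lemma D2_J: "D2 u \<Longrightarrow> D2 (J u)"
  by (simp add: D2_def D1_J)

lemma Casimir_add: "D2 u \<Longrightarrow> D2 v \<Longrightarrow> Casimir J \<pi> (u + v) = Casimir J \<pi> u + Casimir J \<pi> v"
  by (simp add: Casimir_eq D2_add) (simp add: D2_def dvec_add Sd_linear D2_Sd[unfolded D2_def] algebra_simps)

lemma Casimir_scale: "D2 u \<Longrightarrow> Casimir J \<pi> (c *\<^sub>R u) = c *\<^sub>R Casimir J \<pi> u"
  by (simp add: Casimir_eq D2_scale) (simp add: D2_def D1_scale Sd_linear D2_Sd[unfolded D2_def] algebra_simps)

lemma Casimir_J: "D2 u \<Longrightarrow> Casimir J \<pi> (J u) = J (Casimir J \<pi> u)"
  by (simp add: Casimir_eq D2_J J_scale J_diff) (simp add: D2_def D1_J Sd_linear D2_Sd[unfolded D2_def])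

lemma dvec_in:
  assumes V: "inv_subspace J \<pi> V" and v: "v \<in> V" "D1 v"
  shows "Nd v \<in> V" "Ad v \<in> V" "Kd v \<in> V"
proof -
  have cl: "closed V" "subspace V" using V by (auto simp: inv_subspace_def)
  have "x \<in> V" if "((\<lambda>t. \<pi> (\<gamma> t) v) has_vector_derivative x) (at 0)" "\<And>t. \<gamma> t \<in> SL2" for x \<gamma>
  proof (rule Lim_in_closed_set[OF cl(1)])
    show "((\<lambda>t. (\<pi> (\<gamma> t) v - \<pi> (\<gamma> 0) v) /\<^sub>R t) \<longlongrightarrow> x) (at 0)"
      using that(1) by (simp add: has_vector_derivative_at_0_iff)
    show "\<forall>\<^sub>F t in at 0. (\<pi> (\<gamma> t) v - \<pi> (\<gamma> 0) v) /\<^sub>R t \<in> V"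
      using inv_subspace_pi[OF V that(2) v(1)] cl(2) by (simp add: subspace_scale subspace_diff)
  qed simp
  note this[OF dvec_works(1)[OF v(2)]] this[OF dvec_works(2)[OF v(2)]] this[OF dvec_works(3)[OF v(2)]]
  then show "Nd v \<in> V" "Ad v \<in> V" "Kd v \<in> V" by simp_all
qed

lemma Casimir_in:
  assumes V: "inv_subspace J \<pi> V" and v: "v \<in> V" "D2 v" shows "Casimir J \<pi> v \<in> V"
proof -
  have sub: "subspace V" using V by (auto simp: inv_subspace_def)
  have D: "D1 v" "D1 (Nd v)" "D1 (Ad v)" "D1 (Kd v)" "D1 (Sd v)" using v D2_Sd by (auto simp: D2_def)
  have S: "Sd u \<in> V" if "u \<in> V" "D1 u" for u
    using dvec_in[OF V that] sub by (simp add: Sd_eq that subspace_diff subspace_scale)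
  show ?thesis unfolding Casimir_eq[OF v(2)]
    using dvec_in[OF V] S v(1) D sub by (intro subspace_scale subspace_diff) auto
qed

end

section \<open>Multiplicative representations\<close>

locale mult_rep =
  fixes J :: "'h::{real_inner,complete_space} \<Rightarrow> 'h"
    and \<pi> :: "real^2^2 \<Rightarrow> 'h \<Rightarrow> 'h" and \<V> :: "'h set set"
    and m :: "'h \<Rightarrow> 'h \<Rightarrow> 'h" and one :: 'h and cj :: "'h \<Rightarrow> 'h"
  assumes mult_rep: "multiplicative_rep J \<pi> \<V> m one cj"

sublocale mult_rep \<subseteq> sl2_rep
  using mult_rep by unfold_locales (simp_all add: multiplicative_rep_def)

context mult_rep
begin

abbreviation Hf :: "'h set" where "Hf \<equiv> Hfin J \<pi> \<V>"
abbreviation Cas :: "'h \<Rightarrow> 'h" where "Cas \<equiv> Casimir J \<pi>"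

lemma m_smooth: "a \<in> Hf \<Longrightarrow> b \<in> Hf \<Longrightarrow> smoothvec \<pi> (m a b)"
  and m_add_left: "a \<in> Hf \<Longrightarrow> b \<in> Hf \<Longrightarrow> c \<in> Hf \<Longrightarrow> m (a + b) c = m a c + m b c"
  and m_cscale: "a \<in> Hf \<Longrightarrow> b \<in> Hf \<Longrightarrow> m (cscale J z a) b = cscale J z (m a b)"
  and m_commute: "a \<in> Hf \<Longrightarrow> b \<in> Hf \<Longrightarrow> m a b = m b a"
  and one_Hf: "one \<in> Hf"
  and cj_Hf: "a \<in> Hf \<Longrightarrow> cj a \<in> Hf"
  and cj_cinner: "a \<in> Hf \<Longrightarrow> b \<in> Hf \<Longrightarrow> c \<in> Hf \<Longrightarrow> cinner J (m a b) c = cinner J b (m (cj a) c)"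
  and m_perm: "\<sigma> permutes {..<4::nat} \<Longrightarrow> (\<forall>i<4. f i \<in> Hf) \<Longrightarrow>
        cinner J (m (f (\<sigma> 0)) (f (\<sigma> 1))) (m (cj (f (\<sigma> 2))) (cj (f (\<sigma> 3))))
        = cinner J (m (f 0) (f 1)) (m (cj (f 2)) (cj (f 3)))"
  and decomp: "discrete_decomp J \<pi> \<V>"
  using mult_rep by (simp_all add: multiplicative_rep_def)

lemma m_one: assumes "a \<in> Hf" shows "m one a = a"
proof -
  have "\<forall>a\<in>Hf. m one a = a" using mult_rep unfolding multiplicative_rep_def by (elim conjE)
  then show ?thesis using assms by (rule bspec)
qed

lemma m_lie:
  assumes "a \<in> Hf" "b \<in> Hf"
  shows "lie J \<pi> X (m a b) = m (lie J \<pi> X a) b + m a (lie J \<pi> X b)"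
proof -
  have "\<forall>X. \<forall>a\<in>Hf. \<forall>b\<in>Hf. lie J \<pi> X (m a b) = m (lie J \<pi> X a) b + m a (lie J \<pi> X b)"
    using mult_rep unfolding multiplicative_rep_def by (elim conjE)
  then show ?thesis using assms by (elim allE[of _ X]) (drule (1) bspec)+
qed

lemma \<V>_irreducible: "V \<in> \<V> \<Longrightarrow> irreducible_sub J \<pi> V"
  and \<V>_orthogonal: "V \<in> \<V> \<Longrightarrow> W \<in> \<V> \<Longrightarrow> V \<noteq> W \<Longrightarrow> v \<in> V \<Longrightarrow> w \<in> W \<Longrightarrow> inner v w = 0"
  and \<V>_dense: "closure (span (\<Union>\<V>)) = UNIV"
  and \<V>_finite: "finite {V\<in>\<V>. \<exists>c. cmod c \<le> B \<and> (\<forall>v\<in>V. smoothvec \<pi> v \<longrightarrow> Cas v = cscale J c v)}"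
  using decomp by (simp_all add: discrete_decomp_def)

lemma \<V>_inv: "V \<in> \<V> \<Longrightarrow> inv_subspace J \<pi> V"
  using \<V>_irreducible by (simp add: irreducible_sub_def)

lemma Hf_subspace: "subspace Hf"
  by (simp add: Hfin_def)

lemma Hf_add: "a \<in> Hf \<Longrightarrow> b \<in> Hf \<Longrightarrow> a + b \<in> Hf" and Hf_diff: "a \<in> Hf \<Longrightarrow> b \<in> Hf \<Longrightarrow> a - b \<in> Hf"
  and Hf_scale: "a \<in> Hf \<Longrightarrow> c *\<^sub>R a \<in> Hf" and Hf_0: "0 \<in> Hf"
  using Hf_subspace by (simp_all add: subspace_add subspace_diff subspace_scale subspace_0)

lemma Hf_minus: "a \<in> Hf \<Longrightarrow> - a \<in> Hf"
  using Hf_scale[of a "-1"] by simp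

lemma Hf_smooth: "a \<in> Hf \<Longrightarrow> smoothvec \<pi> a"
  using m_smooth[OF one_Hf] by (simp add: m_one)

lemma Hf_D2: "a \<in> Hf \<Longrightarrow> D2 a" and Hf_D1: "a \<in> Hf \<Longrightarrow> D1 a"
  using Hf_smooth smooth_D2 smooth_D1 by simp_all

lemma m_D1: "a \<in> Hf \<Longrightarrow> b \<in> Hf \<Longrightarrow> D1 (m a b)"
  using m_smooth smooth_D1 by simp

section \<open>Stability of the algebraic sum of K-finite vectors\<close>

lemma K_finite_J: assumes "K_finite J \<pi> v" shows "K_finite J \<pi> (J v)"
proof -
  obtain B where B: "finite B" "\<And>t. rot t v \<in> span (B \<union> J ` B)" using assms by (auto simp: K_finite_def)
  have "J ` (B \<union> J ` B) \<subseteq> span (B \<union> J ` B)"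
  proof
    fix y assume "y \<in> J ` (B \<union> J ` B)"
    then consider b where "b \<in> B" "y = J b" | b where "b \<in> B" "y = - b" by auto
    then show "y \<in> span (B \<union> J ` B)"
      by cases (auto intro: span_base span_neg)
  qed
  then have "J ` span (B \<union> J ` B) \<subseteq> span (B \<union> J ` B)"
    using linear_span_image[OF linear_J, of "B \<union> J ` B"] span_minimal[OF _ subspace_span] by metis
  then have "rot t (J v) \<in> span (B \<union> J ` B)" for t using B(2)[of t] by (auto simp: pi_J)
  then show ?thesis using B(1) by (auto simp: K_finite_def)
qed

lemma Hf_J: assumes "a \<in> Hf" shows "J a \<in> Hf"
proof -
  let ?S = "\<Union>V\<in>\<V>. {v\<in>V. K_finite J \<pi> v}"
  have "J ` ?S \<subseteq> ?S" using \<V>_inv K_finite_J by (fastforce simp: inv_subspace_def)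
  from span_mono[OF this] have "J ` span ?S \<subseteq> span ?S" by (simp only: linear_span_image[OF linear_J])
  then show ?thesis using assms by (auto simp: Hfin_def)
qed

lemma VK_Hf: assumes "V \<in> \<V>" "v \<in> VK V" shows "v \<in> Hf"
proof -
  have "K_finite J \<pi> v" unfolding K_finite_def
    using assms(2) by (intro exI[of _ "{v}"]) (auto simp: VK_def K_invariant_def intro: span_base)
  then show ?thesis unfolding Hfin_def using assms by (intro span_base) (auto simp: VK_def)
qed

text \<open>Conjugation by k(t) turns a rotated derivative of \<open>a\<close> into a combination of
  derivatives of \<open>rot t a\<close>, and these lie in the span of the derivatives of a finite
  basis of the rotation orbit.\<close>

lemma K_finite_dvec:
  assumes "K_finite J \<pi> a" "D1 a"
  shows "K_finite J \<pi> (Nd a)" "K_finite J \<pi> (Ad a)" "K_finite J \<pi> (Kd a)"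
proof -
  obtain B where B: "finite B" "\<And>t. rot t a \<in> span (B \<union> J ` B)" using assms by (auto simp: K_finite_def)
  \<comment> \<open>The basis is taken from the orbit itself, since the spanning set
    \<open>B\<close> need not consist of differentiable vectors.\<close>
  obtain O' where O': "O' \<subseteq> range (\<lambda>t. rot t a)" "independent O'" "range (\<lambda>t. rot t a) \<subseteq> span O'"
    using maximal_independent_subset[of "range (\<lambda>t. rot t a)"] by blast
  have "O' \<subseteq> span (B \<union> J ` B)" using O'(1) B(2) by blast
  then have fin: "finite O'" using independent_span_bound[of "B \<union> J ` B" O'] B(1) O'(2) by simp
  define C where "C = Nd ` O' \<union> Ad ` O' \<union> Kd ` O'"
  let ?P = "{u. D1 u \<and> Nd u \<in> span C \<and> Ad u \<in> span C \<and> Kd u \<in> span C}"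
  have D1_0: "D1 0" using D1_scale(1)[OF assms(2), of 0] by simp
  have z: "Nd 0 = 0" "Ad 0 = 0" "Kd 0 = 0" using D1_scale(2-4)[OF assms(2), of 0] by simp_all
  have "subspace ?P"
    using D1_0 by (auto simp: subspace_def z D1_add(1) D1_scale dvec_add span_0 intro: span_add span_scale)
  moreover have "O' \<subseteq> ?P"
    using O'(1) D1_pi[OF assms(2)] by (auto simp: C_def intro!: span_base)
  ultimately have "span O' \<subseteq> ?P" using span_minimal by blast
  then have P: "rot t a \<in> ?P" for t using O'(3) by blast
  have L: "Ld M (rot t a) \<in> span C" for M t
    using P[of t] unfolding Ld_def by (auto intro!: span_add span_diff span_scale)
  have "finite C" using fin by (simp add: C_def)
  moreover have "span C \<subseteq> span (C \<union> J ` C)" by (rule span_mono) simp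
  ultimately have "K_finite J \<pi> x" if "\<And>t. rot t x \<in> span C" for x
    unfolding K_finite_def using that by blast
  then show "K_finite J \<pi> (Nd a)" "K_finite J \<pi> (Ad a)" "K_finite J \<pi> (Kd a)"
    using L by (simp_all add: pi_dvec[OF assms(2)])
qed

lemma Hf_dvec0: "a \<in> Hf \<Longrightarrow> Nd a \<in> Hf \<and> Ad a \<in> Hf \<and> Kd a \<in> Hf"
proof -
  let ?S = "\<Union>V\<in>\<V>. {v\<in>V. K_finite J \<pi> v}"
  let ?P = "{a \<in> Hf. Nd a \<in> Hf \<and> Ad a \<in> Hf \<and> Kd a \<in> Hf}"
  have z: "Nd 0 = 0" "Ad 0 = 0" "Kd 0 = 0" using D1_scale(2-4)[OF Hf_D1[OF Hf_0], of 0] by simp_all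
  have "subspace ?P"
    by (auto simp: subspace_def z Hf_0 Hf_add Hf_scale dvec_add Hf_D1 D1_scale)
  moreover have "?S \<subseteq> ?P"
  proof
    fix v assume "v \<in> ?S"
    then obtain V where V: "V \<in> \<V>" "v \<in> V" "K_finite J \<pi> v" by blast
    have base: "u \<in> Hf" if "u \<in> V" "K_finite J \<pi> u" for u
      unfolding Hfin_def using that V(1) by (intro span_base) blast
    have v: "v \<in> Hf" using base V by blast
    show "v \<in> ?P" using v dvec_in[OF \<V>_inv[OF V(1)] V(2) Hf_D1[OF v]] K_finite_dvec[OF V(3) Hf_D1[OF v]] base
      by blast
  qed
  ultimately have "span ?S \<subseteq> ?P" using span_minimal by blast
  moreover assume "a \<in> Hf"
  ultimately show ?thesis by (auto simp: Hfin_def)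
qed

lemma Hf_Nd: "a \<in> Hf \<Longrightarrow> Nd a \<in> Hf" and Hf_Ad: "a \<in> Hf \<Longrightarrow> Ad a \<in> Hf" and Hf_Kd: "a \<in> Hf \<Longrightarrow> Kd a \<in> Hf"
  using Hf_dvec0 by simp_all

lemma Hf_Sd: "a \<in> Hf \<Longrightarrow> Sd a \<in> Hf"
  by (simp add: Sd_eq Hf_D1 Hf_Nd Hf_Kd Hf_diff Hf_scale)

lemmas Hf_closed = Hf_add Hf_diff Hf_minus Hf_scale Hf_0 Hf_J Hf_Ad Hf_Kd Hf_Sd

lemma Hf_Cas: "a \<in> Hf \<Longrightarrow> Cas a \<in> Hf"
  by (simp add: Casimir_eq Hf_D2 Hf_closed)

lemma dvec_linear:
  assumes "a \<in> Hf" "b \<in> Hf"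
  shows "Ad (a + b) = Ad a + Ad b" "Kd (a + b) = Kd a + Kd b" "Sd (a + b) = Sd a + Sd b"
    "Ad (a - b) = Ad a - Ad b" "Kd (a - b) = Kd a - Kd b" "Sd (a - b) = Sd a - Sd b"
    "Ad (c *\<^sub>R a) = c *\<^sub>R Ad a" "Kd (c *\<^sub>R a) = c *\<^sub>R Kd a" "Sd (c *\<^sub>R a) = c *\<^sub>R Sd a"
    "Ad (J a) = J (Ad a)" "Kd (J a) = J (Kd a)" "Sd (J a) = J (Sd a)"
  using assms[THEN Hf_D1] by (simp_all add: dvec_add dvec_diff D1_scale D1_J Sd_linear)

text \<open>The orbit map of \<open>Y v\<close> is differentiated weakly, against a vector to which \<open>Y\<close> and \<open>Z\<close> can be moved: this avoids
interchanging the unbounded operator \<open>Y\<close> with the limit.\<close>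

lemma commutator_aux:
  assumes v: "v \<in> Hf" and Yv: "Y v \<in> Hf" and Zv: "Z v \<in> Hf" and Xv: "X v \<in> Hf" and XYv: "X (Y v) \<in> Hf" and YXv: "Y (X v) \<in> Hf"
    and X: "\<And>u. D1 u \<Longrightarrow> ((\<lambda>t. \<pi> (\<gamma> t) u) has_vector_derivative X u) (at 0)"
    and \<gamma>: "\<And>t. \<gamma> t \<in> SL2" "\<gamma> 0 = mat 1"
    and Y: "\<And>u w. D1 u \<Longrightarrow> D1 w \<Longrightarrow> inner (Y u) w = - inner u (Y w)"
    and Z: "\<And>u w. D1 u \<Longrightarrow> D1 w \<Longrightarrow> inner (Z u) w = - inner u (Z w)"
    and conj: "\<And>t. \<pi> (\<gamma> t) (Y v) = f t *\<^sub>R Y (\<pi> (\<gamma> t) v) + g t *\<^sub>R Z (\<pi> (\<gamma> t) v)"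
    and f: "(f has_real_derivative 0) (at 0)" "f 0 = 1" and g: "(g has_real_derivative c) (at 0)" "g 0 = 0"
  shows "X (Y v) = Y (X v) + c *\<^sub>R Z v"
proof -
  have D: "D1 (\<pi> (\<gamma> t) v)" for t by (rule D1_pi[OF Hf_D1[OF v] \<gamma>(1)])
  have "inner (X (Y v)) w = inner (Y (X v)) w + c * inner (Z v) w" if w: "w \<in> Hf" for w
  proof -
    have 1: "((\<lambda>t. inner (\<pi> (\<gamma> t) (Y v)) w) has_real_derivative inner (X (Y v)) w) (at 0)"
      using bounded_linear.has_vector_derivative[OF bounded_linear_inner_left X[OF Hf_D1[OF Yv]], of w]
      by (simp add: has_real_derivative_iff_has_vector_derivative)
    have 2: "inner (\<pi> (\<gamma> t) (Y v)) w = - (f t * inner (\<pi> (\<gamma> t) v) (Y w)) - g t * inner (\<pi> (\<gamma> t) v) (Z w)" for t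
      by (simp add: conj inner_add_left Y[OF D Hf_D1[OF w]] Z[OF D Hf_D1[OF w]])
    have d: "((\<lambda>t. inner (\<pi> (\<gamma> t) v) u) has_real_derivative inner (X v) u) (at 0)" for u
      using bounded_linear.has_vector_derivative[OF bounded_linear_inner_left X[OF Hf_D1[OF v]], of u]
      by (simp add: has_real_derivative_iff_has_vector_derivative)
    have "((\<lambda>t. - (f t * inner (\<pi> (\<gamma> t) v) (Y w)) - g t * inner (\<pi> (\<gamma> t) v) (Z w)) has_real_derivative
        - inner (X v) (Y w) - c * inner v (Z w)) (at 0)"
      by (auto intro!: derivative_eq_intros d f(1) g(1) simp: f g \<gamma>)
    then have "inner (X (Y v)) w = - inner (X v) (Y w) - c * inner v (Z w)"
      using DERIV_unique[OF 1] by (simp add: 2)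
    then show ?thesis using Y[OF Hf_D1[OF Xv] Hf_D1[OF w]] Z[OF Hf_D1[OF v] Hf_D1[OF w]] by simp
  qed
  then have "inner (X (Y v) - (Y (X v) + c *\<^sub>R Z v)) w = 0" if "w \<in> Hf" for w
    using that by (simp add: inner_diff_left inner_add_left)
  from this[of "X (Y v) - (Y (X v) + c *\<^sub>R Z v)"] show ?thesis
    using XYv YXv Zv by (simp add: Hf_closed)
qed

lemma commutators:
  assumes v: "v \<in> Hf"
  shows "Kd (Ad v) = Ad (Kd v) - 2 *\<^sub>R Sd v" "Kd (Sd v) = Sd (Kd v) + 2 *\<^sub>R Ad v" "Ad (Sd v) = Sd (Ad v) + 2 *\<^sub>R Kd v"
proof -
  have trig: "((\<lambda>t. cos (2 * t)) has_real_derivative 0) (at 0)" "((\<lambda>t. sin (2 * t)) has_real_derivative 2) (at 0)"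
    "((\<lambda>t. - sin (2 * t)) has_real_derivative - 2) (at 0)"
    "((\<lambda>t::real. cosh (2 * t)) has_real_derivative 0) (at 0)" "((\<lambda>t::real. sinh (2 * t)) has_real_derivative 2) (at 0)"
    by (auto intro!: derivative_eq_intros)
  have "Kd (Ad v) = Ad (Kd v) + (-2) *\<^sub>R Sd v"
    by (rule commutator_aux[OF v _ _ _ _ _ dvec_works(3) _ _ skew(1) skew(3) _ trig(1) _ trig(3)])
       (simp_all add: v Hf_closed rot_dvec Hf_D1)
  then show "Kd (Ad v) = Ad (Kd v) - 2 *\<^sub>R Sd v" by simp
  show "Kd (Sd v) = Sd (Kd v) + 2 *\<^sub>R Ad v"
    by (rule commutator_aux[OF v _ _ _ _ _ dvec_works(3) _ _ skew(3) skew(1) _ trig(1) _ trig(2)])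
       (simp_all add: v Hf_closed rot_dvec Hf_D1)
  show "Ad (Sd v) = Sd (Ad v) + 2 *\<^sub>R Kd v"
    by (rule commutator_aux[OF v _ _ _ _ _ dvec_works(2) _ _ skew(3) skew(2) _ trig(4) _ trig(5)])
       (simp_all add: v Hf_closed amat_dvec Hf_D1)
qed

subsection \<open>The product\<close>

lemma m_scale_left: "a \<in> Hf \<Longrightarrow> b \<in> Hf \<Longrightarrow> m (c *\<^sub>R a) b = c *\<^sub>R m a b"
  using m_cscale[of a b "complex_of_real c"] by (simp add: cscale_def)

lemma m_J_left: "a \<in> Hf \<Longrightarrow> b \<in> Hf \<Longrightarrow> m (J a) b = J (m a b)"
  using m_cscale[of a b \<i>] by (simp add: cscale_def)

lemma m_minus_left: "a \<in> Hf \<Longrightarrow> b \<in> Hf \<Longrightarrow> m (- a) b = - m a b"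
  using m_scale_left[of a b "-1"] by simp

lemma m_diff_left: "a \<in> Hf \<Longrightarrow> b \<in> Hf \<Longrightarrow> c \<in> Hf \<Longrightarrow> m (a - b) c = m a c - m b c"
  using m_add_left[of a "- b" c] by (simp add: m_minus_left Hf_minus)

lemma m_right:
  assumes "a \<in> Hf" "b \<in> Hf"
  shows "c \<in> Hf \<Longrightarrow> m a (b + c) = m a b + m a c" "c \<in> Hf \<Longrightarrow> m a (b - c) = m a b - m a c"
    "m a (r *\<^sub>R b) = r *\<^sub>R m a b" "m a (J b) = J (m a b)" "m a (- b) = - m a b"
  using assms by (simp_all add: m_commute[of a] Hf_closed m_add_left m_diff_left m_scale_left m_J_left m_minus_left)

lemmas m_linear = m_add_left m_diff_left m_scale_left m_J_left m_minus_left m_right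

lemma m_dvec:
  assumes "a \<in> Hf" "b \<in> Hf"
  shows "Kd (m a b) = m (Kd a) b + m a (Kd b)" "Ad (m a b) = m (Ad a) b + m a (Ad b)" "Sd (m a b) = m (Sd a) b + m a (Sd b)"
  using m_lie[OF assms, of "(1,0,0)"] m_lie[OF assms, of "(0,1,0)"] m_lie[OF assms, of "(0,0,1)"]
  by (simp_all add: lie_def cscale_def)

lemma Cas_m:
  assumes a: "a \<in> Hf" and b: "b \<in> Hf"
  shows "Cas (m a b) = m (Cas a) b + m a (Cas b)
     + (1/2) *\<^sub>R (m (Kd a) (Kd b) - m (Ad a) (Ad b) - m (Sd a) (Sd b))"
proof -
  have D2m: "D2 (m a b)" using m_smooth[OF a b] smooth_D2 by simp
  have second: "X (X (m a b)) = m (X (X a)) b + 2 *\<^sub>R m (X a) (X b) + m a (X (X b))"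
    if X: "\<And>u v. u \<in> Hf \<Longrightarrow> v \<in> Hf \<Longrightarrow> X (m u v) = m (X u) v + m u (X v)" "\<And>u. u \<in> Hf \<Longrightarrow> X u \<in> Hf"
      "\<And>u v. D1 u \<Longrightarrow> D1 v \<Longrightarrow> X (u + v) = X u + X v" for X
    using a b by (simp add: X m_D1 scaleR_2)
  have K: "Kd (Kd (m a b)) = m (Kd (Kd a)) b + 2 *\<^sub>R m (Kd a) (Kd b) + m a (Kd (Kd b))"
    by (rule second) (simp_all add: m_dvec Hf_Kd dvec_add)
  have A: "Ad (Ad (m a b)) = m (Ad (Ad a)) b + 2 *\<^sub>R m (Ad a) (Ad b) + m a (Ad (Ad b))"
    by (rule second) (simp_all add: m_dvec Hf_Ad dvec_add)
  have S: "Sd (Sd (m a b)) = m (Sd (Sd a)) b + 2 *\<^sub>R m (Sd a) (Sd b) + m a (Sd (Sd b))"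
    by (rule second) (simp_all add: m_dvec Hf_Sd Sd_linear)
  show ?thesis
    unfolding Casimir_eq[OF D2m] Casimir_eq[OF Hf_D2[OF a]] Casimir_eq[OF Hf_D2[OF b]] K A S
    using a b by (simp add: m_linear Hf_closed algebra_simps)
qed

subsection \<open>Conjugation\<close>

lemma cj_inner: "a \<in> Hf \<Longrightarrow> b \<in> Hf \<Longrightarrow> c \<in> Hf \<Longrightarrow> inner (m a b) c = inner b (m (cj a) c)"
  using cj_cinner[of a b c] by (simp add: cinner_def)

text \<open>Two candidates pair equally with every element of \<open>Hf\<close>, as multiplication
  with \<open>one\<close> shows. So \<open>cj\<close>, of which only adjointness is assumed, is
  determined by it and inherits conjugate-linearity, involutivity and compatibility with
  derivations.\<close>

lemma cj_unique:
  assumes a: "a \<in> Hf" and x: "x \<in> Hf"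
    and adj: "\<And>b c. b \<in> Hf \<Longrightarrow> c \<in> Hf \<Longrightarrow> inner (m a b) c = inner b (m x c)"
  shows "cj a = x"
proof -
  have "inner b (m x one) = inner b (m (cj a) one)" if "b \<in> Hf" for b
    using adj[OF that one_Hf] cj_inner[OF a that one_Hf] by simp
  then have "inner b x = inner b (cj a)" if "b \<in> Hf" for b
    using that x cj_Hf[OF a] by (simp add: m_commute[OF _ one_Hf] m_one)
  from this[OF Hf_diff[OF cj_Hf[OF a] x]] have "inner (cj a - x) (cj a - x) = 0"
    by (simp add: inner_diff_right)
  then show ?thesis by simp
qed

lemma cj_add: "a \<in> Hf \<Longrightarrow> b \<in> Hf \<Longrightarrow> cj (a + b) = cj a + cj b"
  by (rule cj_unique) (simp_all add: Hf_closed cj_Hf m_linear inner_add cj_inner)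

lemma cj_scale: "a \<in> Hf \<Longrightarrow> cj (c *\<^sub>R a) = c *\<^sub>R cj a"
  by (rule cj_unique) (simp_all add: Hf_closed cj_Hf m_linear cj_inner)

lemma cj_J: "a \<in> Hf \<Longrightarrow> cj (J a) = - J (cj a)"
  by (rule cj_unique) (simp_all add: Hf_closed cj_Hf m_linear inner_J_left cj_inner)

lemma cj_minus: "a \<in> Hf \<Longrightarrow> cj (- a) = - cj a"
  using cj_scale[of a "-1"] by simp

lemma cj_diff: "a \<in> Hf \<Longrightarrow> b \<in> Hf \<Longrightarrow> cj (a - b) = cj a - cj b"
  using cj_add[of a "- b"] by (simp add: cj_minus Hf_minus)

lemma cj_cj: assumes a: "a \<in> Hf" shows "cj (cj a) = a"
proof (rule cj_unique)
  fix b c assume bc: "b \<in> Hf" "c \<in> Hf"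
  have "inner (m (cj a) b) c = inner (m a c) b" using cj_inner[OF a bc(2,1)] by (simp add: inner_commute)
  then show "inner (m (cj a) b) c = inner b (m a c)" by (simp add: inner_commute)
qed (simp_all add: a cj_Hf)

lemma norm_cj: assumes a: "a \<in> Hf" shows "norm (cj a) = norm a"
proof -
  note c = cj_Hf[OF a]
  have "inner (cj a) (cj a) = inner (m a (cj a)) one"
    using cj_inner[OF a c one_Hf] by (simp add: m_commute[OF _ one_Hf] m_one c)
  also have "\<dots> = inner (m (cj a) a) one" by (simp add: m_commute a c)
  also have "\<dots> = inner a a"
    using cj_inner[OF c a one_Hf] by (simp add: m_commute[OF _ one_Hf] m_one a cj_cj)
  finally show ?thesis by (simp add: norm_eq_sqrt_inner)
qed

text \<open>Multiplication by \<open>X a\<close> is the commutator of \<open>X\<close> with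
  multiplication by \<open>a\<close>. Since \<open>X\<close> is skew, its adjoint is the commutator
  of \<open>X\<close> with multiplication by \<open>cj a\<close>.\<close>

lemma cj_derivation:
  assumes a: "a \<in> Hf"
    and X: "\<And>u v. u \<in> Hf \<Longrightarrow> v \<in> Hf \<Longrightarrow> X (m u v) = m (X u) v + m u (X v)" "\<And>u. u \<in> Hf \<Longrightarrow> X u \<in> Hf"
    and sk: "\<And>u w. D1 u \<Longrightarrow> D1 w \<Longrightarrow> inner (X u) w = - inner u (X w)"
  shows "cj (X a) = X (cj a)"
proof (rule cj_unique)
  fix b c assume b: "b \<in> Hf" and c: "c \<in> Hf"
  note d = cj_Hf[OF a]
  have "inner (m (X a) b) c = inner (X (m a b)) c - inner (m a (X b)) c"
    using a b by (simp add: X inner_add_left)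
  also have "\<dots> = - inner (m a b) (X c) - inner (X b) (m (cj a) c)"
    by (simp only: sk[OF m_D1[OF a b] Hf_D1[OF c]] cj_inner[OF a X(2)[OF b] c])
  also have "\<dots> = - inner b (m (cj a) (X c)) + inner b (X (m (cj a) c))"
    using sk[OF Hf_D1[OF b] m_D1[OF d c]] cj_inner[OF a b X(2)[OF c]] by simp
  also have "\<dots> = inner b (m (X (cj a)) c)" using c d by (simp add: X inner_add_right)
  finally show "inner (m (X a) b) c = inner b (m (X (cj a)) c)" .
qed (simp_all add: a X cj_Hf)

lemma cj_dvec:
  assumes "a \<in> Hf" shows "cj (Kd a) = Kd (cj a)" "cj (Ad a) = Ad (cj a)" "cj (Sd a) = Sd (cj a)"
  using assms by (auto intro!: cj_derivation simp: m_dvec Hf_closed skew)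

lemma cj_Cas: "a \<in> Hf \<Longrightarrow> cj (Cas a) = Cas (cj a)"
  by (simp add: Casimir_eq Hf_D2 cj_Hf cj_scale cj_diff Hf_closed cj_dvec)

section \<open>Crossing symmetry and the L4 norm\<close>

lemma crossing:
  assumes "a \<in> Hf" "b \<in> Hf" "c \<in> Hf" "d \<in> Hf"
  shows "inner (m a c) (m (cj b) (cj d)) = inner (m a b) (m (cj c) (cj d))"
proof -
  define f :: "nat \<Rightarrow> 'h" where "f i = (if i = 0 then a else if i = 1 then b else if i = 2 then c else d)" for i
  have "Transposition.transpose 1 2 permutes {..<4::nat}" by (rule permutes_swap_id) auto
  from m_perm[OF this, of f] show ?thesis using assms
    by (simp add: f_def cinner_def Transposition.transpose_def)
qed

text \<open>On functions both sides are the integral of |a|^2 |b|^2. Here it is crossing with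
  \<open>cj a\<close> and \<open>cj b\<close> as the last two entries.\<close>

lemma m_inner_pos:
  assumes "a \<in> Hf" "b \<in> Hf"
  shows "inner (m a (cj a)) (m (cj b) b) = (norm (m a b))\<^sup>2"
  using crossing[of a b "cj a" "cj b"] assms
  by (simp add: cj_Hf cj_cj power2_norm_eq_inner m_commute[of "cj b"])

lemma norm_m_cj: assumes a: "a \<in> Hf" shows "norm (m a (cj a)) = norm (m a a)"
proof -
  have "(norm (m a (cj a)))\<^sup>2 = (norm (m a a))\<^sup>2"
    using m_inner_pos[OF a a] by (simp add: power2_norm_eq_inner m_commute a cj_Hf)
  then show ?thesis by simp
qed

definition n4 :: "'h \<Rightarrow> real" where "n4 a = sqrt (norm (m a a))"

lemma n4_nonneg: "n4 a \<ge> 0" and n4_sq: "(n4 a)\<^sup>2 = norm (m a a)"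
  by (simp_all add: n4_def)

text \<open>Cauchy-Schwarz for |a|^2 and |b|^2, in place of Hoelder's inequality.\<close>

lemma norm_m_le: assumes a: "a \<in> Hf" and b: "b \<in> Hf" shows "norm (m a b) \<le> n4 a * n4 b"
proof -
  have "(norm (m a b))\<^sup>2 = inner (m a (cj a)) (m (cj b) b)" by (simp add: m_inner_pos a b)
  also have "\<dots> \<le> norm (m a (cj a)) * norm (m (cj b) b)" by (rule norm_cauchy_schwarz)
  also have "\<dots> = (n4 a * n4 b)\<^sup>2"
    by (simp add: power_mult_distrib n4_sq norm_m_cj a b m_commute[of "cj b"] cj_Hf)
  finally show ?thesis by (rule power2_le_imp_le) (simp add: n4_nonneg)
qed

lemma n4_add: assumes a: "a \<in> Hf" and b: "b \<in> Hf" shows "n4 (a + b) \<le> n4 a + n4 b"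
proof -
  have "(n4 (a + b))\<^sup>2 = norm (m a a + 2 *\<^sub>R m a b + m b b)"
    using a b by (simp add: n4_sq m_linear Hf_closed scaleR_2 m_commute[of b a] algebra_simps)
  also have "\<dots> \<le> norm (m a a) + 2 * norm (m a b) + norm (m b b)"
    using norm_triangle_ineq[of "m a a + 2 *\<^sub>R m a b" "m b b"] norm_triangle_ineq[of "m a a" "2 *\<^sub>R m a b"] by simp
  also have "\<dots> \<le> (n4 a)\<^sup>2 + 2 * (n4 a * n4 b) + (n4 b)\<^sup>2"
    using norm_m_le[OF a b] by (simp add: n4_sq)
  also have "\<dots> = (n4 a + n4 b)\<^sup>2" by (simp add: power2_sum)
  finally show ?thesis by (rule power2_le_imp_le) (simp add: n4_nonneg)
qed

lemma n4_scale: "a \<in> Hf \<Longrightarrow> n4 (c *\<^sub>R a) = \<bar>c\<bar> * n4 a"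
  by (simp add: n4_def m_linear Hf_closed real_sqrt_mult abs_mult flip: mult.assoc)

lemma n4_J: "a \<in> Hf \<Longrightarrow> n4 (J a) = n4 a"
  by (simp add: n4_def m_linear Hf_closed)

lemma n4_sum: "finite S \<Longrightarrow> (\<And>i. i \<in> S \<Longrightarrow> f i \<in> Hf) \<Longrightarrow> n4 (sum f S) \<le> (\<Sum>i\<in>S. n4 (f i))"
proof (induction S rule: finite_induct)
  case empty
  then show ?case using n4_scale[OF Hf_0, of 0] by simp
next
  case (insert x S)
  have "sum f S \<in> Hf" using insert.prems by (intro subspace_sum Hf_subspace) auto
  then have "n4 (sum f (insert x S)) \<le> n4 (f x) + n4 (sum f S)"
    using insert by (simp add: n4_add)
  also have "\<dots> \<le> (\<Sum>i\<in>insert x S. n4 (f i))" using insert by simp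
  finally show ?case .
qed

end

section \<open>Orthonormal sets\<close>

definition onb :: "'a::real_inner set \<Rightarrow> bool" where
  "onb S \<longleftrightarrow> (\<forall>e\<in>S. inner e e = 1) \<and> (\<forall>e\<in>S. \<forall>f\<in>S. e \<noteq> f \<longrightarrow> inner e f = 0)"

definition proj :: "'a::real_inner set \<Rightarrow> 'a \<Rightarrow> 'a" where
  "proj S x = (\<Sum>e\<in>S. inner x e *\<^sub>R e)"

lemma onb_subset: "onb T \<Longrightarrow> S \<subseteq> T \<Longrightarrow> onb S"
  unfolding onb_def by (meson subsetD)

lemma onb_inner_sum:
  assumes "onb S" "finite S" "f \<in> S"
  shows "inner (\<Sum>e\<in>S. c e *\<^sub>R e) f = c f"
proof -
  have "inner (\<Sum>e\<in>S. c e *\<^sub>R e) f = (\<Sum>e\<in>S. if e = f then c e else 0)"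
    unfolding inner_sum_left using assms by (intro sum.cong) (auto simp: onb_def)
  then show ?thesis using assms by simp
qed

lemma onb_norm_sum:
  assumes "onb S" "finite S"
  shows "(norm (\<Sum>e\<in>S. c e *\<^sub>R e))\<^sup>2 = (\<Sum>e\<in>S. (c e)\<^sup>2)"
proof -
  have "(norm (\<Sum>e\<in>S. c e *\<^sub>R e))\<^sup>2 = (\<Sum>f\<in>S. c f * inner (\<Sum>e\<in>S. c e *\<^sub>R e) f)"
    unfolding power2_norm_eq_inner
    using inner_sum_right[of "\<Sum>e\<in>S. c e *\<^sub>R e" "\<lambda>e. c e *\<^sub>R e" S] by simp
  also have "\<dots> = (\<Sum>e\<in>S. (c e)\<^sup>2)"
    using assms by (intro sum.cong refl) (simp add: onb_inner_sum power2_eq_square)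
  finally show ?thesis .
qed

lemma proj_span: "proj S x \<in> span S"
  unfolding proj_def by (intro span_sum span_scale span_base)

lemma inner_proj_right: "inner x (proj S y) = (\<Sum>e\<in>S. inner x e * inner y e)"
  unfolding proj_def by (simp add: inner_sum_right mult.commute)

lemma proj_eq:
  assumes "onb S" "finite S" "x \<in> span S" shows "proj S x = x"
proof -
  obtain c where "x = (\<Sum>e\<in>S. c e *\<^sub>R e)" using assms span_finite[of S] by auto
  then show ?thesis using onb_inner_sum[OF assms(1,2), of _ c] by (simp add: proj_def)
qed

lemma norm_span:
  assumes "onb S" "finite S" "x \<in> span S" shows "(norm x)\<^sup>2 = (\<Sum>e\<in>S. (inner x e)\<^sup>2)"
  using onb_norm_sum[OF assms(1,2), of "inner x"] proj_eq[OF assms] by (simp add: proj_def)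

lemma proj_diff: "proj S (x - y) = proj S x - proj S y"
  by (simp add: proj_def inner_diff_left scaleR_diff_left sum_subtractf)

lemma norm_diff_proj:
  assumes "onb S" "finite S" shows "norm (x - proj S x) \<le> norm x"
proof -
  have "inner x (proj S x) = (norm (proj S x))\<^sup>2"
    using onb_norm_sum[OF assms, of "inner x"] by (simp add: inner_proj_right flip: proj_def) (simp add: power2_eq_square)
  then have "(norm (x - proj S x))\<^sup>2 = (norm x)\<^sup>2 - (norm (proj S x))\<^sup>2"
    by (simp add: power2_norm_eq_inner inner_diff inner_commute)
  then have "(norm (x - proj S x))\<^sup>2 \<le> (norm x)\<^sup>2" by simp
  then show ?thesis by (rule power2_le_imp_le) simp
qed

section \<open>Spherical eigenvectors\<close>

context sl2_rep
begin

lemma K_invariant_Kd: assumes "K_invariant \<pi> v" shows "Kd v = 0"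
proof -
  have "(\<lambda>t. rot t v) = (\<lambda>t. v)" using assms by (simp add: K_invariant_def)
  then show ?thesis unfolding dvec_def by simp
qed

lemma Kd_K_invariant: assumes v: "D1 v" and K: "Kd v = 0" shows "K_invariant \<pi> v"
proof -
  have const: "inner (rot t v) w = inner v w" for t w
  proof -
    have "((\<lambda>t. inner (rot t v) w) has_real_derivative 0) (at s)" for s
    proof -
      have "((\<lambda>t. inner (rot t v) (rot (- s) w)) has_real_derivative inner (Kd v) (rot (- s) w)) (at 0)"
        using bounded_linear.has_vector_derivative[OF bounded_linear_inner_left dvec_works(3)[OF v], of "rot (- s) w"]
        by (simp add: has_real_derivative_iff_has_vector_derivative)
      then have "((\<lambda>t. inner (rot (t + s) v) w) has_real_derivative 0) (at 0)"
        by (simp add: K inner_rot_left[of s, symmetric] add.commute[of _ s] rot_add)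
      then show ?thesis using DERIV_shift[of "\<lambda>t. inner (rot t v) w" 0 0 s] by simp
    qed
    then have "inner (rot t v) w = inner (rot 0 v) w"
      by (intro DERIV_isconst_all) simp
    then show ?thesis by simp
  qed
  have "rot t v = v" for t
  proof -
    have "inner (rot t v - v) (rot t v - v) = 0"
      using const[of t "rot t v - v"] by (simp only: inner_diff_left)
    then show ?thesis by simp
  qed
  then show ?thesis by (simp add: K_invariant_def)
qed

lemma Cas_K_invariant: "D2 v \<Longrightarrow> K_invariant \<pi> v \<Longrightarrow> K_invariant \<pi> (Casimir J \<pi> v)"
  unfolding K_invariant_def using Casimir_pi(2)[of v, OF _ kmat_SL2] by metis

end

context mult_rep
begin

interpretation PK: bounded_linear PK by (rule PK_bounded_linear)

text \<open>\<open>Cas\<close> preserves the complex line \<open>VK V\<close>; symmetry and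
  commutation with \<open>J\<close> remove the \<open>J e\<close> part, so the eigenvalue is real.
  It is nonnegative because \<open>Kd e = 0\<close> removes the only negative term and leaves the
  squared norms of \<open>Ad e\<close> and \<open>Sd e\<close>.\<close>

lemma VK_eigen:
  assumes V: "V \<in> \<V>" and e: "e \<in> VK V" "norm e = 1"
  shows "Cas e = inner (Cas e) e *\<^sub>R e" "inner (Cas e) e \<ge> 0"
proof -
  have eH: "e \<in> Hf" by (rule VK_Hf[OF V e(1)])
  have eK: "K_invariant \<pi> e" "e \<in> V" using e by (auto simp: VK_def)
  have "Cas e \<in> VK V"
    using Casimir_in[OF \<V>_inv[OF V] eK(2) Hf_D2[OF eH]] Cas_K_invariant[OF Hf_D2[OF eH] eK(1)] by (simp add: VK_def)
  from VK_line[OF \<V>_irreducible[OF V] e this]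
  have "Cas e = inner (Cas e) e *\<^sub>R e + inner (Cas e) (J e) *\<^sub>R J e" .
  moreover have "inner (Cas e) (J e) = 0"
  proof -
    have "inner (Cas e) (J e) = inner e (J (Cas e))"
      using Casimir_sym[OF Hf_D2[OF eH] D2_J[OF Hf_D2[OF eH]]] by (simp add: Casimir_J Hf_D2 eH)
    also have "\<dots> = - inner (Cas e) (J e)" by (metis inner_J_left inner_commute)
    finally show ?thesis by simp
  qed
  ultimately show "Cas e = inner (Cas e) e *\<^sub>R e" by simp
  have eq: "inner (Cas e) e = (1/4) * (inner (Ad e) (Ad e) + inner (Sd e) (Sd e))"
    using eH by (simp add: Casimir_eq Hf_D2 inner_diff_left skew Hf_D1 Hf_closed K_invariant_Kd[OF eK(1)])
  show "inner (Cas e) e \<ge> 0" unfolding eq by (intro mult_nonneg_nonneg add_nonneg_nonneg) simp_all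
qed

text \<open>The finiteness axiom counts summands by the eigenvalue on all their smooth vectors, so
  the scalar on \<open>e\<close> must be carried to all of \<open>V\<close>: the defect
  \<open>w\<close> is orthogonal to every translate of \<open>VK V\<close>, and these span a dense
  subspace.\<close>

lemma Cas_scalar:
  assumes V: "V \<in> \<V>" and e: "e \<in> VK V" "norm e = 1" and v: "v \<in> V" "smoothvec \<pi> v"
  shows "Cas v = inner (Cas e) e *\<^sub>R v"
proof -
  define l where "l = inner (Cas e) e"
  have eH: "e \<in> Hf" by (rule VK_Hf[OF V e(1)])
  have Cas_u: "Cas u = l *\<^sub>R u" if uV: "u \<in> VK V" for u
  proof -
    obtain a b where u: "u = a *\<^sub>R e + b *\<^sub>R J e" using VK_line[OF \<V>_irreducible[OF V] e uV] by blast
    have Ce: "Cas e = l *\<^sub>R e" unfolding l_def by (rule VK_eigen(1)[OF V e])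
    show ?thesis unfolding u using Hf_D2[OF eH]
      by (simp add: Casimir_add Casimir_scale Casimir_J D2_scale D2_J Ce J_scale scaleR_add_right mult.commute)
  qed
  define w where "w = Cas v - l *\<^sub>R v"
  have Dv: "D2 v" by (rule smooth_D2[OF v(2)])
  have orth: "inner w (\<pi> g u) = 0" if "g \<in> SL2" "u \<in> VK V" for g u
  proof -
    have Du: "D2 u" by (rule Hf_D2[OF VK_Hf[OF V that(2)]])
    have "inner (Cas v) (\<pi> g u) = inner v (\<pi> g (Cas u))"
      using Casimir_sym[OF Dv Casimir_pi(1)[OF Du that(1)]] Casimir_pi(2)[OF Du that(1)] by simp
    then show ?thesis using that by (simp add: w_def inner_diff_left Cas_u pi_scale)
  qed
  let ?G = "{\<pi> g u |g u. g \<in> SL2 \<and> u \<in> VK V}"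
  have "e \<noteq> 0" using e(2) by auto
  have VV: "closure (span ?G) = V"
    by (rule irreducible_generated[OF \<V>_irreducible[OF V] VK_closed_subspace(3)[OF \<V>_inv[OF V]] _ e(1) \<open>e \<noteq> 0\<close>])
       (auto simp: VK_def)
  have "?G \<subseteq> {x. inner w x = 0}" using orth by blast
  moreover have "subspace {x. inner w x = 0}" by (auto simp: subspace_def inner_add_right)
  ultimately have "span ?G \<subseteq> {x. inner w x = 0}" by (rule span_minimal)
  moreover have "closed {x. inner w x = 0}" by (intro closed_Collect_eq continuous_intros)
  ultimately have "closure (span ?G) \<subseteq> {x. inner w x = 0}" by (rule closure_minimal)
  then have "V \<subseteq> {x. inner w x = 0}" by (simp only: VV)
  moreover have "w \<in> V"
    using Casimir_in[OF \<V>_inv[OF V] v(1) Dv] v(1) \<V>_inv[OF V] by (simp add: w_def inv_subspace_def subspace_diff subspace_scale)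
  ultimately have "inner w w = 0" by blast
  then show ?thesis by (simp add: w_def l_def)
qed

section \<open>An orthonormal set of spherical eigenvectors\<close>

definition sphV :: "'h set set" where "sphV = {V \<in> \<V>. VK V \<noteq> {0}}"
definition eV :: "'h set \<Rightarrow> 'h" where "eV V = (SOME e. e \<in> VK V \<and> norm e = 1)"
text \<open>\<open>J e\<close> is included because \<open>span\<close> is over the reals, where a
  complex line needs two vectors.\<close>

definition BB :: "'h set" where "BB = eV ` sphV \<union> (\<lambda>V. J (eV V)) ` sphV"
definition lam :: "'h \<Rightarrow> real" where "lam e = inner (Cas e) e"

lemma eV: assumes "V \<in> sphV" shows "V \<in> \<V>" "eV V \<in> VK V" "norm (eV V) = 1"
proof -
  show V: "V \<in> \<V>" using assms by (simp add: sphV_def)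
  have sub: "subspace (VK V)" by (rule VK_closed_subspace(2)[OF \<V>_inv[OF V]])
  then have "0 \<in> VK V" by (rule subspace_0)
  then obtain v where v: "v \<in> VK V" "v \<noteq> 0" using assms by (auto simp: sphV_def)
  then have "v /\<^sub>R norm v \<in> VK V \<and> norm (v /\<^sub>R norm v) = 1" using sub by (simp add: subspace_scale)
  from someI[of "\<lambda>e. e \<in> VK V \<and> norm e = 1", OF this]
  show "eV V \<in> VK V" "norm (eV V) = 1" by (simp_all add: eV_def)
qed

lemma BB_cases:
  assumes "e \<in> BB"
  obtains V where "V \<in> sphV" "e = eV V" | V where "V \<in> sphV" "e = J (eV V)"
  using assms by (auto simp: BB_def)

lemma BB_in_VK: assumes "e \<in> BB" shows "\<exists>V\<in>sphV. e \<in> VK V \<and> norm e = 1 \<and> (e = eV V \<or> e = J (eV V))"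
  using assms
proof (cases rule: BB_cases)
  case (1 V) then show ?thesis using eV by blast
next
  case (2 V) then show ?thesis using eV[OF 2(1)] VK_closed_subspace(3)[OF \<V>_inv] by (intro bexI[of _ V]) auto
qed

lemma BB_onb: "onb BB"
  unfolding onb_def
proof (intro conjI ballI impI)
  fix e assume e: "e \<in> BB"
  show "inner e e = 1" using BB_in_VK[OF e] by (auto simp: norm_eq_1)
  fix f assume f: "f \<in> BB" "e \<noteq> f"
  obtain V where V: "V \<in> sphV" "e \<in> VK V" "e = eV V \<or> e = J (eV V)" using BB_in_VK[OF e] by blast
  obtain W where W: "W \<in> sphV" "f \<in> VK W" "f = eV W \<or> f = J (eV W)" using BB_in_VK[OF f(1)] by blast
  show "inner e f = 0"
  proof (cases "V = W")
    case True
    then show ?thesis using V(3) W(3) f(2) by auto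
  next
    case False
    then show ?thesis using \<V>_orthogonal[of V W e f] V W by (auto simp: sphV_def VK_def)
  qed
qed

lemma BB_Hf: "e \<in> BB \<Longrightarrow> e \<in> Hf" and BB_K: "e \<in> BB \<Longrightarrow> K_invariant \<pi> e"
  and BB_eigen: "e \<in> BB \<Longrightarrow> Cas e = lam e *\<^sub>R e" and BB_lam: "e \<in> BB \<Longrightarrow> lam e \<ge> 0"
proof -
  assume "e \<in> BB"
  then obtain V where V: "V \<in> \<V>" "e \<in> VK V" "norm e = 1" using BB_in_VK by (auto simp: sphV_def)
  show "e \<in> Hf" "K_invariant \<pi> e" "Cas e = lam e *\<^sub>R e" "lam e \<ge> 0"
    using VK_Hf[OF V(1,2)] VK_eigen[OF V] V(2) by (auto simp: lam_def VK_def)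
qed

lemma BB_finite: "finite {e \<in> BB. lam e \<le> B}"
proof -
  let ?S = "{V\<in>\<V>. \<exists>c. cmod c \<le> \<bar>B\<bar> \<and> (\<forall>v\<in>V. smoothvec \<pi> v \<longrightarrow> Cas v = cscale J c v)}"
  have "{e \<in> BB. lam e \<le> B} \<subseteq> eV ` ?S \<union> (\<lambda>V. J (eV V)) ` ?S"
  proof
    fix e assume "e \<in> {e \<in> BB. lam e \<le> B}"
    then have e: "e \<in> BB" "lam e \<le> B" by auto
    obtain V where V: "V \<in> \<V>" "e \<in> VK V" "norm e = 1" "e = eV V \<or> e = J (eV V)"
      using BB_in_VK[OF e(1)] by (auto simp: sphV_def)
    have "V \<in> ?S"
    proof (intro CollectI conjI V(1) exI[of _ "complex_of_real (lam e)"] ballI impI)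
      show "cmod (complex_of_real (lam e)) \<le> \<bar>B\<bar>" using BB_lam[OF e(1)] e(2) by simp
      fix v assume "v \<in> V" "smoothvec \<pi> v"
      then show "Cas v = cscale J (complex_of_real (lam e)) v"
        using Cas_scalar[OF V(1-3)] by (simp add: cscale_def lam_def)
    qed
    then show "e \<in> eV ` ?S \<union> (\<lambda>V. J (eV V)) ` ?S" using V(4) by blast
  qed
  then show ?thesis using \<V>_finite[of "\<bar>B\<bar>"] finite_subset by blast
qed

lemma VK_BB: assumes "V \<in> \<V>" "v \<in> VK V" shows "v \<in> span BB"
proof (cases "v = 0")
  case True
  then show ?thesis by (simp add: span_0)
next
  case False
  then have V: "V \<in> sphV" using assms by (auto simp: sphV_def)
  have "v = inner v (eV V) *\<^sub>R eV V + inner v (J (eV V)) *\<^sub>R J (eV V)"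
    by (rule VK_line[OF \<V>_irreducible[OF assms(1)] eV(2,3)[OF V] assms(2)])
  moreover have "eV V \<in> span BB" "J (eV V) \<in> span BB" using V by (auto simp: BB_def intro!: span_base)
  ultimately show ?thesis by (metis span_add span_scale)
qed

lemma PK_span: "PK ` span (\<Union>\<V>) \<subseteq> span BB"
proof -
  have "PK ` \<Union>\<V> \<subseteq> span BB"
  proof
    fix y assume "y \<in> PK ` \<Union>\<V>"
    then obtain V v where V: "V \<in> \<V>" "v \<in> V" "y = PK v" by blast
    then have "y \<in> VK V" using PK_in[OF \<V>_inv] PK_K_invariant by (simp add: VK_def)
    then show "y \<in> span BB" using VK_BB V(1) by blast
  qed
  then have "span (PK ` \<Union>\<V>) \<subseteq> span BB" by (rule span_minimal[OF _ subspace_span])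
  then show ?thesis by (simp only: linear_span_image[OF PK.linear_axioms])
qed

lemma Hf_span_BB: assumes "\<alpha> \<in> Hf" "K_invariant \<pi> \<alpha>" shows "\<alpha> \<in> span BB"
proof -
  have "Hf \<subseteq> span (\<Union>\<V>)" unfolding Hfin_def by (rule span_mono) blast
  then have "PK \<alpha> \<in> span BB" using PK_span assms(1) by blast
  then show ?thesis by (simp add: PK_fix assms(2))
qed

lemma K_invariant_closure_BB: assumes "K_invariant \<pi> x" shows "x \<in> closure (span BB)"
proof -
  have "PK ` closure (span (\<Union>\<V>)) \<subseteq> closure (span BB)"
    by (rule image_closure_subset[OF linear_continuous_on[OF PK_bounded_linear] closed_closure])
       (rule order_trans[OF PK_span closure_subset])
  then have "PK x \<in> closure (span BB)" by (auto simp: \<V>_dense)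
  then show ?thesis by (simp add: PK_fix assms)
qed

lemma proj_approx:
  assumes x: "K_invariant \<pi> x" and "\<delta> > 0"
  obtains S where "finite S" "S \<subseteq> BB" "\<And>T. finite T \<Longrightarrow> S \<subseteq> T \<Longrightarrow> T \<subseteq> BB \<Longrightarrow> norm (x - proj T x) < \<delta>"
proof -
  obtain y where y: "y \<in> span BB" "dist y x < \<delta>"
    using K_invariant_closure_BB[OF x] \<open>\<delta> > 0\<close> by (auto simp: closure_approachable)
  obtain S c where S: "finite S" "S \<subseteq> BB" "y = (\<Sum>e\<in>S. c e *\<^sub>R e)"
    using y(1) by (auto simp: span_explicit)
  show ?thesis
  proof (rule that[OF S(1,2)])
    fix T assume T: "finite T" "S \<subseteq> T" "T \<subseteq> BB"
    have "y \<in> span T" unfolding S(3) using T(2) by (intro span_sum span_scale span_base) auto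
    then have "proj T y = y" using proj_eq[OF onb_subset[OF BB_onb T(3)] T(1)] by simp
    then have eq: "x - proj T x = (x - y) - proj T (x - y)" by (simp add: proj_diff)
    have "norm (x - proj T x) \<le> norm (x - y)"
      unfolding eq by (rule norm_diff_proj[OF onb_subset[OF BB_onb T(3)] T(1)])
    then show "norm (x - proj T x) < \<delta>" using y(2) by (simp add: dist_norm norm_minus_commute)
  qed
qed

lemma span_BB: assumes "\<alpha> \<in> span BB" shows "\<alpha> \<in> Hf" "K_invariant \<pi> \<alpha>" "Kd \<alpha> = 0"
proof -
  show "\<alpha> \<in> Hf" using span_minimal[OF _ Hf_subspace, of BB] BB_Hf assms by blast
  show "K_invariant \<pi> \<alpha>" using span_minimal[OF _ K_invariant_subspace, of BB] BB_K assms by blast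
  then show "Kd \<alpha> = 0" by (rule K_invariant_Kd)
qed

lemma Cas_span:
  assumes S: "finite S" "S \<subseteq> BB" and \<alpha>: "\<alpha> \<in> span S"
  shows "Cas \<alpha> = (\<Sum>e\<in>S. (lam e * inner \<alpha> e) *\<^sub>R e)"
proof -
  have Cas_sum: "Cas (\<Sum>e\<in>T. c e *\<^sub>R e) = (\<Sum>e\<in>T. (lam e * c e) *\<^sub>R e) \<and> (\<Sum>e\<in>T. c e *\<^sub>R e) \<in> Hf"
    if "finite T" "T \<subseteq> BB" for T c
    using that
  proof (induction T rule: finite_induct)
    case empty
    show ?case using Casimir_scale[OF Hf_D2[OF Hf_0], of 0] by (simp add: Hf_0)
  next
    case (insert e T)
    then have "e \<in> BB" "e \<in> Hf" using BB_Hf by auto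
    then show ?case using insert
      by (simp add: Casimir_add Casimir_scale Hf_D2 D2_scale Hf_closed BB_eigen mult.commute)
  qed
  have "Cas (proj S \<alpha>) = (\<Sum>e\<in>S. (lam e * inner \<alpha> e) *\<^sub>R e)"
    unfolding proj_def using Cas_sum[OF S] by simp
  then show ?thesis using proj_eq[OF onb_subset[OF BB_onb S(2)] S(1) \<alpha>] by simp
qed

lemma eigen_orth:
  assumes "x \<in> Hf" "Cas x = l *\<^sub>R x" "f \<in> BB" "lam f \<noteq> l" shows "inner x f = 0"
proof -
  have "l * inner x f = lam f * inner x f"
    using Casimir_sym[OF Hf_D2[OF assms(1)] Hf_D2[OF BB_Hf[OF assms(3)]]] by (simp add: assms(2,3) BB_eigen)
  then show ?thesis using assms(4) by simp
qed

lemma cj_K_invariant: "a \<in> Hf \<Longrightarrow> K_invariant \<pi> a \<Longrightarrow> K_invariant \<pi> (cj a)"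
proof -
  assume a: "a \<in> Hf" "K_invariant \<pi> a"
  have "cj 0 = 0" using cj_scale[OF Hf_0, of 0] by simp
  then have "Kd (cj a) = 0" using cj_dvec(1)[OF a(1)] K_invariant_Kd[OF a(2)] by simp
  then show ?thesis by (rule Kd_K_invariant[OF Hf_D1[OF cj_Hf[OF a(1)]]])
qed

lemma eigen_span:
  assumes x: "x \<in> Hf" "K_invariant \<pi> x" "Cas x = l *\<^sub>R x" and "P l"
  shows "x \<in> span {e \<in> BB. P (lam e)}"
proof -
  obtain T c where T: "finite T" "T \<subseteq> BB" "x = (\<Sum>f\<in>T. c f *\<^sub>R f)"
    using Hf_span_BB[OF x(1,2)] by (auto simp: span_explicit)
  have "c f = inner x f" if "f \<in> T" for f
    using onb_inner_sum[OF onb_subset[OF BB_onb T(2)] T(1) that, of c] T(3) by simp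
  then have "lam f = l \<or> c f = 0" if "f \<in> T" for f
    using eigen_orth[OF x(1,3)] that T(2) by auto
  then have "c f = 0 \<or> f \<in> {e \<in> BB. P (lam e)}" if "f \<in> T" for f
    using that T(2) \<open>P l\<close> by auto
  then have "c f *\<^sub>R f \<in> span {e \<in> BB. P (lam e)}" if "f \<in> T" for f
    using that by (metis scale_eq_0_iff span_base span_scale span_zero)
  then show ?thesis unfolding T(3) by (rule span_sum)
qed

lemma J_span:
  assumes \<alpha>: "\<alpha> \<in> span {e \<in> BB. P (lam e)}" shows "J \<alpha> \<in> span {e \<in> BB. P (lam e)}"
proof -
  let ?S = "{e \<in> BB. P (lam e)}"
  have "J ` ?S \<subseteq> span ?S"
    by (auto intro!: eigen_span simp: BB_Hf Hf_J BB_K K_invariant_J Casimir_J Hf_D2 BB_eigen J_scale)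
  from span_minimal[OF this subspace_span] have "J ` span ?S \<subseteq> span ?S" by (simp only: linear_span_image[OF linear_J])
  then show ?thesis using \<alpha> by blast
qed

text \<open>Conjugation need not preserve the chosen basis, only eigenvalues and K-invariance, so it
  is tracked for whole spectral windows. This permits splitting into real and imaginary parts inside
  one window.\<close>

lemma cj_span:
  assumes \<alpha>: "\<alpha> \<in> span {e \<in> BB. P (lam e)}" shows "cj \<alpha> \<in> span {e \<in> BB. P (lam e)}"
proof -
  let ?S = "{e \<in> BB. P (lam e)}"
  have cje: "cj e \<in> span ?S" if e: "e \<in> ?S" for e
  proof (rule eigen_span)
    have eH: "e \<in> Hf" "e \<in> BB" "P (lam e)" using e BB_Hf by auto
    show "cj e \<in> Hf" "K_invariant \<pi> (cj e)" "P (lam e)"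
      by (simp_all add: eH cj_Hf cj_K_invariant BB_K)
    show "Cas (cj e) = lam e *\<^sub>R cj e"
      using cj_Cas[OF eH(1)] by (simp add: BB_eigen eH cj_scale)
  qed
  have cj0: "cj 0 = 0" using cj_scale[OF Hf_0, of 0] by simp
  have "subspace {\<alpha> \<in> Hf. cj \<alpha> \<in> span ?S}"
    by (auto simp: subspace_def cj0 Hf_closed span_0 cj_add cj_scale intro: span_add span_scale)
  then have "span ?S \<subseteq> {\<alpha> \<in> Hf. cj \<alpha> \<in> span ?S}"
    by (rule span_minimal[rotated]) (use cje BB_Hf in auto)
  then show ?thesis using \<alpha> by blast
qed

section \<open>Spectral positivity\<close>

text \<open>Products may leave \<open>Hf\<close>, so \<open>Cas\<close> needs a larger domain on
  which it can be iterated. By the Leibniz rule the span of all products is stable under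
  \<open>Cas\<close>, and it contains \<open>Hf\<close> because of the unit.\<close>

definition MM :: "'h set" where "MM = span {m a b |a b. a \<in> Hf \<and> b \<in> Hf}"

lemma m_MM: "a \<in> Hf \<Longrightarrow> b \<in> Hf \<Longrightarrow> m a b \<in> MM"
  unfolding MM_def by (rule span_base) blast

lemma MM_subspace: "subspace MM" by (simp add: MM_def)

lemma MM_props: assumes "x \<in> MM" shows "D2 x" "Cas x \<in> MM"
proof -
  have m2: "D2 (m a b)" if "a \<in> Hf" "b \<in> Hf" for a b using m_smooth[OF that] smooth_D2 by simp
  have mC: "Cas (m a b) \<in> MM" if "a \<in> Hf" "b \<in> Hf" for a b
    unfolding Cas_m[OF that] using that
    by (intro subspace_add[OF MM_subspace] subspace_diff[OF MM_subspace] subspace_scale[OF MM_subspace] m_MM Hf_Cas Hf_closed)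
  have z: "Cas 0 = 0" "D2 0" using Casimir_scale[OF Hf_D2[OF Hf_0], of 0] Hf_D2[OF Hf_0] by simp_all
  have "subspace {x. D2 x \<and> Cas x \<in> MM}"
    using z MM_subspace by (auto simp: subspace_def D2_add D2_scale Casimir_add Casimir_scale)
  moreover have "{m a b |a b. a \<in> Hf \<and> b \<in> Hf} \<subseteq> {x. D2 x \<and> Cas x \<in> MM}" using m2 mC by blast
  ultimately have "span {m a b |a b. a \<in> Hf \<and> b \<in> Hf} \<subseteq> {x. D2 x \<and> Cas x \<in> MM}"
    by (rule span_minimal[rotated])
  then have "MM \<subseteq> {x. D2 x \<and> Cas x \<in> MM}" by (rule ord_eq_le_trans[OF MM_def])
  then show "D2 x" "Cas x \<in> MM" using assms by auto
qed

lemma Hf_MM: "a \<in> Hf \<Longrightarrow> a \<in> MM"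
  using m_MM[OF one_Hf] m_one by metis

lemma Cas_inner: "x \<in> MM \<Longrightarrow> y \<in> MM \<Longrightarrow> inner (Cas x) y = inner x (Cas y)"
  by (rule Casimir_sym) (simp_all add: MM_props)

lemma Cas_inner_BB: "x \<in> MM \<Longrightarrow> e \<in> BB \<Longrightarrow> inner (Cas x) e = lam e * inner x e"
  using Cas_inner[of x e] by (simp add: Hf_MM BB_Hf BB_eigen)

text \<open>This stands in for the spectral theorem, since \<open>F\<close> may have infinitely many
  components. Only the second factor of the pairing is projected to finitely many eigenvectors, so
  no convergence of the expansion of \<open>Cas F\<close> is required. The constant \<open>C\<close>
  makes up for negative values of the polynomial at low eigenvalues.\<close>

lemma spectral_positivity:
  assumes F: "F \<in> MM" "K_invariant \<pi> F"
    and pos: "\<And>e. e \<in> BB \<Longrightarrow> c0 + c1 * lam e + c2 * lam e ^ 2 + c3 * lam e ^ 3 + (if lam e \<le> \<Lambda> then C else 0) \<ge> 0"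
  shows "inner (c0 *\<^sub>R F + c1 *\<^sub>R Cas F + c2 *\<^sub>R Cas (Cas F) + c3 *\<^sub>R Cas (Cas (Cas F))) F
     + C * (\<Sum>e\<in>{e \<in> BB. lam e \<le> \<Lambda>}. (inner F e)\<^sup>2) \<ge> 0"
proof -
  let ?S0 = "{e \<in> BB. lam e \<le> \<Lambda>}"
  define u where "u = c0 *\<^sub>R F + c1 *\<^sub>R Cas F + c2 *\<^sub>R Cas (Cas F) + c3 *\<^sub>R Cas (Cas (Cas F))"
  define q where "q s = c0 + c1 * s + c2 * s ^ 2 + c3 * s ^ 3" for s
  have ue: "inner u e = q (lam e) * inner F e" if "e \<in> BB" for e
    using that F(1) by (simp add: u_def q_def inner_add_left Cas_inner_BB MM_props power2_eq_square power3_eq_cube algebra_simps)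
  have "inner u F + C * (\<Sum>e\<in>?S0. (inner F e)\<^sup>2) \<ge> - \<epsilon>" if "\<epsilon> > 0" for \<epsilon>
  proof -
    have "\<epsilon> / (norm u + 1) > 0" using that by (simp add: add_nonneg_pos)
    then obtain S where S: "finite S" "S \<subseteq> BB"
      "\<And>T. finite T \<Longrightarrow> S \<subseteq> T \<Longrightarrow> T \<subseteq> BB \<Longrightarrow> norm (F - proj T F) < \<epsilon> / (norm u + 1)"
      using proj_approx[OF F(2)] by blast
    define T where "T = S \<union> ?S0"
    have T: "finite T" "S \<subseteq> T" "T \<subseteq> BB" "?S0 \<subseteq> T" using S(1,2) BB_finite by (auto simp: T_def)
    have "norm u * norm (F - proj T F) \<le> norm u * (\<epsilon> / (norm u + 1))"
      using S(3)[OF T(1-3)] by (intro mult_left_mono) auto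
    also have "\<dots> \<le> \<epsilon>" using that add_nonneg_pos[OF norm_ge_zero[of u] zero_less_one] by (simp add: field_simps)
    finally have err: "- \<epsilon> \<le> inner u (F - proj T F)"
      using Cauchy_Schwarz_ineq2[of u "F - proj T F"] by linarith
    have "inner u (proj T F) = (\<Sum>e\<in>T. q (lam e) * (inner F e)\<^sup>2)"
      unfolding inner_proj_right using T(3) by (intro sum.cong refl) (auto simp: ue power2_eq_square)
    moreover have "C * (\<Sum>e\<in>?S0. (inner F e)\<^sup>2) = (\<Sum>e\<in>T. (if lam e \<le> \<Lambda> then C else 0) * (inner F e)\<^sup>2)"
    proof -
      have "(\<Sum>e\<in>T. (if lam e \<le> \<Lambda> then C else 0) * (inner F e)\<^sup>2) = (\<Sum>e\<in>?S0. (if lam e \<le> \<Lambda> then C else 0) * (inner F e)\<^sup>2)"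
        using T by (intro sum.mono_neutral_right) auto
      then show ?thesis by (simp add: sum_distrib_left)
    qed
    ultimately have "inner u (proj T F) + C * (\<Sum>e\<in>?S0. (inner F e)\<^sup>2)
        = (\<Sum>e\<in>T. (q (lam e) + (if lam e \<le> \<Lambda> then C else 0)) * (inner F e)\<^sup>2)"
      by (simp add: sum.distrib distrib_right)
    also have "\<dots> \<ge> 0"
    proof (intro sum_nonneg mult_nonneg_nonneg)
      fix e assume "e \<in> T"
      then have "e \<in> BB" using T(3) by blast
      then show "0 \<le> q (lam e) + (if lam e \<le> \<Lambda> then C else 0)" unfolding q_def by (rule pos)
    qed simp
    finally show ?thesis using err by (simp add: inner_diff_right)
  qed
  then have "0 \<le> inner u F + C * (\<Sum>e\<in>?S0. (inner F e)\<^sup>2) + \<epsilon>" if "\<epsilon> > 0" for \<epsilon> using that by fastforce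
  then show ?thesis unfolding u_def by (rule field_le_epsilon)
qed

end

section \<open>Raising and lowering operators\<close>

context mult_rep
begin

definition Ed :: "'h \<Rightarrow> 'h" where "Ed a = (1/2) *\<^sub>R (Ad a + J (Sd a))"
definition Fd :: "'h \<Rightarrow> 'h" where "Fd a = (1/2) *\<^sub>R (Ad a - J (Sd a))"

lemma Hf_Ed: "a \<in> Hf \<Longrightarrow> Ed a \<in> Hf" and Hf_Fd: "a \<in> Hf \<Longrightarrow> Fd a \<in> Hf"
  by (simp_all add: Ed_def Fd_def Hf_closed)

lemma Ed_linear: assumes "a \<in> Hf" "b \<in> Hf"
  shows "Ed (a + b) = Ed a + Ed b" "Ed (a - b) = Ed a - Ed b" "Ed (c *\<^sub>R a) = c *\<^sub>R Ed a" "Ed (- a) = - Ed a" "Ed (J a) = J (Ed a)"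
    "Fd (a + b) = Fd a + Fd b" "Fd (a - b) = Fd a - Fd b" "Fd (c *\<^sub>R a) = c *\<^sub>R Fd a" "Fd (- a) = - Fd a" "Fd (J a) = J (Fd a)"
proof -
  have s: "Ed (c *\<^sub>R a) = c *\<^sub>R Ed a" "Fd (c *\<^sub>R a) = c *\<^sub>R Fd a" for c
    by (simp_all add: Ed_def Fd_def dvec_linear(7,9)[OF assms] J_scale scaleR_add_right scaleR_diff_right)
  show "Ed (c *\<^sub>R a) = c *\<^sub>R Ed a" "Fd (c *\<^sub>R a) = c *\<^sub>R Fd a" by (rule s)+
  show "Ed (- a) = - Ed a" "Fd (- a) = - Fd a" using s[of "-1"] by simp_all
  show "Ed (a + b) = Ed a + Ed b" "Ed (a - b) = Ed a - Ed b" "Fd (a + b) = Fd a + Fd b" "Fd (a - b) = Fd a - Fd b"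
    by (simp_all add: Ed_def Fd_def dvec_linear[OF assms] J_add J_diff algebra_simps)
  show "Ed (J a) = J (Ed a)" "Fd (J a) = J (Fd a)"
    by (simp_all add: Ed_def Fd_def dvec_linear[OF assms] J_add J_diff J_scale)
qed

lemma cj_Ed: "a \<in> Hf \<Longrightarrow> cj (Ed a) = Fd (cj a)" and cj_Fd: "a \<in> Hf \<Longrightarrow> cj (Fd a) = Ed (cj a)"
  by (simp_all add: Ed_def Fd_def cj_scale cj_add cj_diff cj_J cj_dvec Hf_closed cj_Hf)

lemma Kd_Ed: assumes a: "a \<in> Hf" shows "Kd (Ed a) = Ed (Kd a) + 2 *\<^sub>R J (Ed a)"
proof -
  have "Kd (Ed a) = (1/2) *\<^sub>R (Kd (Ad a) + J (Kd (Sd a)))"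
    using a by (simp add: Ed_def dvec_linear[where b = "J (Sd a)"] dvec_linear[where b = a] Hf_closed)
  then show ?thesis using a
    by (simp add: Ed_def commutators J_add J_diff J_scale algebra_simps)
qed

lemma Fd_Ed: assumes a: "a \<in> Hf" shows "Fd (Ed a) = Ed (Fd a) + J (Kd a)"
proof -
  have 1: "Ad (Ed a) = (1/2) *\<^sub>R (Ad (Ad a) + J (Ad (Sd a)))" "Sd (Ed a) = (1/2) *\<^sub>R (Sd (Ad a) + J (Sd (Sd a)))"
    "Ad (Fd a) = (1/2) *\<^sub>R (Ad (Ad a) - J (Ad (Sd a)))" "Sd (Fd a) = (1/2) *\<^sub>R (Sd (Ad a) - J (Sd (Sd a)))"
    using a by (simp_all add: Ed_def Fd_def dvec_linear[where b = "J (Sd a)"] dvec_linear[where b = a] Hf_closed)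
  show ?thesis unfolding Fd_def[of "Ed a"] Ed_def[of "Fd a"] 1 using commutators(3)[OF a]
    by (simp add: J_add J_diff J_scale algebra_simps flip: scaleR_add_left)
qed

lemma Cas_EF: assumes a: "a \<in> Hf" shows "Cas a = (1/4) *\<^sub>R Kd (Kd a) - (1/2) *\<^sub>R (Ed (Fd a) + Fd (Ed a))"
proof -
  have 1: "Ad (Ed a) = (1/2) *\<^sub>R (Ad (Ad a) + J (Ad (Sd a)))" "Sd (Ed a) = (1/2) *\<^sub>R (Sd (Ad a) + J (Sd (Sd a)))"
    "Ad (Fd a) = (1/2) *\<^sub>R (Ad (Ad a) - J (Ad (Sd a)))" "Sd (Fd a) = (1/2) *\<^sub>R (Sd (Ad a) - J (Sd (Sd a)))"
    using a by (simp_all add: Ed_def Fd_def dvec_linear[where b = "J (Sd a)"] dvec_linear[where b = a] Hf_closed)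
  show ?thesis unfolding Casimir_eq[OF Hf_D2[OF a]] Fd_def[of "Ed a"] Ed_def[of "Fd a"] 1
    by (simp add: J_add J_diff J_scale algebra_simps flip: scaleR_add_left)
qed

lemma Cas_m_EF:
  assumes a: "a \<in> Hf" and b: "b \<in> Hf"
  shows "Cas (m a b) = m (Cas a) b + m a (Cas b) + (1/2) *\<^sub>R m (Kd a) (Kd b) - m (Ed a) (Fd b) - m (Fd a) (Ed b)"
proof -
  have "m (Ed a) (Fd b) + m (Fd a) (Ed b) = (1/2) *\<^sub>R (m (Ad a) (Ad b) + m (Sd a) (Sd b))"
    using a b by (simp add: Ed_def Fd_def m_linear Hf_closed J_add J_diff J_scale algebra_simps flip: scaleR_add_left)
  then have "- m (Ed a) (Fd b) - m (Fd a) (Ed b) = - (1/2) *\<^sub>R (m (Ad a) (Ad b) + m (Sd a) (Sd b))"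
    by (metis (no_types, lifting) diff_conv_add_uminus minus_add_distrib scaleR_minus_left)
  then show ?thesis unfolding Cas_m[OF a b] by (simp add: algebra_simps)
qed

text \<open>\<open>Ed\<close> raises the \<open>Kd\<close> eigenvalue by 2i, and this weight enters
  the commutator of \<open>Fd\<close> and \<open>Ed\<close>. Hence on vectors raised from a K-fixed
  one \<open>Fd\<close> undoes \<open>Ed\<close> up to \<open>Cas\<close> and constants; the
  constants become corrections of relative size 1/Lambda.\<close>

lemma raising:
  assumes b: "b \<in> Hf" and K: "Kd b = 0"
  shows "Kd (Ed b) = 2 *\<^sub>R J (Ed b)" "Kd (Ed (Ed b)) = 4 *\<^sub>R J (Ed (Ed b))"
    "Fd (Ed b) = - Cas b" "Fd (Ed (Ed b)) = - Ed (Cas b) - 2 *\<^sub>R Ed b"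
    "Cas (Ed b) = Ed (Cas b)" "Cas (Ed (Ed b)) = Ed (Ed (Cas b))"
proof -
  note c = Hf_closed Hf_Ed Hf_Fd Hf_Cas b
  have z: "Ed 0 = 0" "Fd 0 = 0" "Kd 0 = 0" using Ed_linear(3,8)[OF Hf_0 Hf_0, of 0] dvec_linear(8)[OF Hf_0 Hf_0, of 0] by simp_all
  show K1: "Kd (Ed b) = 2 *\<^sub>R J (Ed b)" by (simp add: Kd_Ed b K z)
  show K2: "Kd (Ed (Ed b)) = 4 *\<^sub>R J (Ed (Ed b))"
    using Kd_Ed[OF Hf_Ed[OF b]] by (simp add: K1 Ed_linear[where b = b] c flip: scaleR_add_left)
  have FE: "Fd (Ed b) = Ed (Fd b)" using Fd_Ed[OF b] by (simp add: K)
  show F1: "Fd (Ed b) = - Cas b" using Cas_EF[OF b] FE by (simp add: K z flip: scaleR_2)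
  have EF: "Ed (Fd b) = - Cas b" using FE F1 by simp
  show F2: "Fd (Ed (Ed b)) = - Ed (Cas b) - 2 *\<^sub>R Ed b"
    using Fd_Ed[OF Hf_Ed[OF b]] by (simp add: F1 K1 J_scale Ed_linear[where b = b] c)
  have KK1: "Kd (Kd (Ed b)) = - 4 *\<^sub>R Ed b"
    by (simp add: K1 dvec_linear[where b = b] c J_scale)
  show "Cas (Ed b) = Ed (Cas b)"
    unfolding Cas_EF[OF Hf_Ed[OF b]] KK1 F1 F2 by (simp add: Ed_linear[where b = b] c algebra_simps flip: scaleR_add_left)
  have KK2: "Kd (Kd (Ed (Ed b))) = - 16 *\<^sub>R Ed (Ed b)"
    by (simp add: K2 dvec_linear[where b = b] c J_scale)
  have F3: "Fd (Ed (Ed (Ed b))) = - Ed (Ed (Cas b)) - 6 *\<^sub>R Ed (Ed b)"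
    using Fd_Ed[OF Hf_Ed[OF Hf_Ed[OF b]]]
    by (simp add: F2 K2 J_scale Ed_linear(2)[where b = "2 *\<^sub>R Ed b"] Ed_linear[where b = b] c algebra_simps flip: scaleR_add_left)
  show "Cas (Ed (Ed b)) = Ed (Ed (Cas b))"
    unfolding Cas_EF[OF Hf_Ed[OF Hf_Ed[OF b]]] KK2 F3 F2
    by (simp add: Ed_linear(2)[where b = "2 *\<^sub>R Ed b"] Ed_linear[where b = b] c algebra_simps flip: scaleR_add_left)
qed

text \<open>Conjugating the raising relations gives these, since \<open>cj\<close> exchanges
  \<open>Ed\<close> and \<open>Fd\<close>.\<close>

lemma lowering:
  assumes b: "b \<in> Hf" and K: "Kd b = 0"
  shows "Kd (Fd b) = - 2 *\<^sub>R J (Fd b)" "Kd (Fd (Fd b)) = - 4 *\<^sub>R J (Fd (Fd b))"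
    "Ed (Fd b) = - Cas b" "Ed (Fd (Fd b)) = - Fd (Cas b) - 2 *\<^sub>R Fd b"
    "Cas (Fd b) = Fd (Cas b)" "Cas (Fd (Fd b)) = Fd (Fd (Cas b))"
proof -
  define c where "c = cj b"
  have c: "c \<in> Hf" "b = cj c" using b by (simp_all add: c_def cj_Hf cj_cj)
  have Kc: "Kd c = 0" unfolding c_def using cj_dvec(1)[OF b] cj_scale[OF Hf_0, of 0] by (simp add: K)
  note cl = c Hf_closed Hf_Ed Hf_Fd Hf_Cas
  note r = raising[OF c(1) Kc, THEN arg_cong[where f = cj]]
  note s = cj_Ed cj_Fd cj_dvec cj_scale cj_J cj_minus cj_diff cj_Cas
  show "Kd (Fd b) = - 2 *\<^sub>R J (Fd b)" "Kd (Fd (Fd b)) = - 4 *\<^sub>R J (Fd (Fd b))"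
    "Ed (Fd b) = - Cas b" "Ed (Fd (Fd b)) = - Fd (Cas b) - 2 *\<^sub>R Fd b"
    "Cas (Fd b) = Fd (Cas b)" "Cas (Fd (Fd b)) = Fd (Fd (Cas b))"
    using r by (simp_all add: s cl)
qed

definition u1 :: "'h \<Rightarrow> 'h \<Rightarrow> 'h" where "u1 b c = m (Ed b) (Fd c)"
definition u2 :: "'h \<Rightarrow> 'h \<Rightarrow> 'h" where "u2 b c = m (Ed (Ed b)) (Fd (Fd c))"
definition u3 :: "'h \<Rightarrow> 'h \<Rightarrow> 'h" where "u3 b c = m (Ed (Ed (Ed b))) (Fd (Fd (Fd c)))"

text \<open>The Leibniz rule with K-fixed factors, where the \<open>Kd\<close> term vanishes. If
  both factors have eigenvalues near Lambda and s is the rescaled Casimir on the product, the right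
  side is about Lambda (2 - s) times the product: half of this is the origin of p_1 = 1 -
  s/2.\<close>

lemma u1_rec:
  assumes "b \<in> Hf" "Kd b = 0" "c \<in> Hf" "Kd c = 0"
  shows "u1 b c + u1 c b = m (Cas b) c + m b (Cas c) - Cas (m b c)"
proof -
  have "m 0 0 = 0" using m_scale_left[OF Hf_0 Hf_0, of 0] by simp
  then show ?thesis using Cas_m_EF[OF assms(1,3)] assms
    by (simp add: u1_def m_commute[of "Fd b"] Hf_Ed Hf_Fd)
qed

text \<open>To leading order this and the next relation are the Chebyshev recursion p_{n+1} = (2 -
  s) p_n - p_{n-1}. The terms \<open>2 *\<^sub>R u1 b c\<close> and, in the next one,
  \<open>8 *\<^sub>R u2 b c\<close> come from the opposite weights 2i, -2i and 4i, -4i of the two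
  factors under \<open>Kd\<close>.\<close>

lemma u2_rec:
  assumes b: "b \<in> Hf" "Kd b = 0" and c: "c \<in> Hf" "Kd c = 0"
  shows "u2 b c = u1 (Cas b) c + u1 b (Cas c) + 2 *\<^sub>R u1 b c - Cas (u1 b c) - m (Cas b) (Cas c)"
  unfolding u1_def Cas_m_EF[OF Hf_Ed[OF b(1)] Hf_Fd[OF c(1)]] u2_def raising[OF b] lowering[OF c]
  using b c by (simp add: m_linear Hf_closed Hf_Ed Hf_Fd Hf_Cas J_scale)

lemma u3_rec:
  assumes b: "b \<in> Hf" "Kd b = 0" and c: "c \<in> Hf" "Kd c = 0"
  shows "u3 b c = u2 (Cas b) c + u2 b (Cas c) + 8 *\<^sub>R u2 b c - Cas (u2 b c)
      - (u1 (Cas b) (Cas c) + 2 *\<^sub>R (u1 (Cas b) c + u1 b (Cas c)) + 4 *\<^sub>R u1 b c)"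
  unfolding u1_def u2_def Cas_m_EF[OF Hf_Ed[OF Hf_Ed[OF b(1)]] Hf_Fd[OF Hf_Fd[OF c(1)]]] u3_def raising[OF b] lowering[OF c]
  using b c by (simp add: m_linear Hf_closed Hf_Ed Hf_Fd Hf_Cas J_scale algebra_simps)

lemma u_MM: "b \<in> Hf \<Longrightarrow> c \<in> Hf \<Longrightarrow> u1 b c \<in> MM" "b \<in> Hf \<Longrightarrow> c \<in> Hf \<Longrightarrow> u2 b c \<in> MM"
  by (simp_all add: u1_def u2_def m_MM Hf_Ed Hf_Fd)

text \<open>On functions these products are \<open>\<bar>E\<^sup>n b\<bar>\<^sup>2\<close>, which is nonnegative; crossing is what replaces pointwise positivity.\<close>

lemma u_positive:
  assumes b: "b \<in> Hf" "cj b = b"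
  shows "inner (u1 b b) (m b b) \<ge> 0" "inner (u2 b b) (m b b) \<ge> 0" "inner (u3 b b) (m b b) \<ge> 0"
proof -
  have p: "inner (m a (cj a)) (m b b) \<ge> 0" if "a \<in> Hf" for a
    using m_inner_pos[OF that b(1)] by (simp add: b(2))
  note cl = Hf_Ed Hf_Fd b
  show "inner (u1 b b) (m b b) \<ge> 0" "inner (u2 b b) (m b b) \<ge> 0" "inner (u3 b b) (m b b) \<ge> 0"
    using p[of "Ed b"] p[of "Ed (Ed b)"] p[of "Ed (Ed (Ed b))"] by (simp_all add: u1_def u2_def u3_def cj_Ed cl)
qed

end

section \<open>The bound on a narrow spectral window\<close>

text \<open>The negative of 2p_1 + p_2 + p_3 with (1 + s^2)/40 subtracted; this subtracted term
  later yields the squared norms of F and its rescaled Casimir. Up to 4 the slack 1/2 exceeds (1 +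
  16)/40, and beyond 4 the cubic dominates.\<close>

lemma cubic_bound:
  fixes s :: real
  assumes "s \<ge> 1"
  shows "- (4 + 1/40) + 15/2 * s - (7/2 + 1/40) * s\<^sup>2 + 1/2 * s ^ 3 \<ge> 0"
proof -
  have eq: "- (4 + 1/40) + 15/2 * s - (7/2 + 1/40) * s\<^sup>2 + 1/2 * s ^ 3
      = 1/2 * ((s - 1) * (s - 3)\<^sup>2) + 1/2 - 1/40 * (1 + s\<^sup>2)"
    by (simp add: power2_eq_square power3_eq_cube algebra_simps)
  show ?thesis
  proof (cases "s \<le> 4")
    case True
    have "s\<^sup>2 \<le> 4\<^sup>2" using True assms by (intro power_mono) auto
    moreover have "(s - 1) * (s - 3)\<^sup>2 \<ge> 0" using assms by simp
    ultimately show ?thesis unfolding eq by (simp add: distrib_left)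
  next
    case False
    have "(s / 4)\<^sup>2 \<le> (s - 3)\<^sup>2" using False by (intro power_mono) auto
    moreover have "3 * (s - 3)\<^sup>2 \<le> (s - 1) * (s - 3)\<^sup>2" using False by (intro mult_right_mono) auto
    ultimately have h: "3 * s\<^sup>2 \<le> 16 * ((s - 1) * (s - 3)\<^sup>2)" by (simp add: power_divide)
    have "0 \<le> s\<^sup>2" by simp
    with h have "0 \<le> 19 / 40 + ((s - 1) * (s - 3)\<^sup>2 / 2 - s\<^sup>2 / 40)" by linarith
    then show ?thesis unfolding eq by (simp add: distrib_left)
  qed
qed

text \<open>The cubic drops to -(4 + 1/40) at 0. The constant 5 covers this and becomes the weight
  of the low spectral part.\<close>

lemma cubic_bound_low:
  fixes s :: real
  assumes "0 \<le> s" "s \<le> 1"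
  shows "- (4 + 1/40) + 15/2 * s - (7/2 + 1/40) * s\<^sup>2 + 1/2 * s ^ 3 + 5 \<ge> 0"
proof -
  have "s\<^sup>2 \<le> s" using assms by (simp add: power2_eq_square mult_left_le)
  moreover have "s ^ 3 \<ge> 0" using assms by simp
  ultimately have "s\<^sup>2 * 141 \<le> 39 + (s * 300 + s ^ 3 * 20)" using assms by linarith
  then show ?thesis by (simp add: algebra_simps)
qed

context mult_rep
begin

lemma m_sum_bound:
  assumes N: "\<And>x y. x \<in> MM \<Longrightarrow> y \<in> MM \<Longrightarrow> N (x + y) \<le> N x + N y" "\<And>c x. x \<in> MM \<Longrightarrow> N (c *\<^sub>R x) = \<bar>c\<bar> * N x"
    and S: "finite S" "S \<subseteq> Hf" and x: "x \<in> Hf"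
  shows "N (m (\<Sum>e\<in>S. c e *\<^sub>R e) x) \<le> (\<Sum>e\<in>S. \<bar>c e\<bar> * N (m e x))"
  using S
proof (induction S rule: finite_induct)
  case empty
  have "m 0 x = 0 *\<^sub>R m 0 x" using m_scale_left[OF Hf_0 x, of 0] by simp
  then have "N (m 0 x) = 0" using N(2)[OF m_MM[OF Hf_0 x], of 0] by simp
  then show ?case by simp
next
  case (insert e S)
  have e: "e \<in> Hf" and s: "(\<Sum>e\<in>S. c e *\<^sub>R e) \<in> Hf"
    using insert by (auto intro!: subspace_sum[OF Hf_subspace] Hf_scale)
  have "N (m (\<Sum>e\<in>insert e S. c e *\<^sub>R e) x) = N (c e *\<^sub>R m e x + m (\<Sum>e\<in>S. c e *\<^sub>R e) x)"
    using insert e s x by (simp add: m_linear Hf_closed)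
  also have "\<dots> \<le> N (c e *\<^sub>R m e x) + N (m (\<Sum>e\<in>S. c e *\<^sub>R e) x)"
    by (intro N(1) m_MM s x subspace_scale[OF MM_subspace] e)
  also have "\<dots> \<le> \<bar>c e\<bar> * N (m e x) + (\<Sum>e\<in>S. \<bar>c e\<bar> * N (m e x))"
    using insert e x by (simp add: N(2) m_MM)
  finally show ?case using insert by simp
qed


definition Win :: "real \<Rightarrow> 'h set" where
  "Win \<Lambda> = {e \<in> BB. \<Lambda> < lam e \<and> lam e \<le> (1 + 1/100000) * \<Lambda>}"
definition WR :: "real \<Rightarrow> 'h set" where "WR \<Lambda> = {b \<in> span (Win \<Lambda>). cj b = b}"
definition Tn :: "real \<Rightarrow> 'h \<Rightarrow> 'h" where "Tn \<Lambda> x = (1 / \<Lambda>) *\<^sub>R Cas x"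
text \<open>A graph norm of the rescaled Casimir. It bounds pairings of two products with up to two
  applications of \<open>Tn\<close> between them, one being moved to each side.\<close>

definition Nn :: "real \<Rightarrow> 'h \<Rightarrow> real" where "Nn \<Lambda> x = norm x + norm (Tn \<Lambda> x)"
text \<open>The best constant in
  \<open>Nn \<Lambda> (m b b) \<le> Zs \<Lambda> * (norm b)\<^sup>2\<close> on real vectors of the
  window. The bootstrap bounds it in terms of itself.\<close>

definition Zs :: "real \<Rightarrow> real" where "Zs \<Lambda> = (SUP b\<in>{b \<in> WR \<Lambda>. norm b \<le> 1}. Nn \<Lambda> (m b b))"

lemma Win_finite: "finite (Win \<Lambda>)" and Win_BB: "Win \<Lambda> \<subseteq> BB"
  using finite_subset[OF _ BB_finite, of "Win \<Lambda>" "(1 + 1/100000) * \<Lambda>"] by (auto simp: Win_def)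

lemma WR_props: assumes "b \<in> WR \<Lambda>" shows "b \<in> Hf" "Kd b = 0" "K_invariant \<pi> b" "cj b = b" "b \<in> span (Win \<Lambda>)"
proof -
  show s: "b \<in> span (Win \<Lambda>)" "cj b = b" using assms by (auto simp: WR_def)
  have "b \<in> span BB" using s(1) span_mono[OF Win_BB] by blast
  then show "b \<in> Hf" "Kd b = 0" "K_invariant \<pi> b" by (simp_all add: span_BB)
qed

lemma WR_subspace: "subspace (WR \<Lambda>)"
proof -
  have cj0: "cj 0 = 0" using cj_scale[OF Hf_0, of 0] by simp
  show ?thesis
  proof (rule subspaceI)
    show "0 \<in> WR \<Lambda>" by (simp add: WR_def cj0 span_0)
    fix x y and c :: real assume x: "x \<in> WR \<Lambda>" and y: "y \<in> WR \<Lambda>"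
    note xp = WR_props[OF x] and yp = WR_props[OF y]
    show "x + y \<in> WR \<Lambda>" unfolding WR_def using xp yp by (simp add: cj_add span_add)
    show "c *\<^sub>R x \<in> WR \<Lambda>" unfolding WR_def using xp by (simp add: cj_scale span_scale)
  qed
qed

lemma WR_Tn:
  assumes \<Lambda>: "\<Lambda> > 0" and b: "b \<in> WR \<Lambda>"
  shows "Tn \<Lambda> b \<in> WR \<Lambda>" "norm (Tn \<Lambda> b - b) \<le> (1/100000) * norm b"
proof -
  note bp = WR_props[OF b]
  let ?W = "Win \<Lambda>"
  have C: "Cas b = (\<Sum>e\<in>?W. (lam e * inner b e) *\<^sub>R e)" by (rule Cas_span[OF Win_finite Win_BB bp(5)])
  have "Cas b \<in> span ?W" unfolding C by (intro span_sum span_scale span_base)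
  then show "Tn \<Lambda> b \<in> WR \<Lambda>"
    using cj_Cas[OF bp(1)] by (auto simp: WR_def Tn_def cj_scale Hf_Cas bp intro: span_scale)
  have onb: "onb ?W" by (rule onb_subset[OF BB_onb Win_BB])
  have "b = (\<Sum>e\<in>?W. inner b e *\<^sub>R e)" using proj_eq[OF onb Win_finite bp(5)] by (simp add: proj_def)
  then have "Tn \<Lambda> b - b = (1/\<Lambda>) *\<^sub>R (\<Sum>e\<in>?W. (lam e * inner b e) *\<^sub>R e) - (\<Sum>e\<in>?W. inner b e *\<^sub>R e)"
    unfolding Tn_def C by simp
  also have "\<dots> = (\<Sum>e\<in>?W. ((lam e / \<Lambda> - 1) * inner b e) *\<^sub>R e)"
    by (simp add: scaleR_right.sum sum_subtractf[symmetric] left_diff_distrib scaleR_diff_left)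
  finally have "(norm (Tn \<Lambda> b - b))\<^sup>2 = (\<Sum>e\<in>?W. ((lam e / \<Lambda> - 1) * inner b e)\<^sup>2)"
    using onb_norm_sum[OF onb Win_finite] by simp
  also have "\<dots> \<le> (\<Sum>e\<in>?W. (1/100000)\<^sup>2 * (inner b e)\<^sup>2)"
  proof (rule sum_mono)
    fix e assume "e \<in> ?W"
    then have "0 \<le> lam e / \<Lambda> - 1" "lam e / \<Lambda> - 1 \<le> 1/100000"
      using \<Lambda> by (auto simp: Win_def field_simps)
    then have "(lam e / \<Lambda> - 1)\<^sup>2 \<le> (1/100000)\<^sup>2" by (intro power_mono)
    then show "((lam e / \<Lambda> - 1) * inner b e)\<^sup>2 \<le> (1/100000)\<^sup>2 * (inner b e)\<^sup>2"
      unfolding power_mult_distrib by (rule mult_right_mono) simp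
  qed
  also have "\<dots> = ((1/100000) * norm b)\<^sup>2"
    unfolding power_mult_distrib norm_span[OF onb Win_finite bp(5)] by (simp add: sum_distrib_left)
  finally show "norm (Tn \<Lambda> b - b) \<le> (1/100000) * norm b" by (rule power2_le_imp_le) simp
qed

lemma Tn_MM: "x \<in> MM \<Longrightarrow> Tn \<Lambda> x \<in> MM"
  unfolding Tn_def by (intro subspace_scale[OF MM_subspace] MM_props)

lemma Tn_add: "x \<in> MM \<Longrightarrow> y \<in> MM \<Longrightarrow> Tn \<Lambda> (x + y) = Tn \<Lambda> x + Tn \<Lambda> y"
  and Tn_scale: "x \<in> MM \<Longrightarrow> Tn \<Lambda> (c *\<^sub>R x) = c *\<^sub>R Tn \<Lambda> x"
  by (simp_all add: Tn_def Casimir_add Casimir_scale MM_props scaleR_add_right)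

lemma Tn_inner: "x \<in> MM \<Longrightarrow> y \<in> MM \<Longrightarrow> inner (Tn \<Lambda> x) y = inner x (Tn \<Lambda> y)"
  by (simp add: Tn_def Cas_inner)

lemma Nn_add: "x \<in> MM \<Longrightarrow> y \<in> MM \<Longrightarrow> Nn \<Lambda> (x + y) \<le> Nn \<Lambda> x + Nn \<Lambda> y"
  using norm_triangle_ineq[of x y] norm_triangle_ineq[of "Tn \<Lambda> x" "Tn \<Lambda> y"] by (simp add: Nn_def Tn_add)

lemma Nn_scale: "x \<in> MM \<Longrightarrow> Nn \<Lambda> (c *\<^sub>R x) = \<bar>c\<bar> * Nn \<Lambda> x"
  by (simp add: Nn_def Tn_scale distrib_left)

lemma Nn_nonneg: "0 \<le> Nn \<Lambda> x" by (simp add: Nn_def)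

lemma Nn_diff: "x \<in> MM \<Longrightarrow> y \<in> MM \<Longrightarrow> Nn \<Lambda> (x - y) \<le> Nn \<Lambda> x + Nn \<Lambda> y"
  using Nn_add[of x "(-1) *\<^sub>R y" \<Lambda>] Nn_scale[of y \<Lambda> "-1"] subspace_scale[OF MM_subspace, of y "-1"] by simp

text \<open>Expansion in the finite basis of the window gives a crude bound. Only finiteness
  matters: it is what allows \<open>Zs\<close> to be absorbed into the left-hand side later.\<close>

lemma Zs_bdd: "bdd_above ((\<lambda>b. Nn \<Lambda> (m b b)) ` {b \<in> WR \<Lambda>. norm b \<le> 1})"
proof -
  let ?W = "Win \<Lambda>"
  have onb: "onb ?W" by (rule onb_subset[OF BB_onb Win_BB])
  have WH: "?W \<subseteq> Hf" using Win_BB BB_Hf by blast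
  show ?thesis
  proof (rule bdd_aboveI2)
    fix b assume "b \<in> {b \<in> WR \<Lambda>. norm b \<le> 1}"
    then have b: "b \<in> WR \<Lambda>" "norm b \<le> 1" by auto
    note bp = WR_props[OF b(1)]
    have beq: "(\<Sum>e\<in>?W. inner b e *\<^sub>R e) = b" using proj_eq[OF onb Win_finite bp(5)] by (simp add: proj_def)
    have coef: "\<bar>inner b e\<bar> \<le> 1" if "e \<in> ?W" for e
    proof -
      have "norm e = 1" using onb that by (simp add: onb_def norm_eq_1)
      then show ?thesis using Cauchy_Schwarz_ineq2[of b e] b(2) by simp
    qed
    have step: "Nn \<Lambda> (m b x) \<le> (\<Sum>e\<in>?W. Nn \<Lambda> (m e x))" if x: "x \<in> Hf" for x
    proof -
      have "Nn \<Lambda> (m (\<Sum>e\<in>?W. inner b e *\<^sub>R e) x) \<le> (\<Sum>e\<in>?W. \<bar>inner b e\<bar> * Nn \<Lambda> (m e x))"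
        by (rule m_sum_bound[OF Nn_add Nn_scale Win_finite WH x])
      also have "\<dots> \<le> (\<Sum>e\<in>?W. Nn \<Lambda> (m e x))"
        by (intro sum_mono mult_left_le_one_le coef Nn_nonneg) simp
      finally show ?thesis by (simp only: beq)
    qed
    have "Nn \<Lambda> (m b b) \<le> (\<Sum>e\<in>?W. Nn \<Lambda> (m e b))" by (rule step[OF bp(1)])
    also have "\<dots> \<le> (\<Sum>e\<in>?W. \<Sum>f\<in>?W. Nn \<Lambda> (m f e))"
    proof (rule sum_mono)
      fix e assume "e \<in> ?W"
      then have e: "e \<in> Hf" using WH by blast
      have "m e b = m b e" by (rule m_commute[OF e bp(1)])
      then show "Nn \<Lambda> (m e b) \<le> (\<Sum>f\<in>?W. Nn \<Lambda> (m f e))" using step[OF e] by simp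
    qed
    finally show "Nn \<Lambda> (m b b) \<le> (\<Sum>e\<in>?W. \<Sum>f\<in>?W. Nn \<Lambda> (m f e))" .
  qed
qed

lemma Nn_le_Zs: "b \<in> WR \<Lambda> \<Longrightarrow> norm b \<le> 1 \<Longrightarrow> Nn \<Lambda> (m b b) \<le> Zs \<Lambda>"
  unfolding Zs_def by (rule cSUP_upper[OF _ Zs_bdd]) simp

lemma Zs_nonneg: "0 \<le> Zs \<Lambda>"
  by (rule order_trans[OF Nn_nonneg Nn_le_Zs[OF subspace_0[OF WR_subspace]]]) simp

lemma Nn_square: assumes b: "b \<in> WR \<Lambda>" shows "Nn \<Lambda> (m b b) \<le> Zs \<Lambda> * (norm b)\<^sup>2"
proof (cases "b = 0")
  case True
  have "m 0 0 = 0 *\<^sub>R m 0 0" using m_scale_left[OF Hf_0 Hf_0, of 0] by simp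
  then have "Nn \<Lambda> (m 0 0) = 0" using Nn_scale[OF m_MM[OF Hf_0 Hf_0], of \<Lambda> 0] by simp
  then show ?thesis using True by simp
next
  case False
  define c where "c = (1 / norm b) *\<^sub>R b"
  have c: "c \<in> WR \<Lambda>" "norm c = 1" using False b WR_subspace by (auto simp: c_def subspace_scale)
  have b': "b = norm b *\<^sub>R c" using False by (simp add: c_def)
  have "m b b = (norm b)\<^sup>2 *\<^sub>R m c c"
    by (subst (1 2) b') (simp add: m_linear Hf_closed WR_props[OF c(1)] power2_eq_square)
  then have "Nn \<Lambda> (m b b) = (norm b)\<^sup>2 * Nn \<Lambda> (m c c)"
    using Nn_scale[OF m_MM[OF WR_props(1)[OF c(1)] WR_props(1)[OF c(1)]]] by simp
  also have "\<dots> \<le> (norm b)\<^sup>2 * Zs \<Lambda>"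
    by (intro mult_left_mono Nn_le_Zs c) (simp_all add: c)
  finally show ?thesis by (simp add: mult.commute)
qed

text \<open>Polarisation and the parallelogram law pass from squares to products without loss in the
  constant. The bilinear bound is what permits replacing \<open>Tn \<Lambda> b\<close> by
  \<open>b\<close> in one factor.\<close>

lemma Nn_polar_unit:
  assumes b: "b \<in> WR \<Lambda>" "norm b = 1" and c: "c \<in> WR \<Lambda>" "norm c = 1"
  shows "Nn \<Lambda> (m b c) \<le> Zs \<Lambda>"
proof -
  note bH = WR_props(1)[OF b(1)] and cH = WR_props(1)[OF c(1)]
  have four: "4 *\<^sub>R x = x + x + (x + x)" for x :: 'h by (simp flip: scaleR_2 scaleR_add_left)
  have "4 *\<^sub>R m b c = m (b + c) (b + c) - m (b - c) (b - c)"
    unfolding four by (simp add: m_linear Hf_closed bH cH m_commute[of c b])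
  then have "4 * Nn \<Lambda> (m b c) \<le> Nn \<Lambda> (m (b + c) (b + c)) + Nn \<Lambda> (m (b - c) (b - c))"
    using Nn_scale[OF m_MM[OF bH cH], of \<Lambda> 4] Nn_diff[of "m (b + c) (b + c)" "m (b - c) (b - c)" \<Lambda>]
    by (simp add: m_MM Hf_closed bH cH)
  also have "\<dots> \<le> Zs \<Lambda> * (norm (b + c))\<^sup>2 + Zs \<Lambda> * (norm (b - c))\<^sup>2"
    by (intro add_mono Nn_square subspace_add[OF WR_subspace] subspace_diff[OF WR_subspace] b c)
  also have "\<dots> = Zs \<Lambda> * ((norm (b + c))\<^sup>2 + (norm (b - c))\<^sup>2)" by (simp add: distrib_left)
  also have "(norm (b + c))\<^sup>2 + (norm (b - c))\<^sup>2 = 2 * (norm b)\<^sup>2 + 2 * (norm c)\<^sup>2"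
    by (simp add: power2_norm_eq_inner inner_add inner_diff)
  finally show ?thesis by (simp add: b c)
qed

lemma Nn_polar:
  assumes b: "b \<in> WR \<Lambda>" and c: "c \<in> WR \<Lambda>"
  shows "Nn \<Lambda> (m b c) \<le> Zs \<Lambda> * norm b * norm c"
proof (cases "b = 0 \<or> c = 0")
  case True
  have "m b c = 0 *\<^sub>R m b c"
    using True m_scale_left[OF WR_props(1)[OF b] WR_props(1)[OF c], of 0] m_right(3)[OF WR_props(1)[OF b] WR_props(1)[OF c], of 0]
    by auto
  then have "Nn \<Lambda> (m b c) = 0" using Nn_scale[OF m_MM[OF WR_props(1)[OF b] WR_props(1)[OF c]], of \<Lambda> 0] by simp
  then show ?thesis using True by auto
next
  case False
  define b1 c1 where "b1 = (1 / norm b) *\<^sub>R b" and "c1 = (1 / norm c) *\<^sub>R c"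
  have u: "b1 \<in> WR \<Lambda>" "norm b1 = 1" "c1 \<in> WR \<Lambda>" "norm c1 = 1"
    using False b c WR_subspace by (auto simp: b1_def c1_def subspace_scale)
  have eq: "b = norm b *\<^sub>R b1" "c = norm c *\<^sub>R c1" using False by (simp_all add: b1_def c1_def)
  have "m b c = (norm b * norm c) *\<^sub>R m b1 c1"
    by (subst eq(1), subst eq(2)) (simp add: m_linear Hf_closed WR_props[OF u(1)] WR_props[OF u(3)] mult.commute)
  then have "Nn \<Lambda> (m b c) = (norm b * norm c) * Nn \<Lambda> (m b1 c1)"
    using Nn_scale[OF m_MM[OF WR_props(1)[OF u(1)] WR_props(1)[OF u(3)]]] by simp
  also have "\<dots> \<le> (norm b * norm c) * Zs \<Lambda>" by (intro mult_left_mono Nn_polar_unit u) simp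
  finally show ?thesis by (simp add: ac_simps)
qed

lemma u_linear:
  assumes "b \<in> Hf" "c \<in> Hf"
  shows "u1 (r *\<^sub>R b) c = r *\<^sub>R u1 b c" "u1 b (r *\<^sub>R c) = r *\<^sub>R u1 b c" "u2 (r *\<^sub>R b) c = r *\<^sub>R u2 b c" "u2 b (r *\<^sub>R c) = r *\<^sub>R u2 b c"
  using assms by (simp_all add: u1_def u2_def Ed_linear[where b = b] Hf_Ed Hf_Fd m_linear)

lemma MM_K_invariant: assumes "b \<in> Hf" "Kd b = 0" "c \<in> Hf" "Kd c = 0" shows "K_invariant \<pi> (m b c)"
proof (rule Kd_K_invariant[OF m_D1[OF assms(1,3)]])
  have "m 0 c = 0" "m b 0 = 0" using m_scale_left[OF Hf_0 assms(3), of 0] m_right(3)[OF assms(1) Hf_0, of 0] by simp_all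
  then show "Kd (m b c) = 0" using m_dvec(1)[OF assms(1,3)] by (simp add: assms)
qed

text \<open>The three nonnegative pairings of \<open>u1\<close>, \<open>u2\<close>,
  \<open>u3\<close> with \<open>F\<close>, weighted by 2t, t^2, t^3 and expanded by the recursions.
  Terms with an explicit \<open>t\<close> are commutator corrections. Dropping them and replacing
  \<open>b1\<close>, \<open>b2\<close>, \<open>b3\<close> by \<beta> leaves the cubic 4 - 15/2 s +
  7/2 s^2 - 1/2 s^3 in \<open>Tn \<Lambda>\<close>.\<close>

lemma positivity_relation:
  assumes \<Lambda>: "\<Lambda> > 0" and \<beta>: "\<beta> \<in> WR \<Lambda>"
  defines "F \<equiv> m \<beta> \<beta>" and "b1 \<equiv> Tn \<Lambda> \<beta>" and "b2 \<equiv> Tn \<Lambda> (Tn \<Lambda> \<beta>)" and "b3 \<equiv> Tn \<Lambda> (Tn \<Lambda> (Tn \<Lambda> \<beta>))" and "t \<equiv> 1 / \<Lambda>"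
  defines "P \<equiv> \<lambda>d b c. inner (m b c) ((Tn \<Lambda> ^^ d) F)"
  shows "0 \<le> 2 * P 0 b1 \<beta> - P 1 \<beta> \<beta>
     + (P 0 b2 \<beta> - 2 * P 1 b1 \<beta> + 1/2 * P 2 \<beta> \<beta> + 2 * (t * P 0 b1 \<beta>) - t * P 1 \<beta> \<beta>)
     + (P 0 b3 \<beta> - 3 * P 1 b2 \<beta> - 3/2 * P 1 b1 b1 + 3 * P 2 b1 \<beta> - 1/2 * P 3 \<beta> \<beta>
        - 2 * (t * P 1 b1 \<beta>) + t * P 2 \<beta> \<beta>
        + 8 * (t * P 0 b2 \<beta>) - 16 * (t * P 1 b1 \<beta>) + 4 * (t * P 2 \<beta> \<beta>)
        + 12 * (t * t * P 0 b1 \<beta>) - 6 * (t * t * P 1 \<beta> \<beta>))"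
proof -
  let ?T = "Tn \<Lambda>"
  have W: "\<beta> \<in> WR \<Lambda>" "b1 \<in> WR \<Lambda>" "b2 \<in> WR \<Lambda>" "b3 \<in> WR \<Lambda>"
    using \<beta> WR_Tn(1)[OF \<Lambda>] by (simp_all add: b1_def b2_def b3_def)
  have F: "F \<in> MM" using WR_props[OF \<beta>] by (simp add: F_def m_MM)
  have TF: "(?T ^^ d) F \<in> MM" for d using F by (induction d) (simp_all add: Tn_MM)
  have Cas_T: "Cas x = \<Lambda> *\<^sub>R ?T x" for x using \<Lambda> by (simp add: Tn_def)
  define U1 where "U1 d b c = t * inner (u1 b c) ((?T ^^ d) F)" for d b c
  define U2 where "U2 d b c = t * t * inner (u2 b c) ((?T ^^ d) F)" for d b c
  have t: "t * \<Lambda> = 1" "t > 0" using \<Lambda> by (simp_all add: t_def)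
  have Psym: "P d b c = P d c b" if "b \<in> WR \<Lambda>" "c \<in> WR \<Lambda>" for d b c
    unfolding P_def using m_commute[OF WR_props(1)[OF that(1)] WR_props(1)[OF that(2)]] by simp
  have Casin: "inner (Cas x) ((?T ^^ d) F) = \<Lambda> * inner x ((?T ^^ Suc d) F)" if "x \<in> MM" for x d
    using Cas_inner[OF that TF[of d]] by (simp add: Cas_T)
  have eq1: "U1 d b c + U1 d c b = P d (?T b) c + P d b (?T c) - P (Suc d) b c" if b: "b \<in> WR \<Lambda>" and c: "c \<in> WR \<Lambda>" for d b c
  proof -
    note bp = WR_props[OF b] and cp = WR_props[OF c] and Tb = WR_props(1)[OF WR_Tn(1)[OF \<Lambda> b]] and Tc = WR_props(1)[OF WR_Tn(1)[OF \<Lambda> c]]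
    have "inner (u1 b c + u1 c b) ((?T ^^ d) F) = \<Lambda> * (P d (?T b) c + P d b (?T c) - P (Suc d) b c)"
      unfolding u1_rec[OF bp(1,2) cp(1,2)] inner_diff_left inner_add_left Casin[OF m_MM[OF bp(1) cp(1)]] Cas_T[of b] Cas_T[of c] P_def
      by (simp add: m_linear bp cp Tb Tc distrib_left right_diff_distrib)
    then have "t * inner (u1 b c + u1 c b) ((?T ^^ d) F) = P d (?T b) c + P d b (?T c) - P (Suc d) b c"
      using t(1) by (simp add: mult.assoc[symmetric])
    then show ?thesis by (simp add: U1_def inner_add_left distrib_left)
  qed
  have eq2: "U2 d b c = U1 d (?T b) c + U1 d b (?T c) + 2 * (t * U1 d b c) - U1 (Suc d) b c - P d (?T b) (?T c)"
    if b: "b \<in> WR \<Lambda>" and c: "c \<in> WR \<Lambda>" for d b c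
  proof -
    note bp = WR_props[OF b] and cp = WR_props[OF c] and Tb = WR_props(1)[OF WR_Tn(1)[OF \<Lambda> b]] and Tc = WR_props(1)[OF WR_Tn(1)[OF \<Lambda> c]]
    have E: "inner (u2 b c) ((?T ^^ d) F) = \<Lambda> * inner (u1 (?T b) c) ((?T ^^ d) F) + \<Lambda> * inner (u1 b (?T c)) ((?T ^^ d) F)
        + 2 * inner (u1 b c) ((?T ^^ d) F) - \<Lambda> * inner (u1 b c) ((?T ^^ Suc d) F) - \<Lambda> * \<Lambda> * P d (?T b) (?T c)"
      unfolding u2_rec[OF bp(1,2) cp(1,2)] inner_diff_left inner_add_left Casin[OF u_MM(1)[OF bp(1) cp(1)]] Cas_T[of b] Cas_T[of c] P_def
      by (simp add: m_linear Hf_scale u_linear bp cp Tb Tc)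
    have "t * t * inner (u2 b c) ((?T ^^ d) F) = t * (t * \<Lambda>) * inner (u1 (?T b) c) ((?T ^^ d) F) + t * (t * \<Lambda>) * inner (u1 b (?T c)) ((?T ^^ d) F)
        + 2 * (t * (t * inner (u1 b c) ((?T ^^ d) F))) - t * (t * \<Lambda>) * inner (u1 b c) ((?T ^^ Suc d) F) - (t * \<Lambda>) * (t * \<Lambda>) * P d (?T b) (?T c)"
      unfolding E by (simp add: algebra_simps)
    then show ?thesis by (simp add: U1_def U2_def t(1))
  qed
  have eq3: "t * t * t * inner (u3 \<beta> \<beta>) F = U2 0 b1 \<beta> + U2 0 \<beta> b1 + 8 * (t * U2 0 \<beta> \<beta>) - U2 1 \<beta> \<beta>
     - (U1 0 b1 b1 + 2 * (t * (U1 0 b1 \<beta> + U1 0 \<beta> b1)) + 4 * (t * t * U1 0 \<beta> \<beta>))"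
  proof -
    note bp = WR_props[OF \<beta>] and Tb = WR_props(1)[OF W(2)]
    have Cb: "Cas \<beta> = \<Lambda> *\<^sub>R b1" by (simp add: Cas_T b1_def)
    have E: "inner (u3 \<beta> \<beta>) F = \<Lambda> * inner (u2 b1 \<beta>) F + \<Lambda> * inner (u2 \<beta> b1) F + 8 * inner (u2 \<beta> \<beta>) F - \<Lambda> * inner (u2 \<beta> \<beta>) (?T F)
      - (\<Lambda> * \<Lambda> * inner (u1 b1 b1) F + 2 * (\<Lambda> * inner (u1 b1 \<beta>) F + \<Lambda> * inner (u1 \<beta> b1) F) + 4 * inner (u1 \<beta> \<beta>) F)"
      unfolding u3_rec[OF bp(1,2) bp(1,2)] inner_diff_left inner_add_left inner_scaleR_left
        Casin[OF u_MM(2)[OF bp(1) bp(1)], of 0, simplified] Cb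
      by (simp add: Hf_scale u_linear bp Tb)
    have "t * t * t * inner (u3 \<beta> \<beta>) F = (t * \<Lambda>) * (t * t * inner (u2 b1 \<beta>) F) + (t * \<Lambda>) * (t * t * inner (u2 \<beta> b1) F)
      + 8 * (t * (t * t * inner (u2 \<beta> \<beta>) F)) - (t * \<Lambda>) * (t * t * inner (u2 \<beta> \<beta>) (?T F))
      - ((t * \<Lambda>) * (t * \<Lambda>) * (t * inner (u1 b1 b1) F) + 2 * ((t * \<Lambda>) * (t * (t * inner (u1 b1 \<beta>) F)) + (t * \<Lambda>) * (t * (t * inner (u1 \<beta> b1) F)))
      + 4 * (t * t * (t * inner (u1 \<beta> \<beta>) F)))"
      unfolding E by (simp add: algebra_simps)
    then show ?thesis by (simp add: U1_def U2_def t(1) distrib_left)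
  qed
  have T: "?T \<beta> = b1" "?T b1 = b2" "?T b2 = b3" by (simp_all add: b1_def b2_def b3_def)
  have s: "P d \<beta> b1 = P d b1 \<beta>" "P d \<beta> b2 = P d b2 \<beta>" "P d \<beta> b3 = P d b3 \<beta>" "P d b1 b2 = P d b2 b1" for d
    by (intro Psym W)+
  note e00 = eq1[OF W(1,1), unfolded T s] and e10 = eq1[OF W(2,1), unfolded T s] and e20 = eq1[OF W(3,1), unfolded T s]
    and e11 = eq1[OF W(2,2), unfolded T s]
  note f00 = eq2[OF W(1,1), unfolded T s] and f10 = eq2[OF W(2,1), unfolded T s] and f01 = eq2[OF W(1,2), unfolded T s]
  \<comment> \<open>The first recursion determines only symmetrised values of \<open>U1\<close>.
    This suffices: equal arguments can be halved, and unequal ones occur below only in symmetric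
    pairs.\<close>
  have U00: "U1 d \<beta> \<beta> = P d b1 \<beta> - 1/2 * P (Suc d) \<beta> \<beta>" for d using e00[of d] by simp
  have U11: "U1 0 b1 b1 = P 0 b2 b1 - 1/2 * P 1 b1 b1" using e11[of 0] by simp
  have A: "U2 d \<beta> \<beta> = P d b2 \<beta> - 2 * P (Suc d) b1 \<beta> + 1/2 * P (Suc (Suc d)) \<beta> \<beta> + 2 * (t * P d b1 \<beta>) - t * P (Suc d) \<beta> \<beta>" for d
    using f00[of d] e10[of d] U00[of d] U00[of "Suc d"] by (simp add: algebra_simps)
  have B: "U2 0 b1 \<beta> + U2 0 \<beta> b1 = P 0 b3 \<beta> + P 0 b2 b1 - 2 * P 1 b2 \<beta> - 2 * P 1 b1 b1 + P 2 b1 \<beta>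
      + 2 * (t * (U1 0 b1 \<beta> + U1 0 \<beta> b1))"
    using f10[of 0] f01[of 0] e20[of 0] U11 e10[of 1] by (simp add: algebra_simps numeral_2_eq_2)
  have "t * t * t * inner (u3 \<beta> \<beta>) F = P 0 b3 \<beta> - 3 * P 1 b2 \<beta> - 3/2 * P 1 b1 b1 + 3 * P 2 b1 \<beta> - 1/2 * P 3 \<beta> \<beta>
        - 2 * (t * P 1 b1 \<beta>) + t * P 2 \<beta> \<beta>
        + 8 * (t * P 0 b2 \<beta>) - 16 * (t * P 1 b1 \<beta>) + 4 * (t * P 2 \<beta> \<beta>)
        + 12 * (t * t * P 0 b1 \<beta>) - 6 * (t * t * P 1 \<beta> \<beta>)"
    unfolding eq3 B A U11 U00 by (simp add: algebra_simps numeral_2_eq_2 numeral_3_eq_3)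
  moreover have "t * t * inner (u2 \<beta> \<beta>) F = P 0 b2 \<beta> - 2 * P 1 b1 \<beta> + 1/2 * P 2 \<beta> \<beta> + 2 * (t * P 0 b1 \<beta>) - t * P 1 \<beta> \<beta>"
    using A[of 0] by (simp add: U2_def numeral_2_eq_2)
  moreover have "2 * (t * inner (u1 \<beta> \<beta>) F) = 2 * P 0 b1 \<beta> - P 1 \<beta> \<beta>"
    using U00[of 0] by (simp add: U1_def)
  moreover have "0 \<le> 2 * (t * inner (u1 \<beta> \<beta>) F) + t * t * inner (u2 \<beta> \<beta>) F + t * t * t * inner (u3 \<beta> \<beta>) F"
    using u_positive[OF WR_props(1,4)[OF \<beta>]] t(2) unfolding F_def by simp
  ultimately show ?thesis by simp
qed


text \<open>The bootstrap inequality. In the sum of positivity and the spectral cubic, pairings with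
  odd powers of \<open>Tn \<Lambda>\<close> cancel, so the low-frequency mass \<open>G\<close>
  controls the graph norm of F up to errors, and \<open>G\<close> is bounded through the known
  constant \<open>Dc\<close>.\<close>

lemma window_square:
  assumes \<Lambda>: "\<Lambda> \<ge> 100000" and Dc: "Dc \<ge> 0" "\<And>g. g \<in> span {e \<in> BB. lam e \<le> \<Lambda>} \<Longrightarrow> n4 g \<le> Dc * norm g"
    and \<beta>: "\<beta> \<in> WR \<Lambda>" "norm \<beta> \<le> 1"
  shows "(Nn \<Lambda> (m \<beta> \<beta>))\<^sup>2 \<le> 400 * (Dc\<^sup>2 * Zs \<Lambda>) + 16/100 * (Zs \<Lambda>)\<^sup>2"
proof -
  have \<Lambda>0: "\<Lambda> > 0" using \<Lambda> by simp
  define Z where "Z = Zs \<Lambda>"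
  have Z0: "Z \<ge> 0" by (simp add: Z_def Zs_nonneg)
  let ?T = "Tn \<Lambda>"
  define F where "F = m \<beta> \<beta>"
  define b1 where "b1 = ?T \<beta>"
  define b2 where "b2 = ?T (?T \<beta>)"
  define b3 where "b3 = ?T (?T (?T \<beta>))"
  define t where "t = 1 / \<Lambda>"
  define P where "P d b c = inner (m b c) ((?T ^^ d) F)" for d b c
  have W: "\<beta> \<in> WR \<Lambda>" "b1 \<in> WR \<Lambda>" "b2 \<in> WR \<Lambda>" "b3 \<in> WR \<Lambda>"
    using \<beta> WR_Tn(1)[OF \<Lambda>0] by (simp_all add: b1_def b2_def b3_def)
  note \<beta>p = WR_props[OF \<beta>(1)]
  have F: "F \<in> MM" using \<beta>p by (simp add: F_def m_MM)
  have FK: "K_invariant \<pi> F" unfolding F_def by (rule MM_K_invariant[OF \<beta>p(1,2) \<beta>p(1,2)])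
  have NF: "Nn \<Lambda> F \<le> Z" unfolding F_def Z_def by (rule Nn_le_Zs[OF \<beta>])
  define k where "k = Z * Z"
  have k0: "k \<ge> 0" using Z0 by (simp add: k_def)

  have Pb: "\<bar>P d b c\<bar> \<le> k * (norm b * norm c)" if d: "d \<le> 2" and b: "b \<in> WR \<Lambda>" and c: "c \<in> WR \<Lambda>" for d b c
  proof -
    have bc: "m b c \<in> MM" using WR_props(1)[OF b] WR_props(1)[OF c] by (rule m_MM)
    have two: "\<bar>P d b c\<bar> \<le> Nn \<Lambda> (m b c) * Nn \<Lambda> F"
    proof -
      have cs: "\<bar>inner x y\<bar> \<le> Nn \<Lambda> (m b c) * Nn \<Lambda> F"
        if "norm x \<le> Nn \<Lambda> (m b c)" "norm y \<le> Nn \<Lambda> F" for x y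
        by (rule order_trans[OF Cauchy_Schwarz_ineq2 mult_mono[OF that Nn_nonneg norm_ge_zero]])
      have nn: "norm x \<le> Nn \<Lambda> x" "norm (?T x) \<le> Nn \<Lambda> x" for x by (simp_all add: Nn_def)
      consider "d = 0" | "d = 1" | "d = 2" using d by linarith
      then show ?thesis
      proof cases
        case 1
        then show ?thesis unfolding P_def by (simp add: cs nn)
      next
        case 2
        then show ?thesis unfolding P_def by (simp add: cs nn)
      next
        case 3
        have "P d b c = inner (?T (m b c)) (?T F)"
          unfolding P_def 3 using Tn_inner[OF bc Tn_MM[OF F]] by (simp add: numeral_2_eq_2)
        then show ?thesis by (simp add: cs nn)
      qed
    qed
    also have "\<dots> \<le> (Z * norm b * norm c) * Z"
      by (intro mult_mono NF Nn_nonneg Nn_polar[OF b c, folded Z_def]) (simp_all add: Z0)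
    finally show ?thesis by (simp add: k_def ac_simps)
  qed
  have Pdiff: "P d (b - b') c = P d b c - P d b' c" "P d c (b - b') = P d c b - P d c b'"
    if "b \<in> WR \<Lambda>" "b' \<in> WR \<Lambda>" "c \<in> WR \<Lambda>" for d b b' c
    using that[THEN WR_props(1)] by (simp_all add: P_def m_linear inner_diff_left)

  define \<epsilon> :: real where "\<epsilon> = 1/100000"
  have T: "norm (?T b - b) \<le> \<epsilon> * norm b" if "b \<in> WR \<Lambda>" for b
    using WR_Tn(2)[OF \<Lambda>0 that] by (simp add: \<epsilon>_def)
  have \<epsilon>: "\<epsilon> \<ge> 0" "\<epsilon> \<le> 1/10" by (simp_all add: \<epsilon>_def)
  have grow: "norm (?T b) \<le> (1 + \<epsilon>) * norm b" if "b \<in> WR \<Lambda>" for b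
    using norm_triangle_ineq[of b "?T b - b"] T[OF that] by (simp add: distrib_right)
  have n1: "norm b1 \<le> 1 + \<epsilon>" and d1: "norm (b1 - \<beta>) \<le> \<epsilon>"
  proof -
    have "\<epsilon> * norm \<beta> \<le> \<epsilon>" "(1 + \<epsilon>) * norm \<beta> \<le> 1 + \<epsilon>" using \<beta>(2) \<epsilon>(1) by (simp_all add: mult_left_le)
    then show "norm b1 \<le> 1 + \<epsilon>" "norm (b1 - \<beta>) \<le> \<epsilon>"
      using grow[OF W(1)] T[OF W(1)] by (simp_all add: b1_def)
  qed
  have tb: "?T b1 = b2" "?T b2 = b3" by (simp_all add: b1_def b2_def b3_def)
  have n1': "norm b1 \<le> 11/10" using n1 \<epsilon> by simp
  have e1: "norm (b2 - b1) \<le> 11/10 * \<epsilon>"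
    using T[OF W(2)] mult_left_mono[OF n1' \<epsilon>(1)] by (simp add: tb mult.commute)
  have n2: "norm b2 \<le> 121/100"
  proof -
    have "(1 + \<epsilon>) * norm b1 \<le> 11/10 * (11/10)" using n1' \<epsilon> by (intro mult_mono) auto
    then show ?thesis using grow[OF W(2)] by (simp add: tb)
  qed
  have e2: "norm (b3 - b2) \<le> 121/100 * \<epsilon>"
    using T[OF W(3)] mult_left_mono[OF n2 \<epsilon>(1)] by (simp add: tb mult.commute)
  have d2: "norm (b2 - \<beta>) \<le> 4 * \<epsilon>"
    using norm_triangle_ineq[of "b2 - b1" "b1 - \<beta>"] e1 d1 \<epsilon>(1) by simp
  have d3: "norm (b3 - \<beta>) \<le> 4 * \<epsilon>"
    using norm_triangle_ineq[of "b3 - b2" "b2 - b1"] norm_triangle_ineq[of "b3 - b1" "b1 - \<beta>"] e1 e2 d1 \<epsilon>(1) by simp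
  define h where "h = \<epsilon> * k"
  have h0: "h \<ge> 0" using \<epsilon>(1) k0 by (simp add: h_def)
  have Pd: "\<bar>P d b \<beta> - P d \<beta> \<beta>\<bar> \<le> 4 * h" if "d \<le> 2" "b \<in> WR \<Lambda>" "norm (b - \<beta>) \<le> 4 * \<epsilon>" for d b
  proof -
    have "\<bar>P d b \<beta> - P d \<beta> \<beta>\<bar> = \<bar>P d (b - \<beta>) \<beta>\<bar>" using Pdiff(1)[OF that(2) W(1) W(1)] by simp
    also have "\<dots> \<le> k * (norm (b - \<beta>) * norm \<beta>)"
      by (intro Pb that(1) subspace_diff[OF WR_subspace] that(2) W)
    also have "\<dots> \<le> k * (4 * \<epsilon> * 1)"
      using that(3) \<beta>(2) \<epsilon>(1) by (intro mult_left_mono mult_mono k0) auto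
    finally show ?thesis by (simp add: h_def ac_simps)
  qed
  have d1': "norm (b1 - \<beta>) \<le> 4 * \<epsilon>" using d1 \<epsilon>(1) by simp
  have P11: "\<bar>P 1 b1 b1 - P 1 \<beta> \<beta>\<bar> \<le> 4 * h"
  proof -
    have "P 1 b1 b1 - P 1 \<beta> \<beta> = P 1 b1 (b1 - \<beta>) + P 1 (b1 - \<beta>) \<beta>"
      using Pdiff(2)[OF W(2) W(1) W(2), of 1] Pdiff(1)[OF W(2) W(1) W(1), of 1] by simp
    also have "\<bar>\<dots>\<bar> \<le> k * (norm b1 * norm (b1 - \<beta>)) + k * (norm (b1 - \<beta>) * norm \<beta>)"
      by (intro order_trans[OF abs_triangle_ineq] add_mono Pb subspace_diff[OF WR_subspace] W) simp_all
    also have "\<dots> \<le> k * (11/10 * \<epsilon>) + k * (\<epsilon> * 1)"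
      using n1' d1 \<beta>(2) \<epsilon>(1) by (intro add_mono mult_left_mono mult_mono k0) auto
    also have "\<dots> = 21/10 * h" by (simp add: h_def algebra_simps)
    also have "\<dots> \<le> 4 * h" using h0 by simp
    finally show ?thesis .
  qed
  have t: "0 \<le> t" "t \<le> \<epsilon>" "t \<le> 1" using \<Lambda> by (simp_all add: t_def \<epsilon>_def field_simps)
  have tP: "\<bar>t * P d b \<beta>\<bar> \<le> 2 * h" "\<bar>t * t * P d b \<beta>\<bar> \<le> 2 * h" if "d \<le> 2" "b \<in> WR \<Lambda>" "norm b \<le> 121/100" for d b
  proof -
    have "\<bar>P d b \<beta>\<bar> \<le> k * (norm b * norm \<beta>)" by (intro Pb that W)
    also have "\<dots> \<le> k * (121/100 * 1)" using that(3) \<beta>(2) by (intro mult_left_mono mult_mono k0) auto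
    also have "\<dots> \<le> 2 * k" using k0 by simp
    finally have p: "\<bar>P d b \<beta>\<bar> \<le> 2 * k" .
    have "\<bar>t * P d b \<beta>\<bar> = t * \<bar>P d b \<beta>\<bar>" using t by (simp add: abs_mult)
    also have "\<dots> \<le> \<epsilon> * (2 * k)" using t p \<epsilon>(1) by (intro mult_mono) auto
    finally show a: "\<bar>t * P d b \<beta>\<bar> \<le> 2 * h" by (simp add: h_def)
    have "\<bar>t * t * P d b \<beta>\<bar> = t * \<bar>t * P d b \<beta>\<bar>" using t by (simp add: abs_mult)
    also have "\<dots> \<le> 1 * \<bar>t * P d b \<beta>\<bar>" using t by (intro mult_right_mono) auto
    finally show "\<bar>t * t * P d b \<beta>\<bar> \<le> 2 * h" using a by simp
  qed
  have nb: "norm \<beta> \<le> 121/100" "norm b1 \<le> 121/100" using \<beta>(2) n1' by simp_all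
  define x0 x1 x2 x3 where "x0 = P 0 \<beta> \<beta>" and "x1 = P 1 \<beta> \<beta>" and "x2 = P 2 \<beta> \<beta>" and "x3 = P 3 \<beta> \<beta>"
  have up: "P d b \<beta> \<le> P d \<beta> \<beta> + 4 * h" and lo: "P d \<beta> \<beta> - 4 * h \<le> P d b \<beta>"
    if "d \<le> 2" "b \<in> WR \<Lambda>" "norm (b - \<beta>) \<le> 4 * \<epsilon>" for d b
    using Pd[OF that] unfolding abs_le_iff by linarith+
  have tup: "t * P d b \<beta> \<le> 2 * h" "t * t * P d b \<beta> \<le> 2 * h" and tlo: "- 2 * h \<le> t * P d b \<beta>" "- 2 * h \<le> t * t * P d b \<beta>"
    if "d \<le> 2" "b \<in> WR \<Lambda>" "norm b \<le> 121/100" for d b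
    using tP[OF that] unfolding abs_le_iff by linarith+
  have PF: "inner F ((?T ^^ d) F) = P d \<beta> \<beta>" for d by (simp add: P_def F_def)
  have ds: "(0::nat) \<le> 2" "(1::nat) \<le> 2" "(2::nat) \<le> 2" by simp_all
  have lo11: "P 1 \<beta> \<beta> - 4 * h \<le> P 1 b1 b1" using P11 unfolding abs_le_iff by linarith
  note bounds = up[OF ds(1) W(2) d1'] up[OF ds(1) W(3) d2] up[OF ds(1) W(4) d3] up[OF ds(3) W(2) d1']
    lo[OF ds(2) W(2) d1'] lo[OF ds(2) W(3) d2] lo11
    tup(1)[OF ds(1) W(2) nb(2)] tup(1)[OF ds(1) W(3) n2] tup(1)[OF ds(3) W(1) nb(1)] tup(2)[OF ds(1) W(2) nb(2)]
    tlo(1)[OF ds(2) W(1) nb(1)] tlo(1)[OF ds(2) W(2) nb(2)] tlo(2)[OF ds(2) W(1) nb(1)]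
  \<comment> \<open>Replacing \<open>b1\<close>, \<open>b2\<close> or \<open>b3\<close> by \<beta>
    costs at most \<open>4 * h\<close> per pairing, and a pairing with a factor \<open>t\<close> is
    at most \<open>2 * h\<close>; weighted with the coefficients the total stays below
    \<open>200 * h\<close>. The pairing \<open>P 3 \<beta> \<beta>\<close>, which the graph norm
    does not bound, needs no replacement.\<close>
  have "0 \<le> 4 * P 0 \<beta> \<beta> - 15/2 * P 1 \<beta> \<beta> + 7/2 * P 2 \<beta> \<beta> - 1/2 * P 3 \<beta> \<beta> + 200 * h"
    using positivity_relation[OF \<Lambda>0 \<beta>(1), folded F_def b1_def b2_def b3_def t_def, folded P_def, unfolded PF] bounds h0
    by linarith
  then have main: "0 \<le> 4 * x0 - 15/2 * x1 + 7/2 * x2 - 1/2 * x3 + 200 * h"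
    by (simp only: x0_def x1_def x2_def x3_def)

  have MT: "?T F \<in> MM" "?T (?T F) \<in> MM" "?T (?T (?T F)) \<in> MM" using F by (simp_all add: Tn_MM)
  have C1: "Cas x = \<Lambda> *\<^sub>R ?T x" for x using \<Lambda>0 by (simp add: Tn_def)
  have C2: "Cas (Cas F) = \<Lambda>\<^sup>2 *\<^sub>R ?T (?T F)"
    by (simp add: C1 Tn_scale MT power2_eq_square)
  have C3: "Cas (Cas (Cas F)) = \<Lambda> ^ 3 *\<^sub>R ?T (?T (?T F))"
    by (simp add: C1 Tn_scale MT subspace_scale[OF MM_subspace] power3_eq_cube)
  have tL: "t * \<Lambda> = 1" using \<Lambda>0 by (simp add: t_def)
  have x: "x0 = inner F F" "x1 = inner F (?T F)" "x2 = inner F (?T (?T F))" "x3 = inner F (?T (?T (?T F)))"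
    by (simp_all add: x0_def x1_def x2_def x3_def P_def F_def[symmetric] numeral_2_eq_2 numeral_3_eq_3)
  define S0 where "S0 = {e \<in> BB. lam e \<le> \<Lambda>}"
  define G where "G = (\<Sum>e\<in>S0. (inner F e)\<^sup>2)"
  have "inner ((- (4 + 1/40)) *\<^sub>R F + (15/2 * t) *\<^sub>R Cas F + (- (7/2 + 1/40) * t\<^sup>2) *\<^sub>R Cas (Cas F) + (1/2 * t ^ 3) *\<^sub>R Cas (Cas (Cas F))) F
     + 5 * (\<Sum>e\<in>{e \<in> BB. lam e \<le> \<Lambda>}. (inner F e)\<^sup>2) \<ge> 0"
  proof (rule spectral_positivity[OF F FK])
    fix e assume "e \<in> BB"
    then have l: "lam e \<ge> 0" by (rule BB_lam)
    define s where "s = t * lam e"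
    have s0: "s \<ge> 0" using l t by (simp add: s_def)
    have q: "- (4 + 1/40) + 15/2 * t * lam e + - (7/2 + 1/40) * t\<^sup>2 * (lam e)\<^sup>2 + 1/2 * t ^ 3 * lam e ^ 3
       = - (4 + 1/40) + 15/2 * s - (7/2 + 1/40) * s\<^sup>2 + 1/2 * s ^ 3"
      by (simp add: s_def power_mult_distrib)
    show "0 \<le> - (4 + 1/40) + 15/2 * t * lam e + - (7/2 + 1/40) * t\<^sup>2 * (lam e)\<^sup>2 + 1/2 * t ^ 3 * lam e ^ 3
       + (if lam e \<le> \<Lambda> then 5 else 0)"
    proof (cases "lam e \<le> \<Lambda>")
      case True
      then have "s \<le> 1" using \<Lambda>0 by (simp add: s_def t_def)
      then show ?thesis unfolding q using cubic_bound_low[OF s0] True by simp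
    next
      case False
      then have "s \<ge> 1" using \<Lambda>0 by (simp add: s_def t_def)
      then show ?thesis unfolding q using cubic_bound False by simp
    qed
  qed
  then have spec: "0 \<le> - (4 + 1/40) * x0 + 15/2 * ((t * \<Lambda>) * x1) - (7/2 + 1/40) * ((t * \<Lambda>)\<^sup>2 * x2) + 1/2 * ((t * \<Lambda>) ^ 3 * x3) + 5 * G"
    unfolding C3 unfolding C2 unfolding C1[of F] G_def S0_def x inner_add_left inner_scaleR_left
    by (simp add: inner_commute power_mult_distrib mult.assoc)
  have x2: "x2 = (norm (?T F))\<^sup>2" using Tn_inner[OF F MT(1)] by (simp add: x power2_norm_eq_inner)
  have x0: "x0 = (norm F)\<^sup>2" by (simp add: x power2_norm_eq_inner)
  \<comment> \<open>Adding \<open>spec\<close> and \<open>main\<close> cancels \<open>x1\<close> and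
    \<open>x3\<close> and leaves (x0 + x2)/40 <= 5 G + 200 h.\<close>
  have sum: "(norm F)\<^sup>2 + (norm (?T F))\<^sup>2 \<le> 200 * G + 8000 * h"
    using spec main unfolding tL x0[symmetric] x2[symmetric] by (simp add: algebra_simps)
  have "(Nn \<Lambda> F)\<^sup>2 \<le> 2 * ((norm F)\<^sup>2 + (norm (?T F))\<^sup>2)"
    using sum_squares_bound[of "norm F" "norm (?T F)"] by (simp add: Nn_def power2_sum)
  with sum have fin: "(Nn \<Lambda> F)\<^sup>2 \<le> 400 * G + 16000 * h" by simp

  have S0: "finite S0" "S0 \<subseteq> BB" using BB_finite by (auto simp: S0_def)
  define g where "g = proj S0 F"
  have gs: "g \<in> span S0" by (simp add: g_def proj_span)
  have gH: "g \<in> Hf" using span_BB(1) span_mono[OF S0(2)] gs by blast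
  have Gg: "(norm g)\<^sup>2 = G" using onb_norm_sum[OF onb_subset[OF BB_onb S0(2)] S0(1)] by (simp add: g_def proj_def G_def)
  have "G = inner F g" by (simp add: g_def inner_proj_right G_def power2_eq_square)
  also have "\<dots> = inner \<beta> (m \<beta> g)" using cj_inner[OF \<beta>p(1) \<beta>p(1) gH] by (simp add: F_def \<beta>p(4))
  also have "\<dots> \<le> norm \<beta> * norm (m \<beta> g)" by (rule norm_cauchy_schwarz)
  also have "\<dots> \<le> 1 * (n4 \<beta> * n4 g)" using \<beta>(2) norm_m_le[OF \<beta>p(1) gH] by (intro mult_mono) auto
  also have "\<dots> \<le> n4 \<beta> * (Dc * norm g)"
    using Dc(2)[of g] gs by (simp add: S0_def mult_left_mono n4_nonneg)
  finally have "norm g * norm g \<le> (n4 \<beta> * Dc) * norm g" using Gg by (simp add: power2_eq_square ac_simps)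
  then have "norm g \<le> n4 \<beta> * Dc"
    using n4_nonneg Dc(1) by (cases "norm g = 0") (auto simp: mult_le_cancel_right)
  then have "G \<le> (n4 \<beta> * Dc)\<^sup>2" unfolding Gg[symmetric] by (intro power_mono) auto
  also have "\<dots> = Dc\<^sup>2 * norm F" by (simp add: power_mult_distrib n4_sq F_def)
  also have "\<dots> \<le> Dc\<^sup>2 * Z" using NF by (intro mult_left_mono) (auto simp: Nn_def intro: order_trans[rotated])
  finally have "G \<le> Dc\<^sup>2 * Z" .
  \<comment> \<open>Here the width 1/100000 pays off: the error coefficient is 16/100, and a value
    below 1 can be absorbed.\<close>
  moreover have "16000 * h = 16/100 * Z\<^sup>2" by (simp add: h_def k_def \<epsilon>_def power2_eq_square)
  ultimately show ?thesis using fin by (simp add: F_def Z_def)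
qed

text \<open>The supremum over the unit ball turns the bootstrap into 0.84 Z^2 <= 400 Dc^2 Z, so Z is
  at most 477 Dc^2; this is rounded up to the square 529 = 23^2.\<close>

lemma window_bound:
  assumes \<Lambda>: "\<Lambda> \<ge> 100000" and Dc: "Dc \<ge> 0" "\<And>g. g \<in> span {e \<in> BB. lam e \<le> \<Lambda>} \<Longrightarrow> n4 g \<le> Dc * norm g"
    and b: "b \<in> WR \<Lambda>"
  shows "n4 b \<le> 23 * Dc * norm b"
proof -
  define Z where "Z = Zs \<Lambda>"
  have Z0: "Z \<ge> 0" by (simp add: Z_def Zs_nonneg)
  define R where "R = 400 * (Dc\<^sup>2 * Z) + 16/100 * Z\<^sup>2"
  have "Nn \<Lambda> (m c c) \<le> sqrt R" if "c \<in> WR \<Lambda>" "norm c \<le> 1" for c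
    using window_square[OF \<Lambda> Dc that] by (intro real_le_rsqrt) (simp add: R_def Z_def)
  moreover have "{b \<in> WR \<Lambda>. norm b \<le> 1} \<noteq> {}"
    using subspace_0[OF WR_subspace, of \<Lambda>] by (auto intro!: exI[of _ 0])
  ultimately have "Z \<le> sqrt R" unfolding Z_def Zs_def by (intro cSUP_least) auto
  then have "Z\<^sup>2 \<le> (sqrt R)\<^sup>2" using Z0 by (intro power_mono)
  also have "\<dots> = R" using Z0 by (simp add: R_def)
  finally have "84/100 * Z\<^sup>2 \<le> 400 * (Dc\<^sup>2 * Z)" by (simp add: R_def)
  then have "Z * (84/100 * Z) \<le> Z * (400 * Dc\<^sup>2)" by (simp add: power2_eq_square ac_simps)
  then have "84/100 * Z \<le> 400 * Dc\<^sup>2" using Z0 by (cases "Z = 0") (auto simp: mult_le_cancel_left)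
  then have Z: "Z \<le> 529 * Dc\<^sup>2" using zero_le_power2[of Dc] by linarith
  have "(n4 b)\<^sup>2 \<le> Nn \<Lambda> (m b b)" by (simp add: n4_sq Nn_def)
  also have "\<dots> \<le> Z * (norm b)\<^sup>2" unfolding Z_def by (rule Nn_square[OF b])
  also have "\<dots> \<le> (529 * Dc\<^sup>2) * (norm b)\<^sup>2" using Z by (intro mult_right_mono) auto
  also have "\<dots> = (23 * Dc * norm b)\<^sup>2" by (simp add: power_mult_distrib)
  finally show ?thesis by (rule power2_le_imp_le) (simp add: Dc)
qed

text \<open>The factor 47 = 1 + 2 * 23 collects the part below Lambda and the real and imaginary
  parts of the part in the window.\<close>

lemma low_bound_step:
  assumes \<Lambda>: "\<Lambda> \<ge> 100000" and Dc: "Dc \<ge> 0" "\<And>g. g \<in> span {e \<in> BB. lam e \<le> \<Lambda>} \<Longrightarrow> n4 g \<le> Dc * norm g"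
    and g: "g \<in> span {e \<in> BB. lam e \<le> (1 + 1/100000) * \<Lambda>}"
  shows "n4 g \<le> 47 * Dc * norm g"
proof -
  let ?S = "{e \<in> BB. lam e \<le> (1 + 1/100000) * \<Lambda>}" and ?Slow = "{e \<in> BB. lam e \<le> \<Lambda>}"
  have "\<Lambda> \<le> (1 + 1/100000) * \<Lambda>" using \<Lambda> by simp
  then have split_le: "lam e \<le> (1 + 1/100000) * \<Lambda> \<longleftrightarrow> lam e \<le> \<Lambda> \<or> (\<Lambda> < lam e \<and> lam e \<le> (1 + 1/100000) * \<Lambda>)" for e
    by linarith
  have union: "?S = ?Slow \<union> Win \<Lambda>"
  proof (rule set_eqI)
    fix e show "e \<in> ?S \<longleftrightarrow> e \<in> ?Slow \<union> Win \<Lambda>"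
      unfolding Win_def Un_iff mem_Collect_eq using split_le[of e] by blast
  qed
  have disj: "?Slow \<inter> Win \<Lambda> = {}" by (auto simp: Win_def)
  have fin: "finite ?S" "finite ?Slow" by (rule BB_finite)+
  have onb: "onb ?S" "onb ?Slow" "onb (Win \<Lambda>)" by (rule onb_subset[OF BB_onb], auto simp: Win_def)+
  define g1 where "g1 = proj ?Slow g"
  define g2 where "g2 = proj (Win \<Lambda>) g"
  have "g = proj ?S g" using proj_eq[OF onb(1) fin(1) g] by simp
  also have "\<dots> = g1 + g2" unfolding proj_def g1_def g2_def union
    by (rule sum.union_disjoint[OF fin(2) Win_finite disj])
  finally have gsum: "g = g1 + g2" .
  have nle: "norm (proj T g) \<le> norm g" if "onb T" "finite T" for T
  proof -
    have "(norm (proj T g))\<^sup>2 = inner g (proj T g)"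
      using onb_norm_sum[OF that, of "inner g"] by (simp add: inner_proj_right flip: proj_def) (simp add: power2_eq_square)
    also have "\<dots> \<le> norm g * norm (proj T g)" by (rule norm_cauchy_schwarz)
    finally show ?thesis by (cases "norm (proj T g) = 0") (auto simp: power2_eq_square mult_le_cancel_right)
  qed
  have n1: "norm g1 \<le> norm g" unfolding g1_def by (rule nle[OF onb(2) fin(2)])
  have n2: "norm g2 \<le> norm g" unfolding g2_def by (rule nle[OF onb(3) Win_finite])
  have s1: "g1 \<in> span ?Slow" and s2: "g2 \<in> span (Win \<Lambda>)" by (simp_all add: g1_def g2_def proj_span)
  have H1: "g1 \<in> Hf" using span_BB(1) span_mono[of ?Slow BB] s1 by blast
  have H2: "g2 \<in> Hf" using span_BB(1) span_mono[OF Win_BB] s2 by blast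
  \<comment> \<open>Real and imaginary parts of \<open>g2\<close>; division by 2i becomes half of
    \<open>J\<close> with the difference reversed.\<close>
  define r where "r = (1/2) *\<^sub>R (g2 + cj g2)"
  define s where "s = (1/2) *\<^sub>R J (cj g2 - g2)"
  have cjW: "cj g2 \<in> span (Win \<Lambda>)"
    using cj_span[of g2 "\<lambda>x. \<Lambda> < x \<and> x \<le> (1 + 1/100000) * \<Lambda>"] s2 by (simp add: Win_def)
  have JW: "J x \<in> span (Win \<Lambda>)" if "x \<in> span (Win \<Lambda>)" for x
    using J_span[of x "\<lambda>x. \<Lambda> < x \<and> x \<le> (1 + 1/100000) * \<Lambda>"] that by (simp add: Win_def)
  note cl = Hf_closed H2 cj_Hf
  have rW: "r \<in> WR \<Lambda>"
    unfolding WR_def using s2 cjW by (simp add: r_def span_add span_scale cj_scale cj_add cj_cj cl add.commute)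
  have "cj s = s" by (simp add: s_def cj_scale cj_J cj_diff cj_cj cl J_diff)
  moreover have "s \<in> span (Win \<Lambda>)" unfolding s_def by (intro span_scale JW span_diff s2 cjW)
  ultimately have sW: "s \<in> WR \<Lambda>" by (simp add: WR_def)
  have two: "x + x = 2 *\<^sub>R x" for x :: 'h by (simp add: scaleR_2)
  have "J s = (1/2) *\<^sub>R (g2 - cj g2)" by (simp add: s_def J_scale)
  then have "r + J s = (1/2) *\<^sub>R (g2 + g2)" by (simp add: r_def flip: scaleR_add_right)
  then have split: "g2 = r + J s" by (simp add: two)
  have nr: "norm r \<le> norm g" using norm_triangle_ineq[of g2 "cj g2"] n2 by (simp add: r_def norm_cj H2)
  have ns: "norm s \<le> norm g" using norm_triangle_ineq4[of "cj g2" g2] n2 by (simp add: s_def norm_cj H2)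
  have nonneg: "0 \<le> 23 * Dc" using Dc(1) by simp
  have "n4 g2 \<le> n4 r + n4 s"
    unfolding split using n4_add[OF WR_props(1)[OF rW] Hf_J[OF WR_props(1)[OF sW]]] n4_J[OF WR_props(1)[OF sW]] by simp
  also have "\<dots> \<le> 23 * Dc * norm g + 23 * Dc * norm g"
    by (intro add_mono order_trans[OF window_bound[OF \<Lambda> Dc rW]] order_trans[OF window_bound[OF \<Lambda> Dc sW]]
        mult_left_mono nr ns nonneg)
  finally have w: "n4 g2 \<le> 46 * Dc * norm g" by simp
  have "n4 g1 \<le> Dc * norm g" by (rule order_trans[OF Dc(2)[OF s1] mult_left_mono[OF n1 Dc(1)]])
  then show ?thesis using n4_add[OF H1 H2] w unfolding gsum[symmetric] by (simp add: algebra_simps)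
qed

section \<open>Iteration over geometric scales and summation over levels\<close>

definition D0 :: real where "D0 = 1 + (\<Sum>e\<in>{e \<in> BB. lam e \<le> 100000}. n4 e)"
definition Lk :: "nat \<Rightarrow> real" where "Lk k = 100000 * (1 + 1/100000) ^ k"

lemma D0_ge_1: "D0 \<ge> 1"
  unfolding D0_def by (simp add: sum_nonneg n4_nonneg)

lemma Lk_Suc: "Lk (Suc k) = (1 + 1/100000) * Lk k" and Lk_ge: "Lk k \<ge> 100000"
  by (simp_all add: Lk_def one_le_power)

text \<open>Each enlargement of the cut-off by 1 + 1/100000 costs a factor 47, so the growth is a
  power of the eigenvalue, with the huge exponent ln 47 / ln (1 + 1/100000). The start uses that
  only finitely many eigenvectors lie below 100000.\<close>

lemma polynomial_bound: "g \<in> span {e \<in> BB. lam e \<le> Lk k} \<Longrightarrow> n4 g \<le> 47 ^ k * D0 * norm g"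
proof (induction k arbitrary: g)
  case 0
  let ?S = "{e \<in> BB. lam e \<le> 100000}"
  have fin: "finite ?S" by (rule BB_finite)
  have onb: "onb ?S" by (rule onb_subset[OF BB_onb]) auto
  have g: "g \<in> span ?S" using 0 by (simp add: Lk_def)
  have "n4 g = n4 (\<Sum>e\<in>?S. inner g e *\<^sub>R e)" using proj_eq[OF onb fin g] by (simp add: proj_def)
  also have "\<dots> \<le> (\<Sum>e\<in>?S. n4 (inner g e *\<^sub>R e))" by (rule n4_sum[OF fin]) (simp add: Hf_scale BB_Hf)
  also have "\<dots> \<le> (\<Sum>e\<in>?S. norm g * n4 e)"
  proof (rule sum_mono)
    fix e assume e: "e \<in> ?S"
    then have "norm e = 1" using onb by (simp add: onb_def norm_eq_1)
    then have "\<bar>inner g e\<bar> \<le> norm g" using Cauchy_Schwarz_ineq2[of g e] by simp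
    then show "n4 (inner g e *\<^sub>R e) \<le> norm g * n4 e"
      using e by (simp add: n4_scale BB_Hf mult_right_mono n4_nonneg)
  qed
  also have "\<dots> = norm g * (\<Sum>e\<in>?S. n4 e)" by (rule sum_distrib_left[symmetric])
  also have "\<dots> \<le> norm g * D0" by (rule mult_left_mono) (simp_all add: D0_def)
  finally show ?case by (simp add: mult.commute)
next
  case (Suc k)
  have "n4 g \<le> 47 * (47 ^ k * D0) * norm g"
    using Suc D0_ge_1 by (intro low_bound_step[OF Lk_ge[of k]]) (simp_all add: Lk_Suc)
  then show ?case by (simp add: mult.assoc)
qed

definition lev :: "real \<Rightarrow> nat" where "lev l = (LEAST k. l \<le> Lk k)"

lemma lev: "l \<le> Lk (lev l)" and lev_bound: "l \<ge> 0 \<Longrightarrow> real (lev l) \<le> 1 + log_plus l / ln (1 + 1/100000)"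
proof -
  obtain k where k: "l / 100000 < (1 + 1/100000) ^ k"
    using real_arch_pow[of "1 + 1/100000" "l / 100000"] by auto
  then have "l \<le> Lk k" by (simp add: Lk_def field_simps)
  then show "l \<le> Lk (lev l)" unfolding lev_def by (rule LeastI)
  have ln0: "ln (1 + 1/100000 :: real) > 0" by simp
  have L0: "log_plus l > 0" by (simp add: log_plus_def)
  show "real (lev l) \<le> 1 + log_plus l / ln (1 + 1/100000)"
  proof (cases "lev l")
    case 0
    then show ?thesis using L0 ln0 by (simp add: divide_nonneg_nonneg add_nonneg_nonneg)
  next
    case (Suc j)
    then have "\<not> l \<le> Lk j" using not_less_Least[of j "\<lambda>k. l \<le> Lk k"] by (simp add: lev_def)
    moreover have "(1 + 1/100000 :: real) ^ j \<le> Lk j" by (simp add: Lk_def)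
    ultimately have "(1 + 1/100000) ^ j \<le> max l 2" by linarith
    then have "ln ((1 + 1/100000) ^ j) \<le> log_plus l" unfolding log_plus_def by (subst ln_le_cancel_iff) auto
    then have "real j * ln (1 + 1/100000) \<le> log_plus l" by (simp add: ln_realpow)
    then have "real j \<le> log_plus l / ln (1 + 1/100000)" using ln0 by (simp add: pos_le_divide_eq)
    then show ?thesis using Suc by simp
  qed
qed

text \<open>Grouping by level bounds \<open>n4\<close> by a sum of norms, not of squares. Weights
  (1/2)^k and Cauchy-Schwarz recover squares at the price of a factor 2 per level: 8836 = 94^2 with
  94 = 2 * 47. The prefactor 2 is a geometric series.\<close>

lemma n4_sq_bound:
  assumes S: "finite S" "S \<subseteq> BB"
  shows "(n4 (\<Sum>e\<in>S. c e *\<^sub>R e))\<^sup>2 \<le> (\<Sum>e\<in>S. 2 * D0\<^sup>2 * 8836 ^ lev (lam e) * (c e)\<^sup>2)"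
proof -
  let ?k = "\<lambda>e. lev (lam e)"
  define K where "K = ?k ` S"
  have K: "finite K" using S(1) by (simp add: K_def)
  define a where "a k = (\<Sum>e\<in>{e \<in> S. ?k e = k}. c e *\<^sub>R e)" for k
  have onb: "onb {e \<in> S. ?k e = k}" for k by (rule onb_subset[OF BB_onb]) (use S(2) in auto)
  have na: "(norm (a k))\<^sup>2 = (\<Sum>e\<in>{e \<in> S. ?k e = k}. (c e)\<^sup>2)" for k
    unfolding a_def using S(1) by (intro onb_norm_sum onb) simp
  have sp: "a k \<in> span {e \<in> BB. lam e \<le> Lk k}" for k
    unfolding a_def using S(2) lev by (intro span_sum span_scale span_base) auto
  have aH: "a k \<in> Hf" for k using span_BB(1) span_mono[of "{e \<in> BB. lam e \<le> Lk k}" BB] sp[of k] by blast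
  have "(\<Sum>e\<in>S. c e *\<^sub>R e) = (\<Sum>k\<in>K. a k)"
    unfolding a_def K_def by (rule sum.image_gen[OF S(1)])
  then have "n4 (\<Sum>e\<in>S. c e *\<^sub>R e) \<le> (\<Sum>k\<in>K. n4 (a k))" using n4_sum[OF K, of a] aH by simp
  also have "\<dots> \<le> (\<Sum>k\<in>K. 47 ^ k * D0 * norm (a k))" by (intro sum_mono polynomial_bound sp)
  also have "\<dots> = (\<Sum>k\<in>K. (1/2) ^ k * (94 ^ k * D0 * norm (a k)))"
  proof (rule sum.cong[OF refl])
    fix k
    have "(94::real) ^ k = 2 ^ k * 47 ^ k" by (simp flip: power_mult_distrib)
    then show "47 ^ k * D0 * norm (a k) = (1/2) ^ k * (94 ^ k * D0 * norm (a k))" by (simp add: power_divide)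
  qed
  finally have "(n4 (\<Sum>e\<in>S. c e *\<^sub>R e))\<^sup>2 \<le> (\<Sum>k\<in>K. (1/2) ^ k * (94 ^ k * D0 * norm (a k)))\<^sup>2"
    by (intro power_mono n4_nonneg)
  also have "\<dots> \<le> (\<Sum>k\<in>K. ((1/2) ^ k)\<^sup>2) * (\<Sum>k\<in>K. (94 ^ k * D0 * norm (a k))\<^sup>2)"
    by (rule Cauchy_Schwarz_ineq_sum)
  also have "\<dots> \<le> 2 * (\<Sum>k\<in>K. (94 ^ k * D0 * norm (a k))\<^sup>2)"
  proof (intro mult_right_mono sum_nonneg)
    have "(\<Sum>k\<in>K. ((1/2) ^ k)\<^sup>2) \<le> (\<Sum>k\<in>K. (1/2 :: real) ^ k)"
      by (intro sum_mono) (simp add: power2_eq_square mult_left_le power_le_one)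
    also have "\<dots> \<le> (\<Sum>k. (1/2) ^ k)" by (intro sum_le_suminf K) (auto simp: summable_geometric)
    also have "\<dots> = 2" by (simp add: suminf_geometric)
    finally show "(\<Sum>k\<in>K. ((1/2) ^ k)\<^sup>2) \<le> (2::real)" .
  qed simp
  also have "\<dots> = (\<Sum>k\<in>K. \<Sum>e\<in>{e \<in> S. ?k e = k}. 2 * D0\<^sup>2 * 8836 ^ ?k e * (c e)\<^sup>2)"
  proof -
    have "(94 ^ k * D0 * norm (a k))\<^sup>2 = (\<Sum>e\<in>{e \<in> S. ?k e = k}. D0\<^sup>2 * 8836 ^ ?k e * (c e)\<^sup>2)" for k
    proof -
      have "((94::real) ^ k)\<^sup>2 = 8836 ^ k" by (simp add: power2_eq_square flip: power_mult_distrib)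
      then show ?thesis by (simp add: power_mult_distrib na sum_distrib_left ac_simps)
    qed
    then show ?thesis by (simp add: sum_distrib_left mult.assoc)
  qed
  also have "\<dots> = (\<Sum>e\<in>S. 2 * D0\<^sup>2 * 8836 ^ ?k e * (c e)\<^sup>2)"
    unfolding K_def by (rule sum.image_gen[OF S(1), symmetric])
  finally show ?thesis .
qed

text \<open>The weight is at most exp(c + b L) with L = \<open>log_plus l\<close>. Since L >= ln 2,
  the constant and the linear term are both dominated by multiples of L^2, the two summands of
  \<open>A\<close>; the halving accounts for the square of the exponential.\<close>

lemma weight_bound:
  "\<exists>A\<ge>0. \<forall>l\<ge>0. 2 * D0\<^sup>2 * 8836 ^ lev l \<le> (exp (A * (log_plus l)\<^sup>2))\<^sup>2"
proof -
  define b where "b = ln 8836 / ln (1 + 1/100000 :: real)"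
  define c where "c = ln (2 * D0\<^sup>2) + ln (8836::real)"
  have D: "1 \<le> D0\<^sup>2" using D0_ge_1 by simp
  have b0: "b \<ge> 0" unfolding b_def by (intro divide_nonneg_nonneg) simp_all
  have c0: "c \<ge> 0" unfolding c_def using D by (intro add_nonneg_nonneg) simp_all
  define A where "A = (c / (ln 2)\<^sup>2 + b / ln 2) / 2"
  have "2 * D0\<^sup>2 * 8836 ^ lev l \<le> (exp (A * (log_plus l)\<^sup>2))\<^sup>2" if l: "l \<ge> 0" for l
  proof -
    define L where "L = log_plus l"
    have L: "L \<ge> ln 2" by (simp add: L_def log_plus_def)
    have ln2: "ln (2::real) > 0" by simp
    have "2 * D0\<^sup>2 * 8836 ^ lev l = exp (ln (2 * D0\<^sup>2) + real (lev l) * ln 8836)"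
    proof -
      have "0 < 2 * D0\<^sup>2" using D by linarith
      then show ?thesis by (simp add: exp_add exp_of_nat_mult)
    qed
    also have "\<dots> \<le> exp (c + b * L)"
    proof -
      have "real (lev l) * ln 8836 \<le> (1 + L / ln (1 + 1/100000)) * ln 8836"
        using lev_bound[OF l] by (intro mult_right_mono) (simp_all add: L_def)
      also have "\<dots> = ln 8836 + b * L" by (simp add: b_def algebra_simps)
      finally show ?thesis by (simp add: c_def)
    qed
    also have "\<dots> \<le> exp (2 * A * L\<^sup>2)"
    proof -
      have "(ln 2)\<^sup>2 \<le> L\<^sup>2" using L ln2 by (intro power_mono) auto
      then have "1 \<le> L\<^sup>2 / (ln 2)\<^sup>2" using ln2 by simp
      from mult_left_mono[OF this c0] have 1: "c \<le> c / (ln 2)\<^sup>2 * L\<^sup>2" by simp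
      have "L \<ge> 0" using L ln2 by linarith
      with L have "L * ln 2 \<le> L * L" by (rule mult_left_mono)
      then have "L \<le> L\<^sup>2 / ln 2" using ln2 by (simp add: pos_le_divide_eq power2_eq_square)
      from mult_left_mono[OF this b0] have 2: "b * L \<le> b / ln 2 * L\<^sup>2" by simp
      have "2 * A = c / (ln 2)\<^sup>2 + b / ln 2" unfolding A_def by (simp add: mult.commute)
      then have "2 * A * L\<^sup>2 = c / (ln 2)\<^sup>2 * L\<^sup>2 + b / ln 2 * L\<^sup>2" by (simp only: distrib_right)
      then show ?thesis using 1 2 by simp
    qed
    also have "\<dots> = (exp (A * L\<^sup>2))\<^sup>2" by (simp add: power2_eq_square flip: exp_add)
    finally show ?thesis by (simp add: L_def)
  qed
  moreover have "A \<ge> 0" using b0 c0 by (simp add: A_def)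
  ultimately show ?thesis by blast
qed

section \<open>Evaluation of the spectral norm on finite combinations of eigenvectors\<close>

lemma eigproj_eq:
  assumes S: "finite S" "S \<subseteq> BB" and \<alpha>: "\<alpha> = (\<Sum>e\<in>S. c e *\<^sub>R e)"
  shows "eigproj J \<pi> l \<alpha> = (\<Sum>e\<in>{e \<in> S. lam e = l}. c e *\<^sub>R e)"
proof -
  define p where "p = (\<Sum>e\<in>{e \<in> S. lam e = l}. c e *\<^sub>R e)"
  let ?X = "{w. smoothvec \<pi> w \<and> Cas w = l *\<^sub>R w}"
  have S': "finite {e \<in> S. lam e = l}" "{e \<in> S. lam e = l} \<subseteq> BB" using S by auto
  have ps: "p \<in> span {e \<in> S. lam e = l}" unfolding p_def by (intro span_sum span_scale span_base)
  have pH: "p \<in> Hf" using span_BB(1) span_mono[OF S'(2)] ps by blast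
  have "Cas p = (\<Sum>e\<in>{e \<in> S. lam e = l}. (lam e * inner p e) *\<^sub>R e)" by (rule Cas_span[OF S' ps])
  also have "\<dots> = l *\<^sub>R proj {e \<in> S. lam e = l} p" by (simp add: proj_def scaleR_right.sum)
  also have "\<dots> = l *\<^sub>R p" using proj_eq[OF onb_subset[OF BB_onb S'(2)] S'(1) ps] by simp
  finally have pX: "p \<in> ?X" using Hf_smooth[OF pH] by simp
  have diff: "\<alpha> - p = (\<Sum>e\<in>S - {e \<in> S. lam e = l}. c e *\<^sub>R e)"
    unfolding \<alpha> p_def using S(1) by (simp add: sum_diff)
  \<comment> \<open>Here \<open>u\<close> need not be K-invariant or in \<open>Hf\<close>; symmetry
    of \<open>Cas\<close> on smooth vectors still makes it orthogonal to eigenvectors with another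
    eigenvalue.\<close>
  have orth: "inner (\<alpha> - p) u = 0" if "u \<in> ?X" for u
  proof -
    have u: "smoothvec \<pi> u" "Cas u = l *\<^sub>R u" using that by auto
    have "inner e u = 0" if "e \<in> S - {e \<in> S. lam e = l}" for e
    proof -
      have e: "e \<in> BB" "lam e \<noteq> l" using that S(2) by auto
      have "lam e * inner e u = l * inner e u"
        using Casimir_sym[OF Hf_D2[OF BB_Hf[OF e(1)]] smooth_D2[OF u(1)]] by (simp add: BB_eigen[OF e(1)] u(2))
      then show ?thesis using e(2) by simp
    qed
    then show ?thesis unfolding diff inner_sum_left by (intro sum.neutral) simp
  qed
  have "?X \<subseteq> {u. inner (\<alpha> - p) u = 0}" using orth by blast
  moreover have "closed {u. inner (\<alpha> - p) u = 0}" by (intro closed_Collect_eq continuous_intros)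
  ultimately have cl: "closure ?X \<subseteq> {u. inner (\<alpha> - p) u = 0}" by (rule closure_minimal)
  have "(THE p. p \<in> closure ?X \<and> (\<forall>u\<in>closure ?X. inner (\<alpha> - p) u = 0)) = p"
  proof (rule the_equality)
    show "p \<in> closure ?X \<and> (\<forall>u\<in>closure ?X. inner (\<alpha> - p) u = 0)"
      using subsetD[OF closure_subset pX] cl by blast
    fix q assume q: "q \<in> closure ?X \<and> (\<forall>u\<in>closure ?X. inner (\<alpha> - q) u = 0)"
    have pc: "p \<in> closure ?X" by (rule subsetD[OF closure_subset pX])
    have "inner (\<alpha> - q) q = 0" "inner (\<alpha> - q) p = 0" "inner (\<alpha> - p) q = 0" "inner (\<alpha> - p) p = 0"
      using q pc cl by blast+
    then have "inner (q - p) (q - p) = 0" by (simp add: inner_diff inner_commute)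
    then show "q = p" by simp
  qed
  then show ?thesis unfolding eigproj_def Let_def p_def .
qed

text \<open>The sum over all real l has only finitely many nonzero terms, at the eigenvalues
  occurring in \<open>S\<close>; regrouping by eigenvalue gives the weighted coefficients.\<close>

lemma fDelta_eq:
  assumes S: "finite S" "S \<subseteq> BB" and \<alpha>: "\<alpha> = (\<Sum>e\<in>S. c e *\<^sub>R e)"
  shows "fDelta_norm_sq J \<pi> f \<alpha> = ennreal (\<Sum>e\<in>S. (f (lam e))\<^sup>2 * (c e)\<^sup>2)"
proof -
  have onb: "onb {e \<in> S. lam e = l}" for l by (rule onb_subset[OF BB_onb]) (use S(2) in auto)
  have n: "(norm (eigproj J \<pi> l \<alpha>))\<^sup>2 = (\<Sum>e\<in>{e \<in> S. lam e = l}. (c e)\<^sup>2)" for l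
    unfolding eigproj_eq[OF S \<alpha>] using S(1) by (intro onb_norm_sum onb) simp
  have z: "(norm (eigproj J \<pi> l \<alpha>))\<^sup>2 = 0" if "l \<notin> lam ` S" for l
    unfolding n by (intro sum.neutral) (use that in auto)
  have "fDelta_norm_sq J \<pi> f \<alpha> = (\<Sum>\<^sub>\<infinity>l\<in>lam ` S. ennreal ((\<bar>f l\<bar>)\<^sup>2 * (norm (eigproj J \<pi> l \<alpha>))\<^sup>2))"
    unfolding fDelta_norm_sq_def by (intro infsum_cong_neutral) (auto simp: z)
  also have "\<dots> = (\<Sum>l\<in>lam ` S. ennreal ((\<bar>f l\<bar>)\<^sup>2 * (norm (eigproj J \<pi> l \<alpha>))\<^sup>2))"
    using S(1) by (intro infsum_finite) simp
  also have "\<dots> = ennreal (\<Sum>l\<in>lam ` S. (\<bar>f l\<bar>)\<^sup>2 * (norm (eigproj J \<pi> l \<alpha>))\<^sup>2)"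
    by (intro sum_ennreal) simp
  also have "(\<Sum>l\<in>lam ` S. (\<bar>f l\<bar>)\<^sup>2 * (norm (eigproj J \<pi> l \<alpha>))\<^sup>2)
      = (\<Sum>l\<in>lam ` S. \<Sum>e\<in>{e \<in> S. lam e = l}. (f (lam e))\<^sup>2 * (c e)\<^sup>2)"
    unfolding n by (intro sum.cong refl) (simp add: sum_distrib_left)
  also have "\<dots> = (\<Sum>e\<in>S. (f (lam e))\<^sup>2 * (c e)\<^sup>2)" by (rule sum.image_gen[OF S(1), symmetric])
  finally show ?thesis .
qed

end

theorem theorem11p9:
  fixes J :: "'h::{real_inner,complete_space} \<Rightarrow> 'h"
    and \<pi> :: "real^2^2 \<Rightarrow> 'h \<Rightarrow> 'h" and \<V> :: "'h set set"
    and m :: "'h \<Rightarrow> 'h \<Rightarrow> 'h" and one :: 'h and cj :: "'h \<Rightarrow> 'h"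
  assumes "multiplicative_rep J \<pi> \<V> m one cj"
  shows "\<exists>A::real. A \<ge> 0 \<and> (\<forall>\<alpha>\<in>Hfin J \<pi> \<V>. K_invariant \<pi> \<alpha> \<longrightarrow>
           ennreal ((L4norm m \<alpha>)\<^sup>2) \<le> fDelta_norm_sq J \<pi> (\<lambda>l. exp (A * (log_plus l)\<^sup>2)) \<alpha>)"
proof -
  interpret mult_rep J \<pi> \<V> m one cj by (unfold_locales) (rule assms)
  obtain A where A: "A \<ge> 0" "\<And>l. l \<ge> 0 \<Longrightarrow> 2 * D0\<^sup>2 * 8836 ^ lev l \<le> (exp (A * (log_plus l)\<^sup>2))\<^sup>2"
    using weight_bound by blast
  have "ennreal ((L4norm m \<alpha>)\<^sup>2) \<le> fDelta_norm_sq J \<pi> (\<lambda>l. exp (A * (log_plus l)\<^sup>2)) \<alpha>"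
    if \<alpha>: "\<alpha> \<in> Hfin J \<pi> \<V>" "K_invariant \<pi> \<alpha>" for \<alpha>
  proof -
    obtain S c where S: "finite S" "S \<subseteq> BB" "\<alpha> = (\<Sum>e\<in>S. c e *\<^sub>R e)"
      using Hf_span_BB[OF \<alpha>] by (auto simp: span_explicit)
    have "(L4norm m \<alpha>)\<^sup>2 = (n4 (\<Sum>e\<in>S. c e *\<^sub>R e))\<^sup>2" by (simp add: L4norm_def n4_def S(3))
    also have "\<dots> \<le> (\<Sum>e\<in>S. 2 * D0\<^sup>2 * 8836 ^ lev (lam e) * (c e)\<^sup>2)" by (rule n4_sq_bound[OF S(1,2)])
    also have "\<dots> \<le> (\<Sum>e\<in>S. (exp (A * (log_plus (lam e))\<^sup>2))\<^sup>2 * (c e)\<^sup>2)"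
      using A(2) BB_lam S(2) by (intro sum_mono mult_right_mono) auto
    finally show ?thesis unfolding fDelta_eq[OF S] by (rule ennreal_leI)
  qed
  then show ?thesis using A(1) by blast
qed

end
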